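(* Let $(X,\Sigma,\mathfrak m)$ be a probability space and let $(\Omega,\mathsf d)$ be a compact metric space. The map sending a Radon $L^0$-valued measure $\mu\in\mathfrak M(\Omega;L^0(\mathfrak m))$ to its $\mathfrak m$-a.e. unique foliation $(\mu_x)_{x\in X}\subseteq\mathfrak M(\Omega)$ is an isometric isomorphism of random normed modules \[ \mathfrak M(\Omega;L^0(\mathfrak m))\to L^0_{w^*}(\mathfrak m;\mathfrak M(\Omega)). \]
   Context: $L^0(\mathfrak m)$ is the algebra of $\mathfrak m$-a.e. equivalence classes $[f]_{\mathfrak m}$ of measurable functions $X\to\mathbb R$, with the $\mathfrak m$-a.e. order and the distance $\int|f-g|\wedge1\,\mathrm d\mathfrak m$; $L^0_+(\mathfrak m)$ is its positive cone; $\bar L^0(\mathfrak m)$ is the complete lattice of classes of $[-\infty,+\infty]$-valued measurable functions, in which $\bigvee,\bigwedge$ are taken. Functions on $X$ are $\mathfrak m$-measurable if they are measurable with respect to the $\mathfrak m$-completion of $\Sigma$; their classes are identified with elements of $L^0(\mathfrak m)$. A sequence in $L^0_+(\mathfrak m)$ is summable if its partial sums are order bounded in $L^0(\mathfrak m)$. A random normed module with base $(X,\Sigma,\mathfrak m)$ is a module $M$ over $L^0(\mathfrak m)$ with a map $|\cdot|\colon M\to L^0_+(\mathfrak m)$ such that $|v|=0$ iff $v=0$, $|v+w|\le|v|+|w|$, $|f\cdot v|=|f||v|$. An isometric isomorphism is an $L^0(\mathfrak m)$-linear bijection preserving the $L^0$-norm. A (Borel) $L^0$-valued measure is a map $\mu\colon\mathscr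 B(\Omega)\to L^0(\mathfrak m)$ with $\mu(\varnothing)=0$ such that for pairwise disjoint Borel sets $(A_n)$ the sequence $(|\mu(A_n)|)_n$ is summable and $\mu(\bigcup_nA_n)=\sum_n\mu(A_n)$. Its total variation is $|\mu|(A)=\bigvee\{\sum_n|\mu(A_n)|:(A_n)_{n\in\mathbb N}\text{ Borel partition of }A\}$; it is of bounded variation if $|\mu|_{\rm TV}:=|\mu|(\Omega)\in L^0_+(\mathfrak m)$. It is Radon if moreover $|\mu|(U)=\bigvee\{|\mu|(K):K\subseteq U\text{ compact}\}$ for all open $U$ and $|\mu|(B)=\bigwedge\{|\mu|(U):U\text{ open},\,B\subseteq U\}$ for all Borel $B$. $\mathfrak M(\Omega;L^0(\mathfrak m))$ is the space of Radon $L^0$-valued measures, a random normed module with setwise operations and $L^0$-norm $|\cdot|_{\rm TV}$. $\mathfrak M(\Omega)$ is the Banach space of finite signed Radon measures on $\Omega$ with the total variation norm, i.e. the dual of $C(\Omega)$. A foliation of $\mu$ is a family $(\mu_x)_{x\in X}\subseteq\mathfrak M(\Omega)$ such that for every $A\in\mathscr B(\Omega)$ the function $x\mapsto\mu_x(A)$ is $\mathfrak m$-measurable and $\mu(A)=[\mu_\cdot(A)]_{\mathfrak m}$. It is a known fact that, for $(\Omega,\mathsf d)$ compact metric, every $\mu\in\mathfrak M(\Omega;L^0(\mathfrak m))$ has a foliation, and that it is unique up to modification on an $\mathfrak m$-null set of $x$. For a separable Banach space $\mathbb B$, $L^0_{w^*}(\mathfrak m;\mathbb B^* )$ is the space of maps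 $\omega\colon X\to\mathbb B^*$ such that $x\mapsto\omega(x)(v)$ is $\mathfrak m$-measurable for every $v\in\mathbb B$, modulo $\mathfrak m$-a.e. equality, with pointwise operations; it is a random normed module with $|\omega|(x)=\|\omega(x)\|_{\mathbb B^*}$ for $\mathfrak m$-a.e. $x$. Here $\mathbb B=C(\Omega)$ and $\mathbb B^*=\mathfrak M(\Omega)$. *)

theory Defs
  imports "HOL-Probability.Probability" "HOL-Algebra.Module" "HOL-Algebra.Lattice"
begin

section \<open>The algebra of measurable functions modulo almost everywhere equality\<close>

text \<open>
  The class of \<open>f\<close> consists of all \<open>M\<close>-measurable functions that are a.e. equal to \<open>f\<close>. The function
  \<open>f\<close> itself need only be measurable with respect to the completion of \<open>M\<close>; this realises the
  identification of classes of completion measurable functions with elements of \<open>L0 M\<close>.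
  Values outside \<open>space M\<close> are irrelevant.
\<close>

definition ae_class :: "'x measure \<Rightarrow> ('x \<Rightarrow> 'b::topological_space) \<Rightarrow> ('x \<Rightarrow> 'b) set" where
  "ae_class M f = {g \<in> borel_measurable M. AE x in M. g x = f x}"

text \<open>At type \<^typ>\<open>real\<close> this is the space \<open>L\<^sup>0\<close>, at type \<^typ>\<open>ereal\<close> its extended version.\<close>

definition L0 :: "'x measure \<Rightarrow> ('x \<Rightarrow> 'b::topological_space) set set" where
  "L0 M = ae_class M ` borel_measurable M"

definition rep :: "'f set \<Rightarrow> 'f" where
  "rep c = (SOME f. f \<in> c)"

definition L0_map :: "'x measure \<Rightarrow> ('b \<Rightarrow> 'c::topological_space) \<Rightarrow> ('x \<Rightarrow> 'b) set \<Rightarrow> ('x \<Rightarrow> 'c) set" where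
  "L0_map M h c = ae_class M (\<lambda>x. h (rep c x))"

definition L0_map2 ::
  "'x measure \<Rightarrow> ('a \<Rightarrow> 'b \<Rightarrow> 'c::topological_space) \<Rightarrow> ('x \<Rightarrow> 'a) set \<Rightarrow> ('x \<Rightarrow> 'b) set \<Rightarrow> ('x \<Rightarrow> 'c) set" where
  "L0_map2 M h c d = ae_class M (\<lambda>x. h (rep c x) (rep d x))"

definition L0_le :: "'x measure \<Rightarrow> ('x \<Rightarrow> 'b::ord) set \<Rightarrow> ('x \<Rightarrow> 'b) set \<Rightarrow> bool" where
  "L0_le M c d \<longleftrightarrow> (AE x in M. rep c x \<le> rep d x)"

definition L0_ring :: "'x measure \<Rightarrow> ('x \<Rightarrow> real) set ring" where
  "L0_ring M =
    \<lparr>carrier = L0 M,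
     mult = L0_map2 M (*),
     one = ae_class M (\<lambda>_. 1),
     zero = ae_class M (\<lambda>_. 0),
     add = L0_map2 M (+)\<rparr>"

definition L0_pos :: "'x measure \<Rightarrow> ('x \<Rightarrow> real) set set" where
  "L0_pos M = {c \<in> L0 M. L0_le M \<zero>\<^bsub>L0_ring M\<^esub> c}"

definition L0_abs :: "'x measure \<Rightarrow> ('x \<Rightarrow> real) set \<Rightarrow> ('x \<Rightarrow> real) set" where
  "L0_abs M = L0_map M abs"

definition L0_dist :: "'x measure \<Rightarrow> ('x \<Rightarrow> real) set \<Rightarrow> ('x \<Rightarrow> real) set \<Rightarrow> real" where
  "L0_dist M c d = (LINT x|M. min \<bar>rep c x - rep d x\<bar> 1)"

definition L0_sums :: "'x measure \<Rightarrow> (nat \<Rightarrow> ('x \<Rightarrow> real) set) \<Rightarrow> ('x \<Rightarrow> real) set \<Rightarrow> bool" where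
  "L0_sums M c s \<longleftrightarrow>
    s \<in> L0 M \<and> (\<lambda>N. L0_dist M (\<Oplus>\<^bsub>L0_ring M\<^esub>n\<in>{..<N}. c n) s) \<longlonglongrightarrow> 0"

definition L0_summable :: "'x measure \<Rightarrow> (nat \<Rightarrow> ('x \<Rightarrow> real) set) \<Rightarrow> bool" where
  "L0_summable M c \<longleftrightarrow>
    (\<forall>n. c n \<in> L0_pos M) \<and>
    (\<exists>b\<in>L0 M. \<forall>N. L0_le M (\<Oplus>\<^bsub>L0_ring M\<^esub>n\<in>{..<N}. c n) b)"

definition L0bar :: "'x measure \<Rightarrow> ('x \<Rightarrow> ereal) set gorder" where
  "L0bar M = \<lparr>carrier = L0 M, eq = (=), le = L0_le M\<rparr>"

definition L0_embed :: "'x measure \<Rightarrow> ('x \<Rightarrow> real) set \<Rightarrow> ('x \<Rightarrow> ereal) set" where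
  "L0_embed M = L0_map M ereal"


section \<open>Random normed modules\<close>

text \<open>
  Records for modules extend those for rings; the fields \<open>mult\<close> and \<open>one\<close> of a module carry no
  meaning and are left undefined below.
\<close>

record ('a, 'b) normed_module = "('a, 'b) module" +
  L0_norm :: "'b \<Rightarrow> 'a"

definition random_normed_module ::
  "'x measure \<Rightarrow> (('x \<Rightarrow> real) set, 'v, 'z) normed_module_scheme \<Rightarrow> bool" where
  "random_normed_module M V \<longleftrightarrow>
    Module.module (L0_ring M) V \<and>
    (\<forall>v\<in>carrier V. L0_norm V v \<in> L0_pos M) \<and>
    (\<forall>v\<in>carrier V. L0_norm V v = \<zero>\<^bsub>L0_ring M\<^esub> \<longleftrightarrow> v = \<zero>\<^bsub>V\<^esub>) \<and>
    (\<forall>v\<in>carrier V. \<forall>w\<in>carrier V.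
       L0_le M (L0_norm V (v \<oplus>\<^bsub>V\<^esub> w)) (L0_norm V v \<oplus>\<^bsub>L0_ring M\<^esub> L0_norm V w)) \<and>
    (\<forall>f\<in>L0 M. \<forall>v\<in>carrier V.
       L0_norm V (f \<odot>\<^bsub>V\<^esub> v) = L0_abs M f \<otimes>\<^bsub>L0_ring M\<^esub> L0_norm V v)"

definition isometric_isomorphism ::
  "'x measure \<Rightarrow> (('x \<Rightarrow> real) set, 'v, 'y) normed_module_scheme \<Rightarrow>
   (('x \<Rightarrow> real) set, 'w, 'z) normed_module_scheme \<Rightarrow> ('v \<Rightarrow> 'w) \<Rightarrow> bool" where
  "isometric_isomorphism M V W \<phi> \<longleftrightarrow>
    random_normed_module M V \<and> random_normed_module M W \<and>
    bij_betw \<phi> (carrier V) (carrier W) \<and>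
    (\<forall>v\<in>carrier V. \<forall>w\<in>carrier V. \<phi> (v \<oplus>\<^bsub>V\<^esub> w) = \<phi> v \<oplus>\<^bsub>W\<^esub> \<phi> w) \<and>
    (\<forall>f\<in>L0 M. \<forall>v\<in>carrier V. \<phi> (f \<odot>\<^bsub>V\<^esub> v) = f \<odot>\<^bsub>W\<^esub> \<phi> v) \<and>
    (\<forall>v\<in>carrier V. L0_norm W (\<phi> v) = L0_norm V v)"


section \<open>Radon measures with values in the algebra\<close>

definition borel_partition :: "(nat \<Rightarrow> 'w::topological_space set) \<Rightarrow> 'w set \<Rightarrow> bool" where
  "borel_partition B A \<longleftrightarrow> range B \<subseteq> sets borel \<and> disjoint_family B \<and> (\<Union>n. B n) = A"

text \<open>
  Set functions on the Borel sets are represented by functions on all sets that vanish on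
  non-Borel sets, so that equality of functions is equality on the Borel sets and setwise
  operations preserve the representation.
\<close>

definition L0_measure ::
  "'x measure \<Rightarrow> ('w::topological_space set \<Rightarrow> ('x \<Rightarrow> real) set) \<Rightarrow> bool" where
  "L0_measure M \<mu> \<longleftrightarrow>
    (\<forall>A\<in>sets borel. \<mu> A \<in> L0 M) \<and> (\<forall>A. A \<notin> sets borel \<longrightarrow> \<mu> A = \<zero>\<^bsub>L0_ring M\<^esub>) \<and>
    \<mu> {} = \<zero>\<^bsub>L0_ring M\<^esub> \<and>
    (\<forall>A. range A \<subseteq> sets borel \<longrightarrow> disjoint_family A \<longrightarrow>
       L0_summable M (\<lambda>n. L0_abs M (\<mu> (A n))) \<and>
       L0_sums M (\<lambda>n. \<mu> (A n)) (\<mu> (\<Union>n. A n)))"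

definition L0_variation ::
  "'x measure \<Rightarrow> ('w::topological_space set \<Rightarrow> ('x \<Rightarrow> real) set) \<Rightarrow> 'w set \<Rightarrow> ('x \<Rightarrow> ereal) set" where
  "L0_variation M \<mu> A =
    \<Squnion>\<^bsub>L0bar M\<^esub> {L0_embed M s | s B. borel_partition B A \<and> L0_sums M (\<lambda>n. L0_abs M (\<mu> (B n))) s}"

definition L0_bounded_variation ::
  "'x measure \<Rightarrow> ('w::topological_space set \<Rightarrow> ('x \<Rightarrow> real) set) \<Rightarrow> bool" where
  "L0_bounded_variation M \<mu> \<longleftrightarrow> L0_variation M \<mu> UNIV \<in> L0_embed M ` L0_pos M"

definition L0_radon ::
  "'x measure \<Rightarrow> ('w::topological_space set \<Rightarrow> ('x \<Rightarrow> real) set) \<Rightarrow> bool" where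
  "L0_radon M \<mu> \<longleftrightarrow>
    L0_measure M \<mu> \<and> L0_bounded_variation M \<mu> \<and>
    (\<forall>U. open U \<longrightarrow>
       L0_variation M \<mu> U = \<Squnion>\<^bsub>L0bar M\<^esub> {L0_variation M \<mu> K | K. compact K \<and> K \<subseteq> U}) \<and>
    (\<forall>B\<in>sets borel.
       L0_variation M \<mu> B = \<Sqinter>\<^bsub>L0bar M\<^esub> {L0_variation M \<mu> U | U. open U \<and> B \<subseteq> U})"

definition L0_radon_module ::
  "'x measure \<Rightarrow> (('x \<Rightarrow> real) set, 'w::topological_space set \<Rightarrow> ('x \<Rightarrow> real) set) normed_module" where
  "L0_radon_module M =
    \<lparr>carrier = {\<mu>. L0_radon M \<mu>},
     mult = undefined,
     one = undefined,
     zero = (\<lambda>A. \<zero>\<^bsub>L0_ring M\<^esub>),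
     add = (\<lambda>\<mu> \<nu> A. \<mu> A \<oplus>\<^bsub>L0_ring M\<^esub> \<nu> A),
     smult = (\<lambda>f \<mu> A. f \<otimes>\<^bsub>L0_ring M\<^esub> \<mu> A),
     L0_norm = (\<lambda>\<mu>. L0_map M real_of_ereal (L0_variation M \<mu> UNIV))\<rparr>"


section \<open>Finite signed Radon measures\<close>

definition signed_measure :: "('w::topological_space set \<Rightarrow> real) \<Rightarrow> bool" where
  "signed_measure \<nu> \<longleftrightarrow>
    (\<forall>A. A \<notin> sets borel \<longrightarrow> \<nu> A = 0) \<and> \<nu> {} = 0 \<and>
    (\<forall>A. range A \<subseteq> sets borel \<longrightarrow> disjoint_family A \<longrightarrow>
       (\<lambda>n. \<nu> (A n)) sums \<nu> (\<Union>n. A n))"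

definition variation :: "('w::topological_space set \<Rightarrow> real) \<Rightarrow> 'w set \<Rightarrow> ennreal" where
  "variation \<nu> A = Sup {(\<Sum>n. ennreal \<bar>\<nu> (B n)\<bar>) | B. borel_partition B A}"

definition radon :: "('w::topological_space set \<Rightarrow> real) \<Rightarrow> bool" where
  "radon \<nu> \<longleftrightarrow>
    signed_measure \<nu> \<and> variation \<nu> UNIV < \<infinity> \<and>
    (\<forall>U. open U \<longrightarrow> variation \<nu> U = Sup {variation \<nu> K | K. compact K \<and> K \<subseteq> U}) \<and>
    (\<forall>B\<in>sets borel. variation \<nu> B = Inf {variation \<nu> U | U. open U \<and> B \<subseteq> U})"

definition variation_norm :: "('w::topological_space set \<Rightarrow> real) \<Rightarrow> real" where
  "variation_norm \<nu> = enn2real (variation \<nu> UNIV)"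

text \<open>
  The Jordan decomposition: \<open>\<nu>\<^sup>+ = (|\<nu>| + \<nu>) / 2\<close> and \<open>\<nu>\<^sup>- = (|\<nu>| - \<nu>) / 2 = (-\<nu>)\<^sup>+\<close>.
\<close>

definition pos_part :: "('w::topological_space set \<Rightarrow> real) \<Rightarrow> 'w measure" where
  "pos_part \<nu> =
    measure_of UNIV (sets borel) (\<lambda>A. ennreal ((enn2real (variation \<nu> A) + \<nu> A) / 2))"

definition neg_part :: "('w::topological_space set \<Rightarrow> real) \<Rightarrow> 'w measure" where
  "neg_part \<nu> =
    measure_of UNIV (sets borel) (\<lambda>A. ennreal ((enn2real (variation \<nu> A) - \<nu> A) / 2))"

text \<open>The action of \<open>\<nu>\<close>, as an element of the dual of \<open>C(\<Omega>)\<close>, on a continuous function \<open>v\<close>.\<close>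

definition pairing :: "('w::topological_space set \<Rightarrow> real) \<Rightarrow> ('w \<Rightarrow> real) \<Rightarrow> real" where
  "pairing \<nu> v = (LINT w|pos_part \<nu>. v w) - (LINT w|neg_part \<nu>. v w)"


section \<open>Weakly* measurable maps into the space of Radon measures\<close>

definition wstar_measurable ::
  "'x measure \<Rightarrow> ('x \<Rightarrow> 'w::topological_space set \<Rightarrow> real) set" where
  "wstar_measurable M =
    {\<omega>. (\<forall>x\<in>space M. radon (\<omega> x)) \<and>
        (\<forall>v. continuous_on UNIV v \<longrightarrow>
           (\<lambda>x. pairing (\<omega> x) v) \<in> borel_measurable (completion M))}"

definition wstar_class ::
  "'x measure \<Rightarrow> ('x \<Rightarrow> 'w::topological_space set \<Rightarrow> real) \<Rightarrow> ('x \<Rightarrow> 'w set \<Rightarrow> real) set" where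
  "wstar_class M \<omega> = {\<omega>' \<in> wstar_measurable M. AE x in M. \<omega>' x = \<omega> x}"

definition L0_wstar_module ::
  "'x measure \<Rightarrow> (('x \<Rightarrow> real) set, ('x \<Rightarrow> 'w::topological_space set \<Rightarrow> real) set) normed_module" where
  "L0_wstar_module M =
    \<lparr>carrier = wstar_class M ` wstar_measurable M,
     mult = undefined,
     one = undefined,
     zero = wstar_class M (\<lambda>x A. 0),
     add = (\<lambda>c d. wstar_class M (\<lambda>x A. rep c x A + rep d x A)),
     smult = (\<lambda>f c. wstar_class M (\<lambda>x A. rep f x * rep c x A)),
     L0_norm = (\<lambda>c. ae_class M (\<lambda>x. variation_norm (rep c x)))\<rparr>"


section \<open>Foliations\<close>

definition foliation ::
  "'x measure \<Rightarrow> ('w::topological_space set \<Rightarrow> ('x \<Rightarrow> real) set) \<Rightarrow> ('x \<Rightarrow> 'w set \<Rightarrow> real) \<Rightarrow> bool" where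
  "foliation M \<mu> \<omega> \<longleftrightarrow>
    (\<forall>x\<in>space M. radon (\<omega> x)) \<and>
    (\<forall>A\<in>sets borel.
       (\<lambda>x. \<omega> x A) \<in> borel_measurable (completion M) \<and> \<mu> A = ae_class M (\<lambda>x. \<omega> x A))"

definition foliation_map ::
  "'x measure \<Rightarrow> ('w::topological_space set \<Rightarrow> ('x \<Rightarrow> real) set) \<Rightarrow> ('x \<Rightarrow> 'w set \<Rightarrow> real) set" where
  "foliation_map M \<mu> = (THE c. \<exists>\<omega>. foliation M \<mu> \<omega> \<and> c = wstar_class M \<omega>)"

end

theory Submission
  imports Defs
begin

text \<open>
  Choose representatives of \<open>\<mu> A\<close> for \<open>A\<close> in the countable algebra generated by the balls with
  rational radii around the points of a countable dense set. For a.e. \<open>x\<close> they form a bounded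
  finitely additive charge. Its positive and negative parts inherit from \<open>\<mu>\<close> continuity along
  balls of increasing radius, so members of the algebra are approximated from inside by closed sets,
  and compactness together with Caratheodory's theorem turns the parts into measures; their
  difference is \<open>\<mu>\<^sub>x\<close>. A foliation is unique because the algebra is countable and generates the
  Borel sets. Conversely, by regularity \<open>|\<mu>\<^sub>x|(B)\<close> is the supremum of
  \<open>|\<mu>\<^sub>x(B \<inter> A)| + |\<mu>\<^sub>x(B - A)|\<close> over the same countable algebra. Hence it is measurable in \<open>x\<close> and
  represents \<open>|\<mu>|(B)\<close>, so that the Radon measures are exactly the set functions with a foliation,
  and all remaining claims are pointwise statements.
\<close>

section \<open>Classes of measurable functions\<close>

text \<open>The obstacle is that every relation between values of \<mu> holds only off a null set
  depending on the sets involved, so that at a single point \<open>x\<close> only countably many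
  relations can be demanded at once. Countable additivity cannot be demanded this way: even a
  countable algebra may have uncountably many decreasing sequences. It is replaced by finite
  additivity, one bound, and smallness on the shells \<open>ball q r - ball q (r - 1/(n+1))\<close>
  cut with members of the algebra; these are countably many conditions, and topology recovers the
  rest. Moreover series in \<open>L0 M\<close> converge in measure only, so a limit relation yields,
  at almost every point, just some index where the error is small. The variation lemmas are arranged
  to need no more than this. In the converse direction the regularity conditions are suprema and
  infima over possibly uncountable families of classes, and the sets that nearly attain them must
  not depend on \<open>x\<close>. Finally \<open>M\<close> need not be complete, while foliations
  are only required to be measurable for \<open>completion M\<close>; \<open>L0_fun\<close> mediates
  between the two.\<close>

definition L0_fun :: "'x measure \<Rightarrow> ('x \<Rightarrow> 'b::topological_space) \<Rightarrow> bool" where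
  "L0_fun M f \<longleftrightarrow> (\<exists>g\<in>borel_measurable M. AE x in M. g x = f x)"

lemma L0_funI: "f \<in> borel_measurable M \<Longrightarrow> L0_fun M f"
  unfolding L0_fun_def by auto

lemma L0_fun_AE:
  assumes "g \<in> borel_measurable M" "AE x in M. g x = f x"
  shows "L0_fun M f"
  unfolding L0_fun_def using assms by (intro bexI[of _ g])

text \<open>Preimages under \<open>f\<close> and \<open>g\<close> differ by a subset of a null set,
  which the completion measures. This needs nothing of the target space, so it serves real and
  extended real functions alike.\<close>

lemma L0_fun_completion_measurable:
  fixes f :: "'x \<Rightarrow> 'b::topological_space"
  assumes "L0_fun M f"
  shows "f \<in> borel_measurable (completion M)"
proof -
  obtain g where g: "g \<in> borel_measurable M" "AE x in M. g x = f x"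
    using assms unfolding L0_fun_def by auto
  show ?thesis
  proof (rule measurableI)
    fix A :: "'b set" assume A: "A \<in> sets borel"
    have "AE x in completion M. x \<in> g -` A \<inter> space M \<longleftrightarrow> x \<in> f -` A \<inter> space M"
      using AE_completion[OF g(2)] by eventually_elim auto
    moreover have "g -` A \<inter> space M \<in> sets (completion M)"
      using measurable_sets[OF measurable_completion[OF g(1)] A] by simp
    ultimately show "f -` A \<inter> space (completion M) \<in> sets (completion M)"
      by (simp add: completion.in_sets_AE[where A="g -` A \<inter> space M"])
  qed auto
qed

text \<open>Closure properties of \<open>L0_fun\<close> are inherited through this equivalence from
  those of measurable functions on the completion.\<close>

lemma L0_fun_real_iff:
  fixes f :: "'x \<Rightarrow> real"
  shows "L0_fun M f \<longleftrightarrow> f \<in> borel_measurable (completion M)"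
proof
  assume "f \<in> borel_measurable (completion M)"
  from completion_ex_borel_measurable_real[OF this] show "L0_fun M f"
    unfolding L0_fun_def by (simp add: eq_commute)
qed (rule L0_fun_completion_measurable)

text \<open>Splitting into positive and negative part reduces extended real functions to
  \<open>ennreal\<close> valued ones, to which \<open>completion_ex_borel_measurable\<close>
  applies. One of the two parts is always 0, so no difference of infinities arises.\<close>

lemma ereal_eq_e2ennreal_diff:
  "x = enn2ereal (e2ennreal x) - enn2ereal (e2ennreal (- x))"
proof (cases "0 \<le> x")
  case True
  then have "e2ennreal (-x) = 0"
    by (intro e2ennreal_neg) simp
  then show ?thesis using True by (simp add: enn2ereal_e2ennreal zero_ennreal.rep_eq)
next
  case False
  then have "e2ennreal x = 0" by (simp add: e2ennreal_neg)
  moreover have "enn2ereal (e2ennreal (-x)) = - x" using False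
    by (intro enn2ereal_e2ennreal) (cases x; simp)
  ultimately show ?thesis by (simp add: zero_ennreal.rep_eq)
qed

lemma L0_fun_ereal_iff:
  fixes f :: "'x \<Rightarrow> ereal"
  shows "L0_fun M f \<longleftrightarrow> f \<in> borel_measurable (completion M)"
proof
  assume f[measurable]: "f \<in> borel_measurable (completion M)"
  have "(\<lambda>x. e2ennreal (f x)) \<in> borel_measurable (completion M)" by measurable
  from completion_ex_borel_measurable[OF this] obtain g where
    g[measurable]: "g \<in> borel_measurable M" "AE x in M. e2ennreal (f x) = g x"
    by blast
  have "(\<lambda>x. e2ennreal (- f x)) \<in> borel_measurable (completion M)" by measurable
  from completion_ex_borel_measurable[OF this] obtain h where
    h[measurable]: "h \<in> borel_measurable M" "AE x in M. e2ennreal (- f x) = h x"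
    by blast
  have "(\<lambda>x. enn2ereal (g x) - enn2ereal (h x)) \<in> borel_measurable M" by measurable
  moreover have "AE x in M. enn2ereal (g x) - enn2ereal (h x) = f x"
    using g(2) h(2)
  proof eventually_elim
    case (elim x)
    show ?case unfolding elim[symmetric] by (rule ereal_eq_e2ennreal_diff[symmetric])
  qed
  ultimately show "L0_fun M f" by (rule L0_fun_AE)
qed (rule L0_fun_completion_measurable)

lemma ae_class_cong:
  assumes "AE x in M. f x = g x"
  shows "ae_class M f = ae_class M g"
  unfolding ae_class_def using assms by (auto elim: eventually_elim2)

lemma ae_class_in_L0: "L0_fun M f \<Longrightarrow> ae_class M f \<in> L0 M"
proof -
  assume "L0_fun M f"
  then obtain g where "g \<in> borel_measurable M" "AE x in M. g x = f x"
    unfolding L0_fun_def by auto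
  then show ?thesis unfolding L0_def using ae_class_cong[of g f M] by blast
qed

text \<open>\<open>L0_fun M f\<close> says exactly that \<open>ae_class M f\<close> is nonempty,
  which is what makes the choice in \<open>rep\<close> land in the class.\<close>

lemma rep_in:
  assumes "L0_fun M f"
  shows "rep (ae_class M f) \<in> borel_measurable M" "AE x in M. rep (ae_class M f) x = f x"
proof -
  obtain g where "g \<in> ae_class M f"
    using assms unfolding L0_fun_def ae_class_def by auto
  then have "rep (ae_class M f) \<in> ae_class M f" unfolding rep_def by (rule someI[where P="\<lambda>g. g \<in> ae_class M f"])
  then show "rep (ae_class M f) \<in> borel_measurable M" "AE x in M. rep (ae_class M f) x = f x"
    by (auto simp: ae_class_def)
qed

lemma ae_class_eqD:
  assumes "ae_class M f = ae_class M g" "L0_fun M f"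
  shows "AE x in M. f x = g x"
proof -
  have "L0_fun M g"
    using assms unfolding L0_fun_def ae_class_def by blast
  from rep_in(2)[OF this] rep_in(2)[OF assms(2)] show ?thesis
    unfolding assms(1) by eventually_elim simp
qed

lemma L0E:
  assumes "c \<in> L0 M"
  obtains f where "f \<in> borel_measurable M" "L0_fun M f" "c = ae_class M f"
  using assms L0_funI unfolding L0_def by blast

lemma L0_rep:
  assumes "c \<in> L0 M"
  shows "rep c \<in> borel_measurable M" "L0_fun M (rep c)" "ae_class M (rep c) = c"
proof -
  obtain f where f: "L0_fun M f" "c = ae_class M f" using assms by (rule L0E)
  show "rep c \<in> borel_measurable M" using rep_in(1)[OF f(1)] f(2) by simp
  then show "L0_fun M (rep c)" by (rule L0_funI)
  show "ae_class M (rep c) = c"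
    using ae_class_cong[OF rep_in(2)[OF f(1)]] f(2) by simp
qed

lemma L0_map_ae_class:
  assumes "L0_fun M f"
  shows "L0_map M h (ae_class M f) = ae_class M (\<lambda>x. h (f x))"
  unfolding L0_map_def using rep_in(2)[OF assms] by (intro ae_class_cong) (auto elim: eventually_mono)

lemma L0_map2_ae_class:
  assumes "L0_fun M f" "L0_fun M g"
  shows "L0_map2 M h (ae_class M f) (ae_class M g) = ae_class M (\<lambda>x. h (f x) (g x))"
  unfolding L0_map2_def using rep_in(2)[OF assms(1)] rep_in(2)[OF assms(2)]
  by (intro ae_class_cong) (auto elim: eventually_elim2)

lemma L0_le_ae_class:
  assumes "L0_fun M f" "L0_fun M g"
  shows "L0_le M (ae_class M f) (ae_class M g) \<longleftrightarrow> (AE x in M. f x \<le> g x)"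
proof -
  have "AE x in M. rep (ae_class M f) x \<le> rep (ae_class M g) x \<longleftrightarrow> f x \<le> g x"
    using rep_in(2)[OF assms(1)] rep_in(2)[OF assms(2)] by eventually_elim simp
  then show ?thesis unfolding L0_le_def by (rule eventually_cong) simp
qed

lemma L0_ring_simps:
  "carrier (L0_ring M) = L0 M" "\<zero>\<^bsub>L0_ring M\<^esub> = ae_class M (\<lambda>_. 0)"
  "\<one>\<^bsub>L0_ring M\<^esub> = ae_class M (\<lambda>_. 1)"
  by (simp_all add: L0_ring_def)

lemma L0_fun_const [simp]: "L0_fun M (\<lambda>_. c)"
  by (rule L0_funI) simp

lemma L0_fun_add: "L0_fun M f \<Longrightarrow> L0_fun M g \<Longrightarrow> L0_fun M (\<lambda>x. f x + g x :: real)"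
  and L0_fun_mult: "L0_fun M f \<Longrightarrow> L0_fun M g \<Longrightarrow> L0_fun M (\<lambda>x. f x * g x :: real)"
  and L0_fun_uminus: "L0_fun M f \<Longrightarrow> L0_fun M (\<lambda>x. - f x :: real)"
  and L0_fun_diff: "L0_fun M f \<Longrightarrow> L0_fun M g \<Longrightarrow> L0_fun M (\<lambda>x. f x - g x :: real)"
  and L0_fun_abs: "L0_fun M f \<Longrightarrow> L0_fun M (\<lambda>x. \<bar>f x :: real\<bar>)"
  unfolding L0_fun_real_iff
  by (rule borel_measurable_add borel_measurable_times borel_measurable_uminus
      borel_measurable_diff borel_measurable_abs; assumption)+

lemma L0_fun_sum: "(\<And>i. i \<in> I \<Longrightarrow> L0_fun M (f i)) \<Longrightarrow> L0_fun M (\<lambda>x. \<Sum>i\<in>I. f i x :: real)"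
  unfolding L0_fun_real_iff by measurable

lemma L0_fun_ereal: "L0_fun M f \<Longrightarrow> L0_fun M (\<lambda>x. ereal (f x))"
  unfolding L0_fun_real_iff L0_fun_ereal_iff by measurable

lemma L0_add_ae_class:
  "L0_fun M f \<Longrightarrow> L0_fun M g \<Longrightarrow>
    ae_class M f \<oplus>\<^bsub>L0_ring M\<^esub> ae_class M g = ae_class M (\<lambda>x. f x + g x)"
  by (simp add: L0_ring_def L0_map2_ae_class)

lemma L0_mult_ae_class:
  "L0_fun M f \<Longrightarrow> L0_fun M g \<Longrightarrow>
    ae_class M f \<otimes>\<^bsub>L0_ring M\<^esub> ae_class M g = ae_class M (\<lambda>x. f x * g x)"
  by (simp add: L0_ring_def L0_map2_ae_class)

lemma L0_abs_ae_class: "L0_fun M f \<Longrightarrow> L0_abs M (ae_class M f) = ae_class M (\<lambda>x. \<bar>f x\<bar>)"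
  by (simp add: L0_abs_def L0_map_ae_class)

lemma L0_embed_ae_class: "L0_fun M f \<Longrightarrow> L0_embed M (ae_class M f) = ae_class M (\<lambda>x. ereal (f x))"
  by (simp add: L0_embed_def L0_map_ae_class)

lemma L0_pos_iff: "L0_fun M f \<Longrightarrow> ae_class M f \<in> L0_pos M \<longleftrightarrow> (AE x in M. 0 \<le> f x)"
  by (simp add: L0_pos_def L0_ring_simps L0_le_ae_class ae_class_in_L0)

lemmas L0_ring_ops = L0_add_ae_class L0_mult_ae_class L0_fun_add L0_fun_mult ae_class_in_L0

lemma abelian_group_L0_ring: "abelian_group (L0_ring M)"
proof (rule abelian_groupI, unfold L0_ring_simps)
  fix c :: "('a \<Rightarrow> real) set" assume "c \<in> L0 M"
  then obtain f where f: "L0_fun M f" "c = ae_class M f" by (rule L0E)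
  have "ae_class M (\<lambda>x. - f x) \<oplus>\<^bsub>L0_ring M\<^esub> c = ae_class M (\<lambda>_. 0)"
    by (simp add: f L0_add_ae_class L0_fun_uminus)
  then show "\<exists>d\<in>L0 M. d \<oplus>\<^bsub>L0_ring M\<^esub> c = ae_class M (\<lambda>_. 0)"
    using ae_class_in_L0[OF L0_fun_uminus[OF f(1)]] by auto
next
  fix x y z :: "('a \<Rightarrow> real) set"
  assume x: "x \<in> L0 M" and y: "y \<in> L0 M" and z: "z \<in> L0 M"
  obtain f where f: "L0_fun M f" "x = ae_class M f" using x by (rule L0E)
  obtain g where g: "L0_fun M g" "y = ae_class M g" using y by (rule L0E)
  obtain h where h: "L0_fun M h" "z = ae_class M h" using z by (rule L0E)
  show "(x \<oplus>\<^bsub>L0_ring M\<^esub> y) \<oplus>\<^bsub>L0_ring M\<^esub> z = x \<oplus>\<^bsub>L0_ring M\<^esub> (y \<oplus>\<^bsub>L0_ring M\<^esub> z)"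
    by (simp add: f g h L0_ring_ops add.assoc)
  show "x \<oplus>\<^bsub>L0_ring M\<^esub> y = y \<oplus>\<^bsub>L0_ring M\<^esub> x"
    by (simp add: f g h L0_ring_ops add.commute)
  show "x \<oplus>\<^bsub>L0_ring M\<^esub> y \<in> L0 M"
    by (simp add: f g h L0_ring_ops)
  show "ae_class M (\<lambda>_. 0) \<oplus>\<^bsub>L0_ring M\<^esub> x = x"
    by (simp add: f L0_ring_ops)
qed (simp add: ae_class_in_L0)

lemma cring_L0_ring: "cring (L0_ring M)"
proof (rule cringI[OF abelian_group_L0_ring comm_monoidI], unfold L0_ring_simps)
  fix x y z :: "('a \<Rightarrow> real) set"
  assume x: "x \<in> L0 M" and y: "y \<in> L0 M" and z: "z \<in> L0 M"
  obtain f where f: "L0_fun M f" "x = ae_class M f" using x by (rule L0E)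
  obtain g where g: "L0_fun M g" "y = ae_class M g" using y by (rule L0E)
  obtain h where h: "L0_fun M h" "z = ae_class M h" using z by (rule L0E)
  show "(x \<oplus>\<^bsub>L0_ring M\<^esub> y) \<otimes>\<^bsub>L0_ring M\<^esub> z = x \<otimes>\<^bsub>L0_ring M\<^esub> z \<oplus>\<^bsub>L0_ring M\<^esub> y \<otimes>\<^bsub>L0_ring M\<^esub> z"
    by (simp add: f g h L0_ring_ops distrib_right)
  show "x \<otimes>\<^bsub>L0_ring M\<^esub> y \<otimes>\<^bsub>L0_ring M\<^esub> z = x \<otimes>\<^bsub>L0_ring M\<^esub> (y \<otimes>\<^bsub>L0_ring M\<^esub> z)"
    by (simp add: f g h L0_ring_ops mult.assoc)
  show "x \<otimes>\<^bsub>L0_ring M\<^esub> y = y \<otimes>\<^bsub>L0_ring M\<^esub> x"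
    by (simp add: f g h L0_ring_ops mult.commute)
  show "x \<otimes>\<^bsub>L0_ring M\<^esub> y \<in> L0 M"
    by (simp add: f g h L0_ring_ops)
  show "ae_class M (\<lambda>_. 1) \<otimes>\<^bsub>L0_ring M\<^esub> x = x"
    by (simp add: f L0_ring_ops)
qed (simp add: ae_class_in_L0)

lemma L0_finsum_ae_class:
  assumes "\<And>n. L0_fun M (f n)"
  shows "(\<Oplus>\<^bsub>L0_ring M\<^esub>n\<in>{..<N::nat}. ae_class M (f n)) = ae_class M (\<lambda>x. \<Sum>n<N. f n x)"
proof -
  interpret abelian_group "L0_ring M" by (rule abelian_group_L0_ring)
  show ?thesis
  proof (induction N)
    case (Suc N)
    have *: "(\<lambda>n. ae_class M (f n)) \<in> {..<N} \<rightarrow> carrier (L0_ring M)"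
      using assms by (auto simp: L0_ring_simps(1) ae_class_in_L0)
    have "(\<Oplus>\<^bsub>L0_ring M\<^esub>n\<in>{..<Suc N}. ae_class M (f n)) =
        ae_class M (f N) \<oplus>\<^bsub>L0_ring M\<^esub> ae_class M (\<lambda>x. \<Sum>n<N. f n x)"
      unfolding lessThan_Suc Suc.IH[symmetric]
      by (rule finsum_insert[OF _ _ *]) (simp_all add: L0_ring_simps(1) ae_class_in_L0 assms)
    also have "\<dots> = ae_class M (\<lambda>x. \<Sum>n<Suc N. f n x)"
      by (simp add: L0_add_ae_class assms L0_fun_sum add.commute)
    finally show ?case .
  qed (simp add: L0_ring_simps)
qed

text \<open>\<open>L0_dist\<close> integrates \<open>M\<close>-measurable representatives, for which
  both integrals agree. With \<open>f\<close> and \<open>g\<close> in their place the integral has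
  to be taken over the completion, since these may fail to be measurable for
  \<open>M\<close>.\<close>

lemma L0_dist_ae_class:
  assumes "L0_fun M f" "L0_fun M g"
  shows "L0_dist M (ae_class M f) (ae_class M g) = (LINT x|completion M. min \<bar>f x - g x\<bar> 1)"
proof -
  have [measurable]: "rep (ae_class M f) \<in> borel_measurable M" "rep (ae_class M g) \<in> borel_measurable M"
    using rep_in(1) assms by auto
  have [measurable]: "f \<in> borel_measurable (completion M)" "g \<in> borel_measurable (completion M)"
    using assms by (auto simp: L0_fun_real_iff)
  have "L0_dist M (ae_class M f) (ae_class M g) =
      (LINT x|completion M. min \<bar>rep (ae_class M f) x - rep (ae_class M g) x\<bar> 1)"
    unfolding L0_dist_def by (rule integral_completion[symmetric]) measurable
  also have "\<dots> = (LINT x|completion M. min \<bar>f x - g x\<bar> 1)"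
  proof (rule integral_cong_AE)
    show "AE x in completion M. min \<bar>rep (ae_class M f) x - rep (ae_class M g) x\<bar> 1 = min \<bar>f x - g x\<bar> 1"
      using AE_completion[OF rep_in(2)[OF assms(1)]] AE_completion[OF rep_in(2)[OF assms(2)]]
      by eventually_elim simp
  next
    show "(\<lambda>x. min \<bar>rep (ae_class M f) x - rep (ae_class M g) x\<bar> 1) \<in> borel_measurable (completion M)"
      by (rule measurable_completion) measurable
  qed measurable
  finally show ?thesis .
qed

section \<open>Series in the algebra: convergence in measure and its pointwise content\<close>

context prob_space
begin

text \<open>Dominated convergence: the truncated errors are bounded by 1, which is integrable for a
  probability measure.\<close>

lemma L0_sumsI:
  assumes f: "\<And>n. L0_fun M (f n)" and g: "L0_fun M g" and sums: "AE x in M. (\<lambda>n. f n x) sums g x"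
  shows "L0_sums M (\<lambda>n. ae_class M (f n)) (ae_class M g)"
proof -
  have [measurable]: "f n \<in> borel_measurable (completion M)" "g \<in> borel_measurable (completion M)" for n
    using f g by (auto simp: L0_fun_real_iff)
  interpret completion: prob_space "completion M" by (rule prob_space_completion)
  have "(\<lambda>N. LINT x|completion M. min \<bar>(\<Sum>n<N. f n x) - g x\<bar> 1) \<longlonglongrightarrow> (LINT x|completion M. 0)"
  proof (rule integral_dominated_convergence[where w="\<lambda>_. 1"])
    show "AE x in completion M. (\<lambda>N. min \<bar>(\<Sum>n<N. f n x) - g x\<bar> 1) \<longlonglongrightarrow> 0"
      using AE_completion[OF sums]
    proof eventually_elim
      case (elim x)
      then have "(\<lambda>N. min \<bar>(\<Sum>n<N. f n x) - g x\<bar> 1) \<longlonglongrightarrow> min \<bar>g x - g x\<bar> 1"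
        unfolding sums_def by (intro tendsto_intros)
      then show ?case by simp
    qed
  qed simp_all
  then show ?thesis
    unfolding L0_sums_def using f g
    by (simp add: L0_finsum_ae_class L0_dist_ae_class L0_fun_sum ae_class_in_L0)
qed

lemma L0_sums_dist:
  assumes "L0_sums M (\<lambda>n. ae_class M (f n)) (ae_class M g)" "\<And>n. L0_fun M (f n)" "L0_fun M g"
  shows "(\<lambda>N. LINT x|completion M. min \<bar>(\<Sum>n<N. f n x) - g x\<bar> 1) \<longlonglongrightarrow> 0"
  using assms unfolding L0_sums_def
  by (simp add: L0_finsum_ae_class L0_dist_ae_class L0_fun_sum)

text \<open>Markov's inequality: the set where all \<open>h N\<close> stay above \<epsilon> has
  measure bounded by a multiple of each of the integrals, hence 0. The index found depends on the
  point; no subsequence converging almost everywhere has to be extracted.\<close>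

lemma AE_ex_small:
  fixes h :: "nat \<Rightarrow> 'a \<Rightarrow> real"
  assumes h: "\<And>N. L0_fun M (h N)" and lim: "(\<lambda>N. LINT x|completion M. min \<bar>h N x\<bar> 1) \<longlonglongrightarrow> 0"
    and \<epsilon>: "\<epsilon> > 0"
  shows "AE x in M. \<exists>N. \<bar>h N x\<bar> < \<epsilon>"
proof -
  have h'[measurable]: "h N \<in> borel_measurable (completion M)" for N
    using h[of N] by (simp only: L0_fun_real_iff)
  interpret completion: prob_space "completion M" by (rule prob_space_completion)
  define E where "E = {x \<in> space (completion M). \<forall>N. \<epsilon> \<le> \<bar>h N x\<bar>}"
  have E: "E \<in> sets (completion M)"
    unfolding E_def
    by (intro sets.sets_Collect_countable_All borel_measurable_le borel_measurable_const borel_measurable_abs h')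
  \<comment> \<open>The integrand is truncated at 1, so the level in Markov's inequality has to lie
    below 1 as well as below \<epsilon>.\<close>
  obtain \<delta> :: real where \<delta>: "0 < \<delta>" "\<delta> \<le> \<epsilon>" "\<delta> \<le> 1"
    using \<epsilon> by (metis min.cobounded1 min.cobounded2 min_less_iff_conj zero_less_one)
  have fin: "emeasure (completion M) E < \<infinity>"
    by (simp only: completion.emeasure_eq_measure infinity_ennreal_def ennreal_less_top)
  have "\<delta> * completion.prob E \<le> (LINT x|completion M. min \<bar>h N x\<bar> 1)" for N
  proof -
    have "(LINT x|completion M. indicator E x *\<^sub>R \<delta>) \<le> (LINT x|completion M. min \<bar>h N x\<bar> 1)"
    proof (rule integral_mono)
      show "integrable (completion M) (\<lambda>x. min \<bar>h N x\<bar> 1)"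
        by (rule completion.integrable_const_bound[where B=1]) auto
      show "indicator E x *\<^sub>R \<delta> \<le> min \<bar>h N x\<bar> 1" for x
      proof (cases "x \<in> E")
        case True
        then have "\<epsilon> \<le> \<bar>h N x\<bar>" by (simp add: E_def)
        then show ?thesis using True \<delta> by simp
      qed simp
      show "integrable (completion M) (\<lambda>x. indicator E x *\<^sub>R \<delta>)"
        by (rule integrable_indicator[OF E fin])
    qed
    moreover have "(LINT x|completion M. indicator E x *\<^sub>R \<delta>) = completion.prob E *\<^sub>R \<delta>"
      by (rule has_bochner_integral_integral_eq[OF has_bochner_integral_indicator[OF E fin]])
    ultimately show ?thesis by (simp only: mult.commute real_scaleR_def)
  qed
  then have "\<delta> * completion.prob E \<le> 0"
    by (intro LIMSEQ_le_const[OF lim]) auto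
  then have "completion.prob E = 0"
    using \<delta>(1) measure_nonneg[of "completion M" E] by (simp add: mult_le_0_iff)
  then have "E \<in> null_sets (completion M)"
    using E by (simp only: null_sets_def mem_Collect_eq completion.emeasure_eq_measure ennreal_0 simp_thms)
  then have "AE x in completion M. x \<notin> E" by (rule AE_not_in)
  then have "AE x in completion M. \<exists>N. \<bar>h N x\<bar> < \<epsilon>"
    using AE_space[of "completion M"] by eventually_elim (auto simp: E_def not_le)
  then show ?thesis by (simp add: AE_completion_iff)
qed

lemma min_abs_add_le: "min \<bar>\<bar>a\<bar> + \<bar>b\<bar>\<bar> 1 \<le> min \<bar>a\<bar> 1 + min \<bar>b\<bar> (1::real)"
  by linarith

text \<open>Both errors must be small at the same index \<open>N\<close>, which two separate uses of
  \<open>AE_ex_small\<close> would not give. Hence it is applied to the sum of their absolute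
  values.\<close>

lemma L0_sums_AE_unique:
  assumes f: "\<And>n. L0_fun M (f n)" and g: "L0_fun M g" and g': "L0_fun M g'"
    and "L0_sums M (\<lambda>n. ae_class M (f n)) (ae_class M g)"
    and "L0_sums M (\<lambda>n. ae_class M (f n)) (ae_class M g')"
  shows "AE x in M. g x = g' x"
proof -
  note f[unfolded L0_fun_real_iff, measurable] g[unfolded L0_fun_real_iff, measurable]
    g'[unfolded L0_fun_real_iff, measurable]
  interpret completion: prob_space "completion M" by (rule prob_space_completion)
  let ?D = "\<lambda>g N x. (\<Sum>n<N. f n x) - g x"
  have "(\<lambda>N. LINT x|completion M. min \<bar>\<bar>?D g N x\<bar> + \<bar>?D g' N x\<bar>\<bar> 1) \<longlonglongrightarrow> 0"
  proof (rule tendsto_sandwich[OF _ _ tendsto_const])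
    show "(\<lambda>N. (LINT x|completion M. min \<bar>?D g N x\<bar> 1) + (LINT x|completion M. min \<bar>?D g' N x\<bar> 1)) \<longlonglongrightarrow> 0"
      using tendsto_add[OF L0_sums_dist[OF assms(4) f g] L0_sums_dist[OF assms(5) f g']] by simp
    have int: "integrable (completion M) (\<lambda>x. min \<bar>u x\<bar> (1::real))"
      if "u \<in> borel_measurable (completion M)" for u
      using that by (intro completion.integrable_const_bound[where B=1]) auto
    have meas: "?D g N \<in> borel_measurable (completion M)" "?D g' N \<in> borel_measurable (completion M)" for N
      by measurable
    have "(LINT x|completion M. min \<bar>\<bar>?D g N x\<bar> + \<bar>?D g' N x\<bar>\<bar> 1)
       \<le> (LINT x|completion M. min \<bar>?D g N x\<bar> 1 + min \<bar>?D g' N x\<bar> 1)" for N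
    proof (rule integral_mono)
      show "integrable (completion M) (\<lambda>x. min \<bar>\<bar>?D g N x\<bar> + \<bar>?D g' N x\<bar>\<bar> 1)"
        by (intro int borel_measurable_add borel_measurable_abs meas)
      show "integrable (completion M) (\<lambda>x. min \<bar>?D g N x\<bar> 1 + min \<bar>?D g' N x\<bar> 1)"
        by (intro Bochner_Integration.integrable_add int meas)
    qed (rule min_abs_add_le)
    also have "\<dots> N = (LINT x|completion M. min \<bar>?D g N x\<bar> 1) + (LINT x|completion M. min \<bar>?D g' N x\<bar> 1)" for N
      by (rule Bochner_Integration.integral_add; intro int meas)
    finally show "\<forall>\<^sub>F N in sequentially. (LINT x|completion M. min \<bar>\<bar>?D g N x\<bar> + \<bar>?D g' N x\<bar>\<bar> 1)
       \<le> (LINT x|completion M. min \<bar>?D g N x\<bar> 1) + (LINT x|completion M. min \<bar>?D g' N x\<bar> 1)"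
      by (intro always_eventually allI)
  qed (simp add: integral_nonneg)
  then have "AE x in M. \<exists>N. \<bar>\<bar>?D g N x\<bar> + \<bar>?D g' N x\<bar>\<bar> < inverse (Suc k)" for k
    by (intro AE_ex_small L0_fun_add L0_fun_abs L0_fun_diff L0_fun_sum f g g') auto
  then have "AE x in M. \<forall>k. \<exists>N. \<bar>\<bar>?D g N x\<bar> + \<bar>?D g' N x\<bar>\<bar> < inverse (Suc k)"
    by (simp add: AE_all_countable)
  then show ?thesis
  proof eventually_elim
    case (elim x)
    have "\<bar>g x - g' x\<bar> < inverse (Suc k)" for k
    proof -
      obtain N where "\<bar>\<bar>?D g N x\<bar> + \<bar>?D g' N x\<bar>\<bar> < inverse (Suc k)" using elim by blast
      then show ?thesis by arith
    qed
    then show ?case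
      using reals_Archimedean[of "\<bar>g x - g' x\<bar>"] by (metis abs_le_zero_iff less_asym not_le eq_iff_diff_eq_0)
  qed
qed

end

section \<open>Essential suprema and infima of extended real classes\<close>

lemma partial_order_L0bar: "partial_order (L0bar M)"
proof
  fix c d e assume "c \<in> carrier (L0bar M)" "d \<in> carrier (L0bar M)"
  then obtain f g where *: "L0_fun M f" "c = ae_class M f" "L0_fun M g" "d = ae_class M g"
    by (auto simp: L0bar_def elim!: L0E)
  show "c .=\<^bsub>L0bar M\<^esub> d" if "c \<sqsubseteq>\<^bsub>L0bar M\<^esub> d" "d \<sqsubseteq>\<^bsub>L0bar M\<^esub> c"
  proof -
    have "AE x in M. f x \<le> g x" "AE x in M. g x \<le> f x"
      using that * by (simp_all add: L0bar_def L0_le_ae_class)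
    then have "AE x in M. f x = g x" by eventually_elim simp
    then show ?thesis using ae_class_cong[of f g M] by (simp add: L0bar_def *)
  qed
  assume "e \<in> carrier (L0bar M)" and "c \<sqsubseteq>\<^bsub>L0bar M\<^esub> d" "d \<sqsubseteq>\<^bsub>L0bar M\<^esub> e"
  then have "AE x in M. rep c x \<le> rep d x" "AE x in M. rep d x \<le> rep e x"
    by (auto simp: L0bar_def L0_le_def)
  then have "AE x in M. rep c x \<le> rep e x" by eventually_elim simp
  then show "c \<sqsubseteq>\<^bsub>L0bar M\<^esub> e" by (simp add: L0bar_def L0_le_def)
qed (simp_all add: L0bar_def L0_le_def)

text \<open>The supremum is a choice among least upper bounds, so antisymmetry identifies it with
  any least upper bound that can be exhibited.\<close>

lemma L0bar_sup_eq:
  assumes "least (L0bar M) s (Upper (L0bar M) S)"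
  shows "\<Squnion>\<^bsub>L0bar M\<^esub> S = s"
  unfolding Lattice.sup_def
proof (rule some_equality[where P="\<lambda>x. least (L0bar M) x (Upper (L0bar M) S)", OF assms])
  fix t assume "least (L0bar M) t (Upper (L0bar M) S)"
  from partial_order.least_unique[OF partial_order_L0bar this assms] show "t = s" .
qed

lemma L0bar_inf_eq:
  assumes "greatest (L0bar M) s (Lower (L0bar M) S)"
  shows "\<Sqinter>\<^bsub>L0bar M\<^esub> S = s"
  unfolding Lattice.inf_def
proof (rule some_equality[where P="\<lambda>x. greatest (L0bar M) x (Lower (L0bar M) S)", OF assms])
  fix t assume "greatest (L0bar M) t (Lower (L0bar M) S)"
  from partial_order.greatest_unique[OF partial_order_L0bar this assms] show "t = s" .
qed

lemma L0bar_supI: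
  assumes f: "L0_fun M f" and "S \<subseteq> L0 M"
    and up: "\<And>c. c \<in> S \<Longrightarrow> AE x in M. rep c x \<le> f x"
    and least: "\<And>g. L0_fun M g \<Longrightarrow> (\<And>c. c \<in> S \<Longrightarrow> AE x in M. rep c x \<le> g x) \<Longrightarrow> AE x in M. f x \<le> g x"
  shows "least (L0bar M) (ae_class M f) (Upper (L0bar M) S)"
  unfolding least_def Upper_def
proof (intro conjI ballI, goal_cases)
  case 2
  have "L0_le M c (ae_class M f)" if "c \<in> S" for c
    using up[OF that] rep_in(2)[OF f] unfolding L0_le_def by eventually_elim simp
  then show ?case using assms by (auto simp: L0bar_def ae_class_in_L0)
next
  case (3 d)
  then have d: "d \<in> L0 M" "\<And>c. c \<in> S \<Longrightarrow> L0_le M c d"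
    using assms(2) by (auto simp: L0bar_def)
  have "AE x in M. f x \<le> rep d x"
    using d L0_rep(2)[of d M] by (intro least) (auto simp: L0_le_def)
  then have "L0_le M (ae_class M f) d"
    using rep_in(2)[OF f] unfolding L0_le_def by eventually_elim simp
  then show ?case by (simp add: L0bar_def)
qed simp

lemma L0bar_infI:
  assumes f: "L0_fun M f" and "S \<subseteq> L0 M"
    and low: "\<And>c. c \<in> S \<Longrightarrow> AE x in M. f x \<le> rep c x"
    and greatest: "\<And>g. L0_fun M g \<Longrightarrow> (\<And>c. c \<in> S \<Longrightarrow> AE x in M. g x \<le> rep c x) \<Longrightarrow> AE x in M. g x \<le> f x"
  shows "greatest (L0bar M) (ae_class M f) (Lower (L0bar M) S)"
  unfolding greatest_def Lower_def
proof (intro conjI ballI, goal_cases)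
  case 2
  have "L0_le M (ae_class M f) c" if "c \<in> S" for c
    using low[OF that] rep_in(2)[OF f] unfolding L0_le_def by eventually_elim simp
  then show ?case using assms by (auto simp: L0bar_def ae_class_in_L0)
next
  case (3 d)
  then have d: "d \<in> L0 M" "\<And>c. c \<in> S \<Longrightarrow> L0_le M d c"
    using assms(2) by (auto simp: L0bar_def)
  have "AE x in M. rep d x \<le> f x"
    using d L0_rep(2)[of d M] by (intro greatest) (auto simp: L0_le_def)
  then have "L0_le M d (ae_class M f)"
    using rep_in(2)[OF f] unfolding L0_le_def by eventually_elim simp
  then show ?case by (simp add: L0bar_def)
qed simp

text \<open>A bounded strictly increasing gauge turns the essential supremum into the maximisation of an integral.\<close>

definition ereal_gauge :: "ereal \<Rightarrow> real" where
  "ereal_gauge y = (if y = \<infinity> then 2 else if y = -\<infinity> then - 2 else arctan (real_of_ereal y))"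

lemma ereal_gauge_measurable [measurable]: "ereal_gauge \<in> borel_measurable borel"
  unfolding ereal_gauge_def[abs_def] by measurable

text \<open>The value 2 at infinity exceeds \<pi>/2, so the gauge stays strictly increasing at both
  ends.\<close>

lemma arctan_abs_less_2: "\<bar>arctan r\<bar> < 2"
  using arctan_ubound[of r] arctan_lbound[of r] pi_less_4 by linarith

lemma ereal_gauge_bound: "\<bar>ereal_gauge y\<bar> \<le> 2"
  unfolding ereal_gauge_def using arctan_abs_less_2[of "real_of_ereal y"] by simp

lemma ereal_gauge_strict_mono: "y < z \<Longrightarrow> ereal_gauge y < ereal_gauge z"
  using arctan_abs_less_2[of "real_of_ereal y"] arctan_abs_less_2[of "real_of_ereal z"]
  by (cases y; cases z) (auto simp: ereal_gauge_def arctan_less_iff)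

lemma ereal_gauge_mono: "y \<le> z \<Longrightarrow> ereal_gauge y \<le> ereal_gauge z"
  using ereal_gauge_strict_mono[of y z] by (cases "y = z") (auto simp: order.strict_iff_order)

text \<open>Exhaustion: among all sequences in \<open>S\<close>, one is chosen whose pointwise
  supremum has the largest gauge integral. Prepending any further member of \<open>S\<close> cannot
  enlarge the integral, so that member already lies below the supremum almost everywhere. A
  countable supremum is measurable, and it lies below every upper bound.\<close>

lemma (in prob_space) L0bar_sup_exists:
  fixes S :: "('a \<Rightarrow> ereal) set set"
  assumes S: "S \<subseteq> L0 M"
  shows "\<exists>s. least (L0bar M) s (Upper (L0bar M) S)"
proof (cases "S = {}")
  case True
  then have "least (L0bar M) (ae_class M (\<lambda>_. -\<infinity>)) (Upper (L0bar M) S)"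
    by (intro L0bar_supI) auto
  then show ?thesis by blast
next
  case False
  then obtain c0 where c0: "c0 \<in> S" by auto
  define G where "G \<sigma> x = (SUP n. rep (\<sigma> n) x)" for \<sigma> :: "nat \<Rightarrow> ('a \<Rightarrow> ereal) set" and x
  define I where "I \<sigma> = (LINT x|M. ereal_gauge (G \<sigma> x))" for \<sigma>
  have rep[measurable]: "c \<in> S \<Longrightarrow> rep c \<in> borel_measurable M" for c using S L0_rep(1) by auto
  have G[measurable]: "G \<sigma> \<in> borel_measurable M" if "range \<sigma> \<subseteq> S" for \<sigma>
    unfolding G_def[abs_def] using that rep by (intro borel_measurable_SUP) (auto simp: image_subset_iff)
  have int: "integrable M (\<lambda>x. ereal_gauge (G \<sigma> x))" if "range \<sigma> \<subseteq> S" for \<sigma>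
  proof (rule integrable_const_bound[where B=2])
    show "(\<lambda>x. ereal_gauge (G \<sigma> x)) \<in> borel_measurable M"
      using G[OF that] by measurable
  qed (simp add: ereal_gauge_bound)
  have I_mono: "I \<sigma> \<le> I \<tau>" if "range \<sigma> \<subseteq> S" "range \<tau> \<subseteq> S" "\<And>x. G \<sigma> x \<le> G \<tau> x" for \<sigma> \<tau>
    unfolding I_def using that by (intro integral_mono int ereal_gauge_mono) auto
  have I_le: "I \<sigma> \<le> 2" if "range \<sigma> \<subseteq> S" for \<sigma>
  proof -
    have "I \<sigma> \<le> (LINT x|M. 2)" unfolding I_def
    proof (rule integral_mono)
      show "ereal_gauge (G \<sigma> x) \<le> 2" for x
        using ereal_gauge_bound[of "G \<sigma> x"] by simp
    qed (use int[OF that] in auto)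
    then show ?thesis by (simp add: prob_space)
  qed
  define \<alpha> where "\<alpha> = (SUP \<sigma>\<in>{\<sigma>. range \<sigma> \<subseteq> S}. I \<sigma>)"
  have bdd: "bdd_above (I ` {\<sigma>. range \<sigma> \<subseteq> S})" using I_le by (intro bdd_aboveI[of _ 2]) auto
  have ne: "{\<sigma> :: nat \<Rightarrow> _. range \<sigma> \<subseteq> S} \<noteq> {}" using c0 by (auto intro!: exI[of _ "\<lambda>_. c0"])
  have "\<exists>\<sigma>. range \<sigma> \<subseteq> S \<and> \<alpha> - inverse (Suc k) < I \<sigma>" for k
    using less_cSUP_iff[OF ne bdd, of "\<alpha> - inverse (Suc k)"] unfolding \<alpha>_def by auto
  then obtain \<sigma> where \<sigma>: "\<And>k. range (\<sigma> k) \<subseteq> S" "\<And>k. \<alpha> - inverse (Suc k) < I (\<sigma> k)" by metis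
  \<comment> \<open>\<open>prod_decode\<close> merges the near optimal sequences into one whose
    supremum dominates each of theirs, so the maximum \<alpha> is attained.\<close>
  define \<tau> where "\<tau> n = \<sigma> (fst (prod_decode n)) (snd (prod_decode n))" for n
  have \<tau>: "range \<tau> \<subseteq> S" using \<sigma>(1) unfolding \<tau>_def by auto
  have G_le: "G (\<sigma> k) x \<le> G \<tau> x" for k x
    unfolding G_def
  proof (rule SUP_least)
    fix n show "rep (\<sigma> k n) x \<le> (SUP n. rep (\<tau> n) x)"
      by (rule SUP_upper2[of "prod_encode (k, n)"]) (simp_all add: \<tau>_def)
  qed
  have I\<tau>: "\<alpha> - inverse (Suc k) < I \<tau>" for k
    using \<sigma>(2)[of k] I_mono[OF \<sigma>(1) \<tau> G_le] by (rule less_le_trans)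
  have \<alpha>: "\<alpha> \<le> I \<tau>"
  proof (rule field_le_epsilon)
    fix e :: real assume "e > 0"
    from reals_Archimedean[OF this] obtain k where "inverse (real (Suc k)) < e" by blast
    then show "\<alpha> \<le> I \<tau> + e" using I\<tau>[of k] by linarith
  qed
  have "least (L0bar M) (ae_class M (G \<tau>)) (Upper (L0bar M) S)"
  proof (rule L0bar_supI)
    show "L0_fun M (G \<tau>)" using \<tau> by (intro L0_funI G)
  next
    fix c assume c: "c \<in> S"
    define \<tau>' where "\<tau>' n = (case n of 0 \<Rightarrow> c | Suc m \<Rightarrow> \<tau> m)" for n
    have "\<tau>' n \<in> S" for n
      using \<tau> c by (cases n) (simp_all add: \<tau>'_def image_subset_iff)
    then have \<tau>': "range \<tau>' \<subseteq> S" by blast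
    have le: "G \<tau> x \<le> G \<tau>' x" for x
      unfolding G_def
    proof (rule SUP_least)
      fix n show "rep (\<tau> n) x \<le> (SUP n. rep (\<tau>' n) x)"
        by (rule SUP_upper2[of "Suc n"]) (simp_all add: \<tau>'_def)
    qed
    have "I \<tau>' \<le> \<alpha>" unfolding \<alpha>_def using \<tau>' by (intro cSUP_upper[OF _ bdd] CollectI)
    \<comment> \<open>The gauge difference is nonnegative and has integral 0, hence vanishes almost
      everywhere; strict monotonicity of the gauge then leaves no room for
      \<open>G \<tau> x < G \<tau>' x\<close>.\<close>
    then have "I \<tau>' - I \<tau> = 0" using \<alpha> I_mono[OF \<tau> \<tau>' le] by simp
    then have "(LINT x|M. ereal_gauge (G \<tau>' x) - ereal_gauge (G \<tau> x)) = 0"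
      unfolding I_def by (simp only: Bochner_Integration.integral_diff[OF int[OF \<tau>'] int[OF \<tau>]])
    then have "AE x in M. ereal_gauge (G \<tau>' x) - ereal_gauge (G \<tau> x) = 0"
      by (rule integral_nonneg_eq_0_iff_AE[THEN iffD1, rotated 2])
        (simp_all add: int[OF \<tau>] int[OF \<tau>'] ereal_gauge_mono[OF le])
    then show "AE x in M. rep c x \<le> G \<tau> x"
    proof eventually_elim
      case (elim x)
      then have "\<not> G \<tau> x < G \<tau>' x" using ereal_gauge_strict_mono[of "G \<tau> x" "G \<tau>' x"] by linarith
      then have "G \<tau>' x \<le> G \<tau> x" by (simp only: not_less)
      moreover have "rep c x \<le> G \<tau>' x"
        unfolding G_def by (rule SUP_upper2[of 0]) (simp_all add: \<tau>'_def)
      ultimately show ?case by (rule order_trans[rotated])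
    qed
  next
    fix g assume "L0_fun M g" and g: "\<And>c. c \<in> S \<Longrightarrow> AE x in M. rep c x \<le> g x"
    have "AE x in M. \<forall>n. rep (\<tau> n) x \<le> g x"
      unfolding AE_all_countable
    proof
      fix n have "\<tau> n \<in> S" using \<tau> by blast
      then show "AE x in M. rep (\<tau> n) x \<le> g x" by (rule g)
    qed
    then show "AE x in M. G \<tau> x \<le> g x"
      unfolding G_def by eventually_elim (auto intro: SUP_least)
  qed (rule S)
  then show ?thesis by blast
qed

text \<open>Bounded variation is a statement about a chosen supremum. That the chosen class is an
  upper bound at all rests on the existence of a least one.\<close>

lemma (in prob_space) L0bar_le_sup:
  fixes c :: "('a \<Rightarrow> ereal) set"
  assumes "S \<subseteq> L0 M" "c \<in> S"
  shows "L0_le M c (\<Squnion>\<^bsub>L0bar M\<^esub> S)"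
proof -
  obtain s where s: "least (L0bar M) s (Upper (L0bar M) S)"
    using L0bar_sup_exists[OF assms(1)] by blast
  then have "s \<in> Upper (L0bar M) S" by (simp add: least_def)
  then have "L0_le M c s"
    unfolding Upper_def using assms by (auto simp: L0bar_def)
  then show ?thesis by (simp add: L0bar_sup_eq[OF s])
qed

section \<open>Bounded charges on an algebra of sets\<close>

text \<open>The upper variation, that is, the positive part of the Jordan decomposition, with
  competitors restricted to \<open>\<A>\<close>. It is used with the Borel sets and with the algebra
  of balls; \<open>A\<close> itself is not restricted to \<open>\<A>\<close>.\<close>

definition pos_variation :: "'w set set \<Rightarrow> ('w set \<Rightarrow> real) \<Rightarrow> 'w set \<Rightarrow> real" where
  "pos_variation \<A> \<nu> A = (SUP B\<in>{B\<in>\<A>. B \<subseteq> A}. \<nu> B)"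

text \<open>Two instances matter: bounded signed measures on the Borel sets, and the values at one
  point of chosen representatives on the algebra of balls. The bound \<open>b\<close> keeps the
  suprema in \<open>pos_variation\<close> finite.\<close>

locale charge =
  fixes \<A> :: "'w set set" and \<nu> :: "'w set \<Rightarrow> real" and b :: real
  assumes empty_in: "{} \<in> \<A>"
    and Un_in: "A \<in> \<A> \<Longrightarrow> B \<in> \<A> \<Longrightarrow> A \<union> B \<in> \<A>"
    and Diff_in: "A \<in> \<A> \<Longrightarrow> B \<in> \<A> \<Longrightarrow> A - B \<in> \<A>"
    and additive: "A \<in> \<A> \<Longrightarrow> B \<in> \<A> \<Longrightarrow> A \<inter> B = {} \<Longrightarrow> \<nu> (A \<union> B) = \<nu> A + \<nu> B"
    and bounded: "A \<in> \<A> \<Longrightarrow> \<bar>\<nu> A\<bar> \<le> b"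
begin

lemma Int_in: "A \<in> \<A> \<Longrightarrow> B \<in> \<A> \<Longrightarrow> A \<inter> B \<in> \<A>"
  using Diff_in[of A "A - B"] Diff_in[of A B] by (simp add: Diff_Diff_Int)

lemma empty: "\<nu> {} = 0"
  using additive[OF empty_in empty_in] by simp

lemma Diff_Int: "A \<in> \<A> \<Longrightarrow> B \<in> \<A> \<Longrightarrow> \<nu> A = \<nu> (A \<inter> B) + \<nu> (A - B)"
  using additive[of "A \<inter> B" "A - B"] Int_in[of A B] Diff_in[of A B] by (simp add: Int_Diff_Un Int_Diff_disjoint)

lemma Diff: "A \<in> \<A> \<Longrightarrow> B \<in> \<A> \<Longrightarrow> B \<subseteq> A \<Longrightarrow> \<nu> (A - B) = \<nu> A - \<nu> B"
  using Diff_Int[of A B] by (simp add: Int_absorb1)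

lemma negated: "charge \<A> (\<lambda>A. - \<nu> A) b"
  by unfold_locales (simp_all add: empty_in Un_in Diff_in additive bounded)

abbreviation "pv \<equiv> pos_variation \<A> \<nu>"

lemma pv_upper: "B \<in> \<A> \<Longrightarrow> B \<subseteq> A \<Longrightarrow> \<nu> B \<le> pv A"
  unfolding pos_variation_def
proof (rule cSUP_upper)
  show "bdd_above (\<nu> ` {B \<in> \<A>. B \<subseteq> A})"
  proof (rule bdd_aboveI)
    fix y assume "y \<in> \<nu> ` {B \<in> \<A>. B \<subseteq> A}"
    then obtain B where "B \<in> \<A>" "y = \<nu> B" by blast
    then show "y \<le> b" using bounded[of B] by linarith
  qed
qed simp

lemma pv_least:
  assumes "\<And>B. B \<in> \<A> \<Longrightarrow> B \<subseteq> A \<Longrightarrow> \<nu> B \<le> c"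
  shows "pv A \<le> c"
  unfolding pos_variation_def
proof (rule cSUP_least)
  show "{B \<in> \<A>. B \<subseteq> A} \<noteq> {}" using empty_in by blast
qed (use assms in simp)

lemma pv_self: "A \<in> \<A> \<Longrightarrow> \<nu> A \<le> pv A"
  by (rule pv_upper) simp_all

lemma pv_nonneg: "0 \<le> pv A"
  using pv_upper[OF empty_in, of A] empty by simp

lemma pv_empty: "pv {} = 0"
proof (rule antisym)
  show "pv {} \<le> 0" by (rule pv_least) (simp add: empty)
qed (rule pv_nonneg)

lemma pv_mono: "A \<subseteq> B \<Longrightarrow> pv A \<le> pv B"
  by (rule pv_least, rule pv_upper) simp_all

text \<open>A competitor for the union splits along \<open>A\<close>; conversely competitors for
  \<open>A\<close> and for \<open>B\<close> are disjoint and unite to one for the union.\<close>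

lemma pv_Un:
  assumes A: "A \<in> \<A>" and B: "B \<in> \<A>" and disj: "A \<inter> B = {}"
  shows "pv (A \<union> B) = pv A + pv B"
proof (rule antisym)
  show "pv (A \<union> B) \<le> pv A + pv B"
  proof (rule pv_least)
    fix C assume C: "C \<in> \<A>" "C \<subseteq> A \<union> B"
    have "C - A \<subseteq> B" using C(2) by blast
    then have "\<nu> (C \<inter> A) + \<nu> (C - A) \<le> pv A + pv B"
      by (intro add_mono pv_upper Int_in Diff_in C(1) A Int_lower2)
    then show "\<nu> C \<le> pv A + pv B" using Diff_Int[OF C(1) A] by simp
  qed
  have "pv A \<le> pv (A \<union> B) - pv B"
  proof (rule pv_least)
    fix C assume C: "C \<in> \<A>" "C \<subseteq> A"
    have "pv B \<le> pv (A \<union> B) - \<nu> C"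
    proof (rule pv_least)
      fix D assume D: "D \<in> \<A>" "D \<subseteq> B"
      have "C \<inter> D = {}" "C \<union> D \<subseteq> A \<union> B" using C D disj by blast+
      then show "\<nu> D \<le> pv (A \<union> B) - \<nu> C"
        using additive[OF C(1) D(1)] pv_upper[OF Un_in[OF C(1) D(1)], of "A \<union> B"] by linarith
    qed
    then show "\<nu> C \<le> pv (A \<union> B) - pv B" by simp
  qed
  then show "pv A + pv B \<le> pv (A \<union> B)" by simp
qed

lemma pv_Diff: "A \<in> \<A> \<Longrightarrow> B \<in> \<A> \<Longrightarrow> B \<subseteq> A \<Longrightarrow> pv (A - B) = pv A - pv B"
  using pv_Un[of B "A - B"] Diff_in[of A B] by (simp add: Un_absorb1)

lemma pv_uminus:
  assumes A: "A \<in> \<A>"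
  shows "pos_variation \<A> (\<lambda>A. - \<nu> A) A = pv A - \<nu> A"
proof (rule antisym)
  interpret neg: charge \<A> "\<lambda>A. - \<nu> A" b by (rule negated)
  show "neg.pv A \<le> pv A - \<nu> A"
  proof (rule neg.pv_least)
    fix B assume B: "B \<in> \<A>" "B \<subseteq> A"
    have "\<nu> (A - B) \<le> pv A" by (rule pv_upper[OF Diff_in[OF A B(1)]]) blast
    then show "- \<nu> B \<le> pv A - \<nu> A" using Diff[OF A B] by simp
  qed
  have "pv A \<le> neg.pv A + \<nu> A"
  proof (rule pv_least)
    fix B assume B: "B \<in> \<A>" "B \<subseteq> A"
    have "- \<nu> (A - B) \<le> neg.pv A" by (rule neg.pv_upper[OF Diff_in[OF A B(1)]]) blast
    then show "\<nu> B \<le> neg.pv A + \<nu> A" using Diff[OF A B] by simp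
  qed
  then show "pv A - \<nu> A \<le> neg.pv A" by simp
qed

text \<open>If \<open>pv (C n) \<ge> \<epsilon>\<close> for all \<open>n\<close>, then a competitor
  \<open>B\<close> for \<open>C 0\<close> satisfies \<open>\<nu> B \<le> \<nu> (B - C n) + \<delta>
  \<le> pv (C 0) - \<epsilon> + \<delta>\<close> for a suitable \<open>n\<close>, which contradicts
  the choice of \<open>pv (C 0)\<close> as a supremum. The index may depend on \<open>B\<close> and
  \<delta>, and this weak form is all that convergence in measure supplies.\<close>

lemma pv_small:
  assumes C: "\<And>n::nat. C n \<in> \<A>" "\<And>n. C n \<subseteq> C 0"
    and small: "\<And>B \<delta>. B \<in> \<A> \<Longrightarrow> \<delta> > 0 \<Longrightarrow> \<exists>n. \<bar>\<nu> (B \<inter> C n)\<bar> < \<delta>"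
    and \<epsilon>: "\<epsilon> > 0"
  shows "\<exists>n. pv (C n) < \<epsilon>"
proof (rule ccontr)
  assume "\<not> (\<exists>n. pv (C n) < \<epsilon>)"
  then have ge: "\<epsilon> \<le> pv (C n)" for n by (simp add: not_less)
  have "pv (C 0) \<le> pv (C 0) - \<epsilon>"
  proof (rule pv_least, rule field_le_epsilon)
    fix B \<delta> assume B: "B \<in> \<A>" "B \<subseteq> C 0" and \<delta>: "(0::real) < \<delta>"
    obtain n where n: "\<bar>\<nu> (B \<inter> C n)\<bar> < \<delta>" using small[OF B(1) \<delta>] by blast
    have "\<nu> (B - C n) \<le> pv (C 0 - C n)"
      using B by (intro pv_upper Diff_in C(1) Diff_mono) simp_all
    then show "\<nu> B \<le> pv (C 0) - \<epsilon> + \<delta>"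
      using Diff_Int[OF B(1) C(1)[of n]] n ge[of n] pv_Diff[OF C(1)[of 0] C(1)[of n] C(2)[of n]]
      by linarith
  qed
  then show False using \<epsilon> by simp
qed

end


section \<open>Bounded signed measures\<close>

text \<open>The working form of \<open>radon\<close>: on a compact metric space the two agree by
  \<open>radon_iff\<close>, and the bound is what the locale \<open>charge\<close> asks for.\<close>

definition bounded_signed :: "('w::topological_space set \<Rightarrow> real) \<Rightarrow> bool" where
  "bounded_signed \<nu> \<longleftrightarrow> signed_measure \<nu> \<and> (\<exists>b. \<forall>A\<in>sets borel. \<bar>\<nu> A\<bar> \<le> b)"

text \<open>Partitions are sequences by definition; \<open>binaryset\<close> continues a partition
  into two sets by empty ones.\<close>

lemma borel_partition_binaryset:
  assumes "A \<in> sets borel" "B \<in> sets borel" "A \<inter> B = {}"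
  shows "borel_partition (binaryset A B) (A \<union> B)"
  using assms unfolding borel_partition_def disjoint_family_on_def
  by (simp add: range_binaryset_eq UN_binaryset_eq) (auto simp: binaryset_def)

lemma signed_measure_additive:
  assumes "signed_measure \<nu>" "A \<in> sets borel" "B \<in> sets borel" "A \<inter> B = {}"
  shows "\<nu> (A \<union> B) = \<nu> A + \<nu> B"
proof -
  have "(\<lambda>n. \<nu> (binaryset A B n)) sums \<nu> (A \<union> B)"
    using assms(1) borel_partition_binaryset[OF assms(2-4)]
    unfolding signed_measure_def borel_partition_def by metis
  moreover have "(\<lambda>n. \<nu> (binaryset A B n)) sums (\<nu> A + \<nu> B)"
    using assms(1) by (intro binaryset_sums) (simp add: signed_measure_def)
  ultimately show ?thesis by (rule sums_unique2)
qed

lemma bounded_signed_charge: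
  assumes "bounded_signed \<nu>"
  obtains b where "charge (sets borel) \<nu> b"
proof -
  obtain b where "\<forall>A\<in>sets borel. \<bar>\<nu> A\<bar> \<le> b" using assms by (auto simp: bounded_signed_def)
  moreover have "signed_measure \<nu>" using assms by (simp add: bounded_signed_def)
  ultimately have "charge (sets borel) \<nu> b"
    by unfold_locales (simp_all add: signed_measure_additive)
  then show ?thesis by (rule that)
qed

text \<open>A point of \<open>C 0\<close> lies in exactly one difference, the one at the last index
  whose set contains it. Thus continuity at the empty set follows from countable additivity by
  telescoping, for real and for class valued measures alike.\<close>

lemma decseq_differences:
  assumes "decseq C" "(\<Inter>n::nat. C n) = {}"
  shows "disjoint_family (\<lambda>n. C n - C (Suc n))" "(\<Union>n. C n - C (Suc n)) = C 0"
proof -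
  have "(C m - C (Suc m)) \<inter> (C n - C (Suc n)) = {}" if "m < n" for m n
  proof -
    have "C n \<subseteq> C (Suc m)" using assms(1) that by (simp add: decseqD Suc_leI)
    then show ?thesis by blast
  qed
  then show "disjoint_family (\<lambda>n. C n - C (Suc n))"
    unfolding disjoint_family_on_def by (metis Int_commute linorder_neqE_nat)
  show "(\<Union>n. C n - C (Suc n)) = C 0"
  proof (rule antisym)
    show "(\<Union>n. C n - C (Suc n)) \<subseteq> C 0"
    proof (rule UN_least)
      fix n show "C n - C (Suc n) \<subseteq> C 0" using decseqD[OF assms(1), of 0 n] by auto
    qed
    show "C 0 \<subseteq> (\<Union>n. C n - C (Suc n))"
    proof
      fix x assume x: "x \<in> C 0"
      have "\<exists>n. x \<notin> C n" using assms(2) by blast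
      then obtain n where n: "x \<notin> C n" "\<And>k. k < n \<Longrightarrow> x \<in> C k"
        using exists_least_iff[of "\<lambda>n. x \<notin> C n"] by blast
      then obtain m where m: "n = Suc m" using x by (cases n) auto
      then have "x \<in> C m - C (Suc m)" using n by simp
      then show "x \<in> (\<Union>n. C n - C (Suc n))" by blast
    qed
  qed
qed

lemma signed_measure_decseq_tendsto:
  assumes \<nu>: "signed_measure \<nu>" and C: "range C \<subseteq> sets borel" "decseq C" "(\<Inter>n. C n) = {}"
  shows "(\<lambda>n. \<nu> (C n)) \<longlonglongrightarrow> 0"
proof -
  have Cm: "C n \<in> sets borel" for n using C(1) by blast
  have dec: "C (Suc n) \<subseteq> C n" for n using C(2) by (simp add: decseq_Suc_iff)
  define D where "D n = C n - C (Suc n)" for n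
  have Dm: "range D \<subseteq> sets borel" using Cm by (auto simp: D_def)
  have partial: "(\<Sum>k<n. \<nu> (D k)) = \<nu> (C 0) - \<nu> (C n)" for n
  proof (induction n)
    case (Suc n)
    have "\<nu> (C n) = \<nu> (C (Suc n)) + \<nu> (D n)"
      using signed_measure_additive[OF \<nu>, of "C (Suc n)" "D n"] Cm[of n] Cm[of "Suc n"] dec[of n]
      by (simp add: D_def Un_absorb1)
    then show ?case using Suc by simp
  qed simp
  have "disjoint_family D" "(\<Union>n. D n) = C 0"
    unfolding D_def[abs_def] by (rule decseq_differences[OF C(2,3)])+
  then have "(\<lambda>n. \<nu> (D n)) sums \<nu> (C 0)"
    using \<nu> Dm unfolding signed_measure_def by metis
  then have "(\<lambda>n. \<nu> (C 0) - \<nu> (C n)) \<longlonglongrightarrow> \<nu> (C 0)"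
    unfolding sums_def partial .
  from tendsto_diff[OF tendsto_const[of "\<nu> (C 0)"] this] show ?thesis by simp
qed

lemma bounded_signed_uminus: "bounded_signed \<nu> \<Longrightarrow> bounded_signed (\<lambda>A. - \<nu> A)"
  unfolding bounded_signed_def signed_measure_def by (simp add: sums_minus)

section \<open>The Jordan decomposition of a bounded signed measure\<close>

abbreviation "bv \<equiv> pos_variation (sets borel)"

text \<open>\<open>pv_small\<close> yields one index with a small value; monotonicity of the
  positive part along the decreasing sequence improves this to convergence.\<close>

lemma bv_small:
  assumes \<nu>: "bounded_signed \<nu>" and C: "range C \<subseteq> sets borel" "decseq C" "(\<Inter>n. C n) = {}"
  shows "(\<lambda>n. bv \<nu> (C n)) \<longlonglongrightarrow> 0"
proof -
  obtain b where "charge (sets borel) \<nu> b" using \<nu> by (rule bounded_signed_charge)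
  then interpret charge "sets borel" \<nu> b .
  have Cm: "C n \<in> sets borel" for n using C(1) by blast
  have small: "\<exists>n. bv \<nu> (C n) < \<epsilon>" if "\<epsilon> > 0" for \<epsilon>
  proof (rule pv_small[OF _ _ _ that])
    show "C n \<in> sets borel" for n by (rule Cm)
    show "C n \<subseteq> C 0" for n using decseqD[OF C(2), of 0 n] by simp
    fix B :: "'a set" and \<delta> :: real assume "B \<in> sets borel" "\<delta> > 0"
    have "(\<lambda>n. \<nu> (B \<inter> C n)) \<longlonglongrightarrow> 0"
    proof (rule signed_measure_decseq_tendsto)
      show "signed_measure \<nu>" using \<nu> by (simp add: bounded_signed_def)
      show "range (\<lambda>n. B \<inter> C n) \<subseteq> sets borel" using Cm \<open>B \<in> sets borel\<close> by auto
      show "decseq (\<lambda>n. B \<inter> C n)" using C(2) by (auto simp: decseq_def)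
      show "(\<Inter>n. B \<inter> C n) = {}" using C(3) by auto
    qed
    from LIMSEQ_D[OF this \<open>\<delta> > 0\<close>] show "\<exists>n. \<bar>\<nu> (B \<inter> C n)\<bar> < \<delta>" by auto
  qed
  show ?thesis
  proof (rule LIMSEQ_I)
    fix r :: real assume "0 < r"
    then obtain n where n: "bv \<nu> (C n) < r" using small by blast
    have "norm (bv \<nu> (C m) - 0) < r" if "m \<ge> n" for m
      using pv_mono[OF decseqD[OF C(2) that]] n pv_nonneg[of "C m"] by simp
    then show "\<exists>no. \<forall>n\<ge>no. norm (bv \<nu> (C n) - 0) < r" by blast
  qed
qed

definition bv_measure :: "('w::topological_space set \<Rightarrow> real) \<Rightarrow> 'w measure" where
  "bv_measure \<nu> = measure_of UNIV (sets borel) (\<lambda>A. ennreal (bv \<nu> A))"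

lemma space_bv_measure [simp]: "space (bv_measure \<nu>) = UNIV"
  and sets_bv_measure [simp]: "sets (bv_measure \<nu>) = sets borel"
  by (simp_all add: bv_measure_def) (metis sets.sigma_sets_eq space_borel)

text \<open>Finite additivity together with continuity at the empty set gives countable additivity,
  because the values are finite.\<close>

lemma emeasure_bv_measure:
  assumes \<nu>: "bounded_signed \<nu>" and A: "A \<in> sets borel"
  shows "emeasure (bv_measure \<nu>) A = ennreal (bv \<nu> A)"
proof -
  obtain b where "charge (sets borel) \<nu> b" using \<nu> by (rule bounded_signed_charge)
  then interpret charge "sets borel" \<nu> b .
  interpret B: sigma_algebra UNIV "sets (borel :: 'a measure)"
    using sets.sigma_algebra_axioms[of "borel :: 'a measure"] by simp
  have pos: "positive (sets borel) (\<lambda>A. ennreal (bv \<nu> A))"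
    by (simp add: positive_def pv_empty)
  have "Measure_Space.additive (sets borel) (\<lambda>A. ennreal (bv \<nu> A))"
    by (simp add: Measure_Space.additive_def pv_Un ennreal_plus[symmetric] pv_nonneg del: ennreal_plus)
  then have ca: "countably_additive (sets borel) (\<lambda>A. ennreal (bv \<nu> A))"
  proof (rule B.empty_continuous_imp_countably_additive[OF pos])
    fix C :: "nat \<Rightarrow> 'a set" assume "range C \<subseteq> sets borel" "decseq C" "(\<Inter>i. C i) = {}"
    from tendsto_ennrealI[OF bv_small[OF \<nu> this]]
    show "(\<lambda>i. ennreal (bv \<nu> (C i))) \<longlonglongrightarrow> 0" by simp
  qed simp
  show ?thesis
    unfolding bv_measure_def
    by (rule emeasure_measure_of_sigma[OF B.sigma_algebra_axioms pos ca A])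
qed

lemma finite_measure_bv_measure:
  assumes "bounded_signed \<nu>"
  shows "finite_measure (bv_measure \<nu>)"
proof (rule finite_measureI)
  show "emeasure (bv_measure \<nu>) (space (bv_measure \<nu>)) \<noteq> \<infinity>"
    using emeasure_bv_measure[OF assms, of UNIV] by simp
qed

lemma measure_bv_measure:
  assumes "bounded_signed \<nu>" "A \<in> sets borel"
  shows "measure (bv_measure \<nu>) A = bv \<nu> A"
proof -
  obtain b where "charge (sets borel) \<nu> b" using assms(1) by (rule bounded_signed_charge)
  then interpret charge "sets borel" \<nu> b .
  show ?thesis using emeasure_bv_measure[OF assms] by (simp add: measure_def pv_nonneg)
qed

text \<open>The upper bound holds term by term and is summed with the two Jordan measures; for the
  lower bound partitions into two sets already suffice.\<close>

lemma variation_eq: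
  assumes \<nu>: "bounded_signed \<nu>" and A: "A \<in> sets borel"
  shows "variation \<nu> A = ennreal (bv \<nu> A + bv (\<lambda>A. - \<nu> A) A)"
proof (rule antisym)
  obtain b where "charge (sets borel) \<nu> b" using \<nu> by (rule bounded_signed_charge)
  then interpret charge "sets borel" \<nu> b .
  interpret neg: charge "sets borel" "\<lambda>A. - \<nu> A" b by (rule negated)
  note neg_\<nu> = bounded_signed_uminus[OF \<nu>]
  show "variation \<nu> A \<le> ennreal (bv \<nu> A + bv (\<lambda>A. - \<nu> A) A)"
    unfolding variation_def
  proof (rule Sup_least)
    fix y assume "y \<in> {\<Sum>n. ennreal \<bar>\<nu> (B n)\<bar> |B. borel_partition B A}"
    then obtain B where B: "borel_partition B A" and y: "y = (\<Sum>n. ennreal \<bar>\<nu> (B n)\<bar>)" by blast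
    have Bm: "B n \<in> sets borel" and rB: "range B \<subseteq> sets borel" and dB: "disjoint_family B"
      and UB: "(\<Union>n. B n) = A" for n
      using B by (auto simp: borel_partition_def)
    have "ennreal \<bar>\<nu> (B n)\<bar> \<le> emeasure (bv_measure \<nu>) (B n) + emeasure (bv_measure (\<lambda>A. - \<nu> A)) (B n)" for n
    proof -
      have "\<bar>\<nu> (B n)\<bar> \<le> bv \<nu> (B n) + bv (\<lambda>A. - \<nu> A) (B n)"
        using pv_self[OF Bm] neg.pv_self[OF Bm] pv_nonneg neg.pv_nonneg by (smt (verit))
      then show ?thesis
        by (simp add: emeasure_bv_measure \<nu> neg_\<nu> Bm ennreal_plus[symmetric] pv_nonneg neg.pv_nonneg
            ennreal_leI del: ennreal_plus)
    qed
    then have "y \<le> (\<Sum>n. emeasure (bv_measure \<nu>) (B n) + emeasure (bv_measure (\<lambda>A. - \<nu> A)) (B n))"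
      unfolding y by (intro suminf_le) simp_all
    also have "\<dots> = (\<Sum>n. emeasure (bv_measure \<nu>) (B n)) + (\<Sum>n. emeasure (bv_measure (\<lambda>A. - \<nu> A)) (B n))"
      by (rule suminf_add[symmetric]) simp_all
    also have "\<dots> = emeasure (bv_measure \<nu>) A + emeasure (bv_measure (\<lambda>A. - \<nu> A)) A"
      using suminf_emeasure[of B "bv_measure \<nu>"] suminf_emeasure[of B "bv_measure (\<lambda>A. - \<nu> A)"] rB dB UB
      by simp
    also have "\<dots> = ennreal (bv \<nu> A + bv (\<lambda>A. - \<nu> A) A)"
      by (simp add: emeasure_bv_measure \<nu> neg_\<nu> A pv_nonneg neg.pv_nonneg)
    finally show "y \<le> ennreal (bv \<nu> A + bv (\<lambda>A. - \<nu> A) A)" .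
  qed
  have pair: "ennreal (\<bar>\<nu> B\<bar> + \<bar>\<nu> (A - B)\<bar>) \<le> variation \<nu> A" if B: "B \<in> sets borel" "B \<subseteq> A" for B
  proof -
    have "borel_partition (binaryset B (A - B)) (B \<union> (A - B))"
      using A B by (intro borel_partition_binaryset) auto
    then have "(\<Sum>n. ennreal \<bar>\<nu> (binaryset B (A - B) n)\<bar>) \<le> variation \<nu> A"
      unfolding variation_def using B(2) by (intro Sup_upper) (auto simp: Un_absorb1)
    moreover have "(\<Sum>n. ennreal \<bar>\<nu> (binaryset B (A - B) n)\<bar>) = ennreal \<bar>\<nu> B\<bar> + ennreal \<bar>\<nu> (A - B)\<bar>"
      by (rule suminf_binaryset_eq) (simp add: empty)
    ultimately show ?thesis by simp
  qed
  show "ennreal (bv \<nu> A + bv (\<lambda>A. - \<nu> A) A) \<le> variation \<nu> A"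
  proof (cases "variation \<nu> A")
    case (real v)
    \<comment> \<open>As \<open>\<nu> A = \<nu> B + \<nu> (A - B)\<close>, twice
      \<open>\<nu> B\<close> equals \<open>\<nu> A\<close> plus
      \<open>\<nu> B - \<nu> (A - B)\<close>, and the latter is at most the sum over the partition
      of \<open>A\<close> into \<open>B\<close> and \<open>A - B\<close>.\<close>
    have "bv \<nu> A \<le> (v + \<nu> A) / 2"
    proof (rule pv_least)
      fix B assume B: "B \<in> sets borel" "B \<subseteq> A"
      have "\<bar>\<nu> B\<bar> + \<bar>\<nu> (A - B)\<bar> \<le> v"
        using pair[OF B] real by (simp add: ennreal_plus[symmetric] del: ennreal_plus)
      moreover have "\<nu> B \<le> \<bar>\<nu> B\<bar>" "- \<nu> (A - B) \<le> \<bar>\<nu> (A - B)\<bar>"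
        by (rule abs_ge_self abs_ge_minus_self)+
      ultimately show "\<nu> B \<le> (v + \<nu> A) / 2" using Diff[OF A B] by (simp add: field_simps)
    qed
    then have "bv \<nu> A + bv (\<lambda>A. - \<nu> A) A \<le> v"
      unfolding pv_uminus[OF A] by (simp add: field_simps)
    then show ?thesis unfolding real(2) by (rule ennreal_leI)
  qed simp
qed

lemma bounded_signed_iff:
  "bounded_signed \<nu> \<longleftrightarrow> signed_measure \<nu> \<and> variation \<nu> UNIV < \<infinity>"
proof
  assume "bounded_signed \<nu>"
  then show "signed_measure \<nu> \<and> variation \<nu> UNIV < \<infinity>"
    using variation_eq[of \<nu> UNIV] by (simp add: bounded_signed_def)
next
  assume *: "signed_measure \<nu> \<and> variation \<nu> UNIV < \<infinity>"
  then obtain v where v: "v \<ge> 0" "variation \<nu> UNIV = ennreal v"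
    by (cases "variation \<nu> UNIV") auto
  have e: "\<nu> {} = 0" using * by (simp add: signed_measure_def)
  have "\<bar>\<nu> B\<bar> \<le> v" if B: "B \<in> sets borel" for B
  proof -
    have "borel_partition (binaryset B (- B)) (B \<union> - B)"
      using B by (intro borel_partition_binaryset) auto
    then have "(\<Sum>n. ennreal \<bar>\<nu> (binaryset B (- B) n)\<bar>) \<le> variation \<nu> UNIV"
      unfolding variation_def by (intro Sup_upper) auto
    moreover have "(\<Sum>n. ennreal \<bar>\<nu> (binaryset B (- B) n)\<bar>) = ennreal \<bar>\<nu> B\<bar> + ennreal \<bar>\<nu> (- B)\<bar>"
      by (rule suminf_binaryset_eq) (simp add: e)
    ultimately have "\<bar>\<nu> B\<bar> + \<bar>\<nu> (- B)\<bar> \<le> v"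
      using v by (simp add: ennreal_plus[symmetric] del: ennreal_plus)
    then show ?thesis by linarith
  qed
  then show "bounded_signed \<nu>" using * by (auto simp: bounded_signed_def)
qed

text \<open>The real valued form of \<open>variation\<close>. Since the suprema behind it run over
  Borel subsets of an arbitrary set, monotonicity and subadditivity in \<nu> hold without
  measurability of the set.\<close>

definition tv :: "('w::topological_space set \<Rightarrow> real) \<Rightarrow> 'w set \<Rightarrow> real" where
  "tv \<nu> A = bv \<nu> A + bv (\<lambda>A. - \<nu> A) A"

lemma tv_nonneg: "bounded_signed \<nu> \<Longrightarrow> 0 \<le> tv \<nu> A"
  by (metis add_nonneg_nonneg bounded_signed_charge bounded_signed_uminus charge.pv_nonneg tv_def)

lemma variation_tv: "bounded_signed \<nu> \<Longrightarrow> A \<in> sets borel \<Longrightarrow> variation \<nu> A = ennreal (tv \<nu> A)"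
  unfolding tv_def by (rule variation_eq)

lemma bv_eq_tv:
  assumes "bounded_signed \<nu>" "A \<in> sets borel"
  shows "bv \<nu> A = (tv \<nu> A + \<nu> A) / 2" "bv (\<lambda>A. - \<nu> A) A = (tv \<nu> A - \<nu> A) / 2"
proof -
  obtain b where "charge (sets borel) \<nu> b" using assms(1) by (rule bounded_signed_charge)
  from charge.pv_uminus[OF this assms(2)]
  show "bv \<nu> A = (tv \<nu> A + \<nu> A) / 2" "bv (\<lambda>A. - \<nu> A) A = (tv \<nu> A - \<nu> A) / 2"
    by (simp_all add: tv_def)
qed

text \<open>The measures occurring in \<open>pairing\<close> are given by a formula for their values
  only; their countable additivity comes from this identification.\<close>

lemma pos_part_eq:
  assumes "bounded_signed \<nu>"
  shows "pos_part \<nu> = bv_measure \<nu>" "neg_part \<nu> = bv_measure (\<lambda>A. - \<nu> A)"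
proof -
  have *: "sigma_sets UNIV (sets (borel :: 'a measure)) = sets borel"
    using sets.sigma_sets_eq[of "borel :: 'a measure"] by simp
  show "pos_part \<nu> = bv_measure \<nu>" "neg_part \<nu> = bv_measure (\<lambda>A. - \<nu> A)"
    unfolding pos_part_def neg_part_def bv_measure_def
    by (rule measure_of_eq;
      simp add: * variation_tv[OF assms] bv_eq_tv[OF assms] tv_nonneg[OF assms])+
qed

definition tv_measure :: "('w::topological_space set \<Rightarrow> real) \<Rightarrow> 'w measure" where
  "tv_measure \<nu> = measure_of UNIV (sets borel) (variation \<nu>)"

lemma space_tv_measure [simp]: "space (tv_measure \<nu>) = UNIV"
  and sets_tv_measure [simp]: "sets (tv_measure \<nu>) = sets borel"
  by (simp_all add: tv_measure_def) (metis sets.sigma_sets_eq space_borel)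

lemma emeasure_tv_measure:
  assumes \<nu>: "bounded_signed \<nu>" and A: "A \<in> sets borel"
  shows "emeasure (tv_measure \<nu>) A = ennreal (tv \<nu> A)"
proof -
  obtain b where "charge (sets borel) \<nu> b" using \<nu> by (rule bounded_signed_charge)
  then interpret charge "sets borel" \<nu> b .
  interpret neg: charge "sets borel" "\<lambda>A. - \<nu> A" b by (rule negated)
  note neg_\<nu> = bounded_signed_uminus[OF \<nu>]
  interpret B: sigma_algebra UNIV "sets (borel :: 'a measure)"
    using sets.sigma_algebra_axioms[of "borel :: 'a measure"] by simp
  have sum: "variation \<nu> A = emeasure (bv_measure \<nu>) A + emeasure (bv_measure (\<lambda>A. - \<nu> A)) A"
    if "A \<in> sets borel" for A
    by (simp add: variation_eq[OF \<nu> that] emeasure_bv_measure \<nu> neg_\<nu> that pv_nonneg neg.pv_nonneg)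
  have pos: "positive (sets borel) (variation \<nu>)"
    by (simp add: positive_def sum)
  have ca: "countably_additive (sets borel) (variation \<nu>)"
  proof (rule countably_additiveI)
    fix C :: "nat \<Rightarrow> 'a set"
    assume C: "range C \<subseteq> sets borel" "disjoint_family C" "(\<Union>i. C i) \<in> sets borel"
    then have Cm: "C n \<in> sets borel" for n by blast
    have "(\<Sum>i. variation \<nu> (C i)) =
        (\<Sum>i. emeasure (bv_measure \<nu>) (C i)) + (\<Sum>i. emeasure (bv_measure (\<lambda>A. - \<nu> A)) (C i))"
      unfolding sum[OF Cm] by (rule suminf_add[symmetric]) simp_all
    also have "\<dots> = variation \<nu> (\<Union>i. C i)"
      using suminf_emeasure[of C "bv_measure \<nu>"] suminf_emeasure[of C "bv_measure (\<lambda>A. - \<nu> A)"] C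
      by (simp add: sum[OF C(3)])
    finally show "(\<Sum>i. variation \<nu> (C i)) = variation \<nu> (\<Union>i. C i)" .
  qed
  have "emeasure (tv_measure \<nu>) A = variation \<nu> A"
    unfolding tv_measure_def by (rule emeasure_measure_of_sigma[OF B.sigma_algebra_axioms pos ca A])
  then show ?thesis by (simp add: variation_tv[OF \<nu> A])
qed

lemma measure_tv_measure:
  "bounded_signed \<nu> \<Longrightarrow> A \<in> sets borel \<Longrightarrow> measure (tv_measure \<nu>) A = tv \<nu> A"
  by (simp add: measure_def emeasure_tv_measure tv_nonneg)

lemma finite_measure_tv_measure:
  assumes "bounded_signed \<nu>"
  shows "finite_measure (tv_measure \<nu>)"
  by (rule finite_measureI) (simp add: emeasure_tv_measure[OF assms])

lemma tv_mono: "bounded_signed \<nu> \<Longrightarrow> A \<subseteq> B \<Longrightarrow> tv \<nu> A \<le> tv \<nu> B"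
  by (metis add_mono bounded_signed_charge bounded_signed_uminus charge.pv_mono tv_def)

lemma abs_le_tv: "bounded_signed \<nu> \<Longrightarrow> A \<in> sets borel \<Longrightarrow> \<bar>\<nu> A\<bar> \<le> tv \<nu> A"
proof -
  assume "bounded_signed \<nu>" and A: "A \<in> sets borel"
  obtain b where "charge (sets borel) \<nu> b" using \<open>bounded_signed \<nu>\<close> by (rule bounded_signed_charge)
  then interpret charge "sets borel" \<nu> b .
  interpret neg: charge "sets borel" "\<lambda>A. - \<nu> A" b by (rule negated)
  show ?thesis
    using pv_self[OF A] neg.pv_self[OF A] pv_nonneg neg.pv_nonneg unfolding tv_def by (smt (verit))
qed

lemma bounded_signed_add:
  assumes "bounded_signed \<nu>" "bounded_signed \<nu>'"
  shows "bounded_signed (\<lambda>A. \<nu> A + \<nu>' A)"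
proof -
  obtain b b' where b: "\<forall>A\<in>sets borel. \<bar>\<nu> A\<bar> \<le> b" "\<forall>A\<in>sets borel. \<bar>\<nu>' A\<bar> \<le> b'"
    using assms by (auto simp: bounded_signed_def)
  have "\<bar>\<nu> A + \<nu>' A\<bar> \<le> b + b'" if "A \<in> sets borel" for A
    using bspec[OF b(1) that] bspec[OF b(2) that] by linarith
  moreover have "signed_measure (\<lambda>A. \<nu> A + \<nu>' A)"
    using assms unfolding bounded_signed_def signed_measure_def by (simp add: sums_add)
  ultimately show ?thesis unfolding bounded_signed_def by blast
qed

lemma bounded_signed_scale:
  assumes "bounded_signed \<nu>"
  shows "bounded_signed (\<lambda>A. c * \<nu> A)"
proof -
  obtain b where b: "\<forall>A\<in>sets borel. \<bar>\<nu> A\<bar> \<le> b"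
    using assms by (auto simp: bounded_signed_def)
  have "\<bar>c * \<nu> A\<bar> \<le> \<bar>c\<bar> * b" if "A \<in> sets borel" for A
    using bspec[OF b that] by (simp add: abs_mult mult_left_mono)
  moreover have "signed_measure (\<lambda>A. c * \<nu> A)"
    using assms unfolding bounded_signed_def signed_measure_def by (simp add: sums_mult)
  ultimately show ?thesis unfolding bounded_signed_def by blast
qed

lemma bounded_signed_zero: "bounded_signed (\<lambda>A. 0)"
  unfolding bounded_signed_def signed_measure_def by (auto intro: exI[of _ 0])

text \<open>The case distinction enforces the convention that signed measures vanish off the Borel
  sets.\<close>

lemma bounded_signed_measure_diff:
  assumes "finite_measure N" "finite_measure N'" "sets N = sets borel" "sets N' = sets borel"
  shows "bounded_signed (\<lambda>A. if A \<in> sets borel then measure N A - measure N' A else 0)"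
proof -
  interpret N: finite_measure N by fact
  interpret N': finite_measure N' by fact
  let ?\<nu> = "\<lambda>A. if A \<in> sets borel then measure N A - measure N' A else 0"
  have "(\<lambda>n. ?\<nu> (A n)) sums ?\<nu> (\<Union>n. A n)"
    if A: "range A \<subseteq> sets borel" "disjoint_family A" for A
  proof -
    have Am: "A n \<in> sets borel" "(\<Union>n. A n) \<in> sets borel" for n using A(1) by auto
    have "(\<lambda>n. measure N (A n) - measure N' (A n)) sums (measure N (\<Union>n. A n) - measure N' (\<Union>n. A n))"
      using A assms(3,4) by (intro sums_diff N.finite_measure_UNION N'.finite_measure_UNION) simp_all
    then show ?thesis using Am by simp
  qed
  then have "signed_measure ?\<nu>" unfolding signed_measure_def by simp
  moreover have "\<bar>?\<nu> A\<bar> \<le> measure N (space N) + measure N' (space N')" if "A \<in> sets borel" for A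
  proof -
    have "\<bar>measure N A - measure N' A\<bar> \<le> measure N (space N) + measure N' (space N')"
      using N.bounded_measure[of A] N'.bounded_measure[of A] measure_nonneg[of N A] measure_nonneg[of N' A]
      by arith
    then show ?thesis using that by simp
  qed
  ultimately show ?thesis unfolding bounded_signed_def by blast
qed

section \<open>Regularity on compact metric spaces\<close>

lemma open_eq_Union_closed:
  fixes U :: "'w::metric_space set"
  assumes "open U"
  obtains F :: "nat \<Rightarrow> 'w set" where "\<And>n. closed (F n)" "incseq F" "(\<Union>n. F n) = U"
\<comment> \<open>The distance to the empty set is 0 by convention, so the sets \<open>F n\<close>
  below would be empty for the whole space.\<close>
proof (cases "U = UNIV")
  case True
  then show ?thesis using that[of "\<lambda>_. UNIV"] by simp
next
  case False
  define F where "F n = {x. inverse (real (Suc n)) \<le> infdist x (- U)}" for n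
  have "closed (F n)" for n
    unfolding F_def by (intro closed_Collect_le continuous_intros)
  moreover have "incseq F"
  proof (rule incseq_SucI)
    fix n show "F n \<le> F (Suc n)"
    proof
      fix x assume "x \<in> F n"
      moreover have "inverse (real (Suc (Suc n))) \<le> inverse (real (Suc n))"
        by (rule le_imp_inverse_le) simp_all
      ultimately show "x \<in> F (Suc n)" unfolding F_def mem_Collect_eq by (rule order_trans[rotated])
    qed
  qed
  moreover have "(\<Union>n. F n) = U"
  proof (rule Set.set_eqI)
    fix x
    have cl: "closed (- U)" "- U \<noteq> {}" using assms False by auto
    have "x \<in> (\<Union>n. F n) \<longleftrightarrow> 0 < infdist x (- U)"
    proof
      assume "x \<in> (\<Union>n. F n)"
      then obtain n where "inverse (real (Suc n)) \<le> infdist x (- U)" by (auto simp: F_def)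
      moreover have "0 < inverse (real (Suc n))" by simp
      ultimately show "0 < infdist x (- U)" by linarith
    next
      assume "0 < infdist x (- U)"
      from reals_Archimedean[OF this] obtain n where "inverse (real (Suc n)) < infdist x (- U)" by blast
      then have "x \<in> F n" by (simp add: F_def)
      then show "x \<in> (\<Union>n. F n)" by blast
    qed
    also have "\<dots> \<longleftrightarrow> \<not> x \<in> - U"
      using in_closed_iff_infdist_zero[OF cl, of x] infdist_nonneg[of x "- U"] by linarith
    finally show "x \<in> (\<Union>n. F n) \<longleftrightarrow> x \<in> U" by simp
  qed
  ultimately show ?thesis by (rule that)
qed

text \<open>Inner and outer approximation are required together, so that taking complements merely
  exchanges the closed and the open set.\<close>

definition approximable :: "'w::metric_space measure \<Rightarrow> 'w set \<Rightarrow> bool" where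
  "approximable N B \<longleftrightarrow>
    (\<forall>e>0. \<exists>F U. closed F \<and> open U \<and> F \<subseteq> B \<and> B \<subseteq> U \<and> measure N (U - F) < e)"

lemma approximableD:
  "approximable N B \<Longrightarrow> e > 0 \<Longrightarrow>
    \<exists>F U. closed F \<and> open U \<and> F \<subseteq> B \<and> B \<subseteq> U \<and> measure N (U - F) < e"
  by (simp add: approximable_def)

text \<open>The approximable sets contain the open ones, since these are increasing unions of closed
  sets, and they are closed under complements and countable unions.\<close>

lemma borel_approximable:
  fixes N :: "'w::metric_space measure"
  assumes "finite_measure N" and sets: "sets N = sets borel" and "B \<in> sets borel"
  shows "approximable N B"
proof -
  interpret finite_measure N by fact
  have "B \<in> sigma_sets UNIV {S. open S}"
    using assms(3) unfolding borel_def by simp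
  then show ?thesis
  proof induction
    case (Basic U)
    then have U: "open U" by simp
    obtain F :: "nat \<Rightarrow> 'w set" where F: "\<And>n. closed (F n)" "incseq F" "(\<Union>n. F n) = U"
      using U by (rule open_eq_Union_closed) blast
    have r: "range F \<subseteq> sets N" using F(1) by (auto simp: sets intro: borel_closed)
    have lim: "(\<lambda>n. measure N (F n)) \<longlonglongrightarrow> measure N U"
      using finite_Lim_measure_incseq[OF r F(2)] F(3) by simp
    show ?case unfolding approximable_def
    proof (intro allI impI)
      fix e :: real assume "e > 0"
      from LIMSEQ_D[OF lim this] obtain n where n: "norm (measure N (F n) - measure N U) < e" by blast
      have "F n \<subseteq> U" using F(3) by blast
      moreover have "measure N (U - F n) = measure N U - measure N (F n)"
        using U F(1) \<open>F n \<subseteq> U\<close> by (intro finite_measure_Diff) (auto simp: sets)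
      ultimately show "\<exists>F Ua. closed F \<and> open Ua \<and> F \<subseteq> U \<and> U \<subseteq> Ua \<and> measure N (Ua - F) < e"
        using n F(1) U by (intro exI[of _ "F n"] exI[of _ U]) auto
    qed
  next
    case Empty
    have "closed ({} :: 'w set) \<and> open ({} :: 'w set) \<and> {} \<subseteq> {} \<and> {} \<subseteq> {} \<and> measure N ({} - {}) < e" if "e > 0" for e
      using that by simp
    then show ?case unfolding approximable_def by blast
  next
    case (Compl B)
    show ?case unfolding approximable_def
    proof (intro allI impI)
      fix e :: real assume "e > 0"
      from approximableD[OF Compl.IH this] obtain F U where
        FU: "closed F" "open U" "F \<subseteq> B" "B \<subseteq> U" "measure N (U - F) < e" by blast
      have "- F - - U = U - F" by blast
      then have "measure N (- F - - U) < e" using FU(5) by simp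
      moreover have "closed (- U)" "open (- F)" using FU by auto
      moreover have "- U \<subseteq> UNIV - B" "UNIV - B \<subseteq> - F" using FU by blast+
      ultimately show "\<exists>F U. closed F \<and> open U \<and> F \<subseteq> UNIV - B \<and> UNIV - B \<subseteq> U \<and> measure N (U - F) < e"
        by blast
    qed
  next
    case (Union B)
    show ?case unfolding approximable_def
    proof (intro allI impI)
      fix e :: real assume e: "e > 0"
      \<comment> \<open>The tolerances add up to \<open>e / 2\<close>. The other half pays for
        replacing the union of all \<open>F i\<close>, which need not be closed, by the finite union
        \<open>K n\<close>.\<close>
      have "\<exists>F U. closed F \<and> open U \<and> F \<subseteq> B i \<and> B i \<subseteq> U \<and> measure N (U - F) < e / 2 * (1/2) ^ Suc i" for i
        by (rule approximableD[OF Union.IH]) (use e in simp)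
      then obtain F U where FU: "\<And>i. closed (F i)" "\<And>i. open (U i)" "\<And>i. F i \<subseteq> B i" "\<And>i. B i \<subseteq> U i"
        "\<And>i. measure N (U i - F i) < e / 2 * (1/2) ^ Suc i" by metis
      define V where "V = (\<Union>i. U i)"
      define K where "K n = (\<Union>i<n. F i)" for n
      have V: "open V" using FU(2) by (auto simp: V_def)
      have K: "closed (K n)" for n using FU(1) by (auto simp: K_def)
      have FN: "F i \<in> sets N" "U i \<in> sets N" "V \<in> sets N" "K n \<in> sets N" for i n
        using FU K V by (auto simp: sets)
      have KU: "(\<Union>n. K n) = (\<Union>i. F i)" by (auto simp: K_def)
      have summ: "summable (\<lambda>i. e / 2 * (1/2) ^ Suc i)"
        using power_half_series sums_mult[of "\<lambda>i. (1/2) ^ Suc i" 1 "e/2"] by (auto simp: sums_iff)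
      have "measure N (V - (\<Union>i. F i)) \<le> measure N (\<Union>i. U i - F i)"
        using FN by (intro finite_measure_mono) (auto simp: V_def)
      also have "\<dots> \<le> (\<Sum>i. measure N (U i - F i))"
      proof (rule finite_measure_subadditive_countably)
        show "range (\<lambda>i. U i - F i) \<subseteq> sets N" using FN by auto
        show "summable (\<lambda>i. measure N (U i - F i))"
          by (rule summable_comparison_test'[OF summ, of 0]) (use FU(5) in \<open>simp add: less_imp_le\<close>)
      qed
      also have "\<dots> \<le> (\<Sum>i. e / 2 * (1/2) ^ Suc i)"
        by (rule suminf_le[OF _ _ summ])
          (use FU(5) less_imp_le summable_comparison_test'[OF summ, of 0 "\<lambda>i. measure N (U i - F i)"] in \<open>auto\<close>)
      also have "\<dots> = e / 2"
        using sums_unique[OF sums_mult[OF power_half_series, of "e/2"]] by simp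
      finally have half: "measure N (V - (\<Union>i. F i)) \<le> e / 2" .
      have "incseq K" unfolding incseq_def K_def by (intro allI impI UN_mono) auto
      then have dec: "decseq (\<lambda>n. V - K n)" by (auto simp: decseq_def incseq_def)
      have "(\<lambda>n. measure N (V - K n)) \<longlonglongrightarrow> measure N (\<Inter>n. V - K n)"
        using FN dec by (intro finite_Lim_measure_decseq) auto
      moreover have "(\<Inter>n. V - K n) = V - (\<Union>i. F i)" unfolding KU[symmetric] by auto
      ultimately have "(\<lambda>n. measure N (V - K n)) \<longlonglongrightarrow> measure N (V - (\<Union>i. F i))" by simp
      from LIMSEQ_D[OF this, of "e/2"] e obtain n where
        "norm (measure N (V - K n) - measure N (V - (\<Union>i. F i))) < e / 2" by auto
      then have "measure N (V - K n) < e" using half by (simp only: real_norm_def)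
      moreover have "K n \<subseteq> (\<Union>i. B i)" "(\<Union>i. B i) \<subseteq> V"
        using FU(3,4) unfolding K_def V_def by blast+
      ultimately show "\<exists>F U. closed F \<and> open U \<and> F \<subseteq> \<Union> (range B) \<and> \<Union> (range B) \<subseteq> U \<and> measure N (U - F) < e"
        using K[of n] V by (intro exI[of _ "K n"] exI[of _ V] conjI)
    qed
  qed
qed

text \<open>Both regularity conditions follow by applying \<open>borel_approximable\<close> to the
  total variation measure; closed sets are compact here, so inner approximation by closed sets is
  approximation by compact ones.\<close>

lemma radon_iff:
  fixes \<nu> :: "'w::metric_space set \<Rightarrow> real"
  assumes "compact (UNIV :: 'w set)"
  shows "radon \<nu> \<longleftrightarrow> bounded_signed \<nu>"
proof
  assume "radon \<nu>" then show "bounded_signed \<nu>" unfolding bounded_signed_iff radon_def by blast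
next
  assume \<nu>: "bounded_signed \<nu>"
  interpret finite_measure "tv_measure \<nu>" by (rule finite_measure_tv_measure[OF \<nu>])
  have comp: "compact F" if "closed F" for F :: "'w set"
    using compact_Int_closed[OF assms that] by simp
  have split: "tv \<nu> U \<le> tv \<nu> F + tv \<nu> (U - F)" if "closed F" "U \<in> sets borel" "F \<subseteq> U" for F U
    using finite_measure_Diff[of U F] that
    by (simp add: measure_tv_measure[OF \<nu>] borel_closed)
  have approx: "\<exists>F U. closed F \<and> open U \<and> F \<subseteq> B \<and> B \<subseteq> U \<and> tv \<nu> (U - F) < e"
    if B: "B \<in> sets borel" and e: "e > 0" for B e
  proof -
    obtain F U where FU: "closed F" "open U" "F \<subseteq> B" "B \<subseteq> U" "measure (tv_measure \<nu>) (U - F) < e"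
      using borel_approximable[OF finite_measure_axioms _ B] e
      unfolding approximable_def by auto
    then show ?thesis by (auto simp: measure_tv_measure[OF \<nu>] borel_closed borel_open)
  qed
  have mono: "variation \<nu> A \<le> variation \<nu> B" if "A \<in> sets borel" "B \<in> sets borel" "A \<subseteq> B" for A B
    using that by (simp add: variation_tv[OF \<nu>] tv_mono[OF \<nu>] ennreal_leI)
  have "variation \<nu> U = Sup {variation \<nu> K |K. compact K \<and> K \<subseteq> U}" if U: "open U" for U
  proof (rule antisym)
    have Um: "U \<in> sets borel" using U by (rule borel_open)
    show "Sup {variation \<nu> K |K. compact K \<and> K \<subseteq> U} \<le> variation \<nu> U"
      by (rule Sup_least) (auto intro!: mono Um borel_closed compact_imp_closed)
    show "variation \<nu> U \<le> Sup {variation \<nu> K |K. compact K \<and> K \<subseteq> U}"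
    proof (rule ennreal_le_epsilon)
      fix e :: real assume "0 < e"
      from approx[OF Um this] obtain F V where F: "closed F" "open V" "F \<subseteq> U" "U \<subseteq> V" "tv \<nu> (V - F) < e" by blast
      have "tv \<nu> (U - F) \<le> tv \<nu> (V - F)" using F(4) by (intro tv_mono[OF \<nu>]) blast
      then have "tv \<nu> (U - F) \<le> e" using F(5) by linarith
      then have "tv \<nu> U \<le> tv \<nu> F + e" using split[OF F(1) Um F(3)] by simp
      then have "variation \<nu> U \<le> variation \<nu> F + ennreal e"
        using \<open>0 < e\<close> by (simp add: variation_tv[OF \<nu>] Um F(1) borel_closed tv_nonneg[OF \<nu>]
            ennreal_leI ennreal_plus[symmetric] del: ennreal_plus)
      also have "\<dots> \<le> Sup {variation \<nu> K |K. compact K \<and> K \<subseteq> U} + ennreal e"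
        using comp[OF F(1)] F(3) by (intro add_right_mono Sup_upper) blast
      finally show "variation \<nu> U \<le> Sup {variation \<nu> K |K. compact K \<and> K \<subseteq> U} + ennreal e" .
    qed
  qed
  moreover have "variation \<nu> B = Inf {variation \<nu> U |U. open U \<and> B \<subseteq> U}" if B: "B \<in> sets borel" for B
  proof (rule antisym)
    show "variation \<nu> B \<le> Inf {variation \<nu> U |U. open U \<and> B \<subseteq> U}"
      by (rule Inf_greatest) (auto intro!: mono B borel_open)
    show "Inf {variation \<nu> U |U. open U \<and> B \<subseteq> U} \<le> variation \<nu> B"
    proof (rule ennreal_le_epsilon)
      fix e :: real assume "0 < e"
      from approx[OF B this] obtain F U where F: "closed F" "open U" "F \<subseteq> B" "B \<subseteq> U" "tv \<nu> (U - F) < e" by blast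
      have "F \<subseteq> U" using F(3,4) by blast
      then have "tv \<nu> U \<le> tv \<nu> B + e"
        using split[OF F(1) borel_open[OF F(2)]] F(5) tv_mono[OF \<nu> F(3)] by fastforce
      then have "variation \<nu> U \<le> variation \<nu> B + ennreal e"
        using \<open>0 < e\<close> by (simp add: variation_tv[OF \<nu>] B F(2) borel_open tv_nonneg[OF \<nu>]
            ennreal_leI ennreal_plus[symmetric] del: ennreal_plus)
      moreover have "Inf {variation \<nu> U |U. open U \<and> B \<subseteq> U} \<le> variation \<nu> U"
        using F(2,4) by (intro Inf_lower) blast
      ultimately show "Inf {variation \<nu> U |U. open U \<and> B \<subseteq> U} \<le> variation \<nu> B + ennreal e" by simp
    qed
  qed
  ultimately show "radon \<nu>" using \<nu> unfolding radon_def bounded_signed_iff by blast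
qed

section \<open>A countable algebra that generates the Borel sets\<close>

inductive_set gen_alg :: "'w set set \<Rightarrow> 'w set set" for G :: "'w set set" where
  base: "A \<in> G \<Longrightarrow> A \<in> gen_alg G"
| empty: "{} \<in> gen_alg G"
| Compl: "A \<in> gen_alg G \<Longrightarrow> - A \<in> gen_alg G"
| Un: "A \<in> gen_alg G \<Longrightarrow> B \<in> gen_alg G \<Longrightarrow> A \<union> B \<in> gen_alg G"

lemma gen_alg_Diff: "A \<in> gen_alg G \<Longrightarrow> B \<in> gen_alg G \<Longrightarrow> A - B \<in> gen_alg G"
  using gen_alg.Compl[OF gen_alg.Un[OF gen_alg.Compl[of A G], of B]] by (simp add: Diff_eq)

lemma gen_alg_finite_Union: "finite I \<Longrightarrow> (\<And>i. i \<in> I \<Longrightarrow> A i \<in> gen_alg G) \<Longrightarrow> (\<Union>i\<in>I. A i) \<in> gen_alg G"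
  by (induction I rule: finite_induct) (auto intro: gen_alg.empty gen_alg.Un)

text \<open>Each member arises after finitely many rounds of complements and unions. A round keeps
  all older sets, so two members can be brought to a common round.\<close>

lemma countable_gen_alg:
  assumes "countable G"
  shows "countable (gen_alg G)"
proof -
  define step where "step S = insert {} (S \<union> uminus ` S \<union> (\<lambda>(A, B). A \<union> B) ` (S \<times> S))" for S :: "'a set set"
  have step: "A \<in> S \<Longrightarrow> A \<in> step S" "{} \<in> step S" "A \<in> S \<Longrightarrow> - A \<in> step S"
    "A \<in> S \<Longrightarrow> B \<in> S \<Longrightarrow> A \<union> B \<in> step S" for A B S
    by (auto simp: step_def)
  have mono: "(step ^^ m) G \<subseteq> (step ^^ n) G" if "m \<le> n" for m n
    using that by (induction rule: dec_induct) (auto intro: step(1))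
  have "countable ((step ^^ n) G)" for n
    by (induction n) (simp_all add: step_def assms)
  then have "countable (\<Union>n. (step ^^ n) G)" by simp
  moreover have "gen_alg G \<subseteq> (\<Union>n. (step ^^ n) G)"
  proof
    fix A assume "A \<in> gen_alg G"
    then show "A \<in> (\<Union>n. (step ^^ n) G)"
    proof induction
      case (base A) then show ?case by (intro UN_I[of 0]) simp_all
    next
      case empty show ?case by (rule UN_I[of "Suc 0"]) (simp_all add: step(2))
    next
      case (Compl A)
      then obtain n where "A \<in> (step ^^ n) G" by blast
      then show ?case by (intro UN_I[of "Suc n"]) (simp_all add: step(3))
    next
      case (Un A B)
      then obtain m n where "A \<in> (step ^^ m) G" "B \<in> (step ^^ n) G" by blast
      then have "A \<in> (step ^^ max m n) G" "B \<in> (step ^^ max m n) G"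
        using mono[of m "max m n"] mono[of n "max m n"] by auto
      then have "A \<union> B \<in> (step ^^ Suc (max m n)) G" by (simp add: step(4))
      then show ?case by blast
    qed
  qed
  ultimately show ?thesis by (rule countable_subset[rotated])
qed

text \<open>The rationals are closed under subtracting \<open>1/(n+1)\<close>, so the inner balls of
  the shells used later are again generators. Radii that are not positive are allowed and give the
  empty set.\<close>

definition ball_alg :: "'w::metric_space set \<Rightarrow> 'w set set" where
  "ball_alg D = gen_alg {ball q r | q r. q \<in> D \<and> r \<in> \<rat>}"

lemma countable_ball_alg: "countable D \<Longrightarrow> countable (ball_alg D)"
proof -
  assume "countable D"
  then have "countable ((\<lambda>(q, r). ball q r) ` (D \<times> \<rat>))" by (simp add: countable_rat)
  moreover have "(\<lambda>(q, r). ball q r) ` (D \<times> \<rat>) = {ball q r | q r. q \<in> D \<and> r \<in> \<rat>}" by auto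
  ultimately show ?thesis unfolding ball_alg_def by (simp add: countable_gen_alg)
qed

lemma ball_alg_borel: "A \<in> ball_alg D \<Longrightarrow> A \<in> sets borel"
  unfolding ball_alg_def by (induction rule: gen_alg.induct) auto

lemma countable_dense_exists:
  assumes "compact (UNIV :: 'w::metric_space set)"
  obtains D :: "'w::metric_space set" where "countable D" "\<And>x e. e > 0 \<Longrightarrow> \<exists>q\<in>D. dist q x < e"
proof -
  have "\<exists>K. finite K \<and> (\<Union>q\<in>K. ball q (inverse (Suc n))) = (UNIV :: 'w set)" for n :: nat
    using seq_compact_imp_totally_bounded[OF compact_imp_seq_compact[OF assms]]
    by (metis inverse_positive_iff_positive of_nat_0_less_iff top.extremum_uniqueI zero_less_Suc)
  then obtain K :: "nat \<Rightarrow> 'w set" where K: "\<And>n. finite (K n)" "\<And>n. (\<Union>q\<in>K n. ball q (inverse (Suc n))) = UNIV"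
    by metis
  show ?thesis
  proof (rule that[of "\<Union>n. K n"])
    show "countable (\<Union>n. K n)" using K(1) by (simp add: countable_finite)
    fix x :: 'w and e :: real assume "e > 0"
    from reals_Archimedean[OF this] obtain n where n: "inverse (real (Suc n)) < e" by blast
    have "x \<in> (\<Union>q\<in>K n. ball q (inverse (Suc n)))" using K(2) by simp
    then obtain q where "q \<in> K n" "dist q x < inverse (real (Suc n))" by auto
    then show "\<exists>q\<in>\<Union>n. K n. dist q x < e" using n by (intro bexI[of _ q]) auto
  qed
qed

text \<open>Every point of \<open>F\<close> has a generating ball around it inside \<open>U\<close>,
  and compactness leaves a finite union of these.\<close>

lemma ball_alg_between:
  fixes D :: "'w::metric_space set"
  assumes comp: "compact (UNIV :: 'w set)"
    and D: "\<And>x e. e > 0 \<Longrightarrow> \<exists>q\<in>D. dist q x < e"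
    and F: "closed F" and U: "open U" and FU: "F \<subseteq> U"
  shows "\<exists>A\<in>ball_alg D. F \<subseteq> A \<and> A \<subseteq> U"
proof -
  have "\<exists>q r. q \<in> D \<and> r \<in> \<rat> \<and> x \<in> ball q r \<and> ball q r \<subseteq> U" if x: "x \<in> F" for x
  proof -
    obtain e where e: "e > 0" "ball x e \<subseteq> U" using openE[OF U subsetD[OF FU x]] by blast
    obtain q where q: "q \<in> D" "dist q x < e / 2" using D[of "e/2" x] e(1) by auto
    \<comment> \<open>Radius below \<open>e / 2\<close> and centre within \<open>e / 2\<close> of
      \<open>x\<close> keep the ball inside \<open>ball x e\<close>, while radius above
      \<open>dist q x\<close> keeps \<open>x\<close> inside the ball.\<close>
    obtain r where r: "r \<in> \<rat>" "dist q x < r" "r < e / 2" using Rats_dense_in_real[OF q(2)] by blast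
    have "ball q r \<subseteq> ball x e"
    proof
      fix y assume "y \<in> ball q r"
      then show "y \<in> ball x e"
        using dist_triangle[of x y q] q(2) r(3) by (simp add: dist_commute)
    qed
    then show ?thesis using q r e(2) by (intro exI[of _ q] exI[of _ r]) auto
  qed
  then obtain q r where qr: "\<And>x. x \<in> F \<Longrightarrow> q x \<in> D \<and> r x \<in> \<rat> \<and> x \<in> ball (q x) (r x) \<and> ball (q x) (r x) \<subseteq> U"
    by metis
  have "compact F" using compact_Int_closed[OF comp F] by simp
  moreover have "open (ball (q x) (r x))" for x by simp
  moreover have "F \<subseteq> (\<Union>x\<in>F. ball (q x) (r x))" using qr by blast
  ultimately obtain C where C: "C \<subseteq> F" "finite C" "F \<subseteq> (\<Union>x\<in>C. ball (q x) (r x))"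
    by (rule compactE_image[of F F "\<lambda>x. ball (q x) (r x)"])
  have "(\<Union>x\<in>C. ball (q x) (r x)) \<in> ball_alg D"
    unfolding ball_alg_def using C qr by (intro gen_alg_finite_Union gen_alg.base) blast+
  moreover have "(\<Union>x\<in>C. ball (q x) (r x)) \<subseteq> U" using qr C(1) by blast
  ultimately show ?thesis using C(3) by blast
qed

text \<open>An open set is a countable union of closed sets; a member of the algebra fits between
  each of these and the open set.\<close>

lemma sigma_sets_ball_alg:
  fixes D :: "'w::metric_space set"
  assumes comp: "compact (UNIV :: 'w set)"
    and D: "\<And>x e. e > 0 \<Longrightarrow> \<exists>q\<in>D. dist q x < e"
  shows "sigma_sets UNIV (ball_alg D) = sets borel"
proof (rule antisym)
  show "sigma_sets UNIV (ball_alg D) \<subseteq> sets borel"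
    using sets.sigma_sets_subset[of "ball_alg D" borel] ball_alg_borel by auto
  have "{S. open S} \<subseteq> sigma_sets UNIV (ball_alg D)"
  proof
    fix U :: "'w set" assume "U \<in> {S. open S}"
    then have U: "open U" by simp
    obtain F :: "nat \<Rightarrow> 'w set" where F: "\<And>n. closed (F n)" "(\<Union>n. F n) = U"
      using U by (rule open_eq_Union_closed) blast
    have "\<exists>A\<in>ball_alg D. F n \<subseteq> A \<and> A \<subseteq> U" for n
      using F(2) by (intro ball_alg_between[OF comp D F(1) U]) blast+
    then obtain A where A: "\<And>n. A n \<in> ball_alg D" "\<And>n. F n \<subseteq> A n" "\<And>n. A n \<subseteq> U" by metis
    have "(\<Union>n. A n) \<in> sigma_sets UNIV (ball_alg D)"
      using A(1) by (intro sigma_sets.Union sigma_sets.Basic)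
    moreover have "(\<Union>n. A n) = U" using A(2,3) F(2) by blast
    ultimately show "U \<in> sigma_sets UNIV (ball_alg D)" by simp
  qed
  then have "sigma_sets UNIV {S. open S} \<subseteq> sigma_sets UNIV (ball_alg D)"
    by (rule sigma_sets_mono)
  then show "sets borel \<subseteq> sigma_sets UNIV (ball_alg D)" unfolding borel_def by simp
qed

text \<open>The one property of the countable algebra on which the approximation of total variations
  relies.\<close>

definition separating :: "'w::metric_space set set \<Rightarrow> bool" where
  "separating G \<longleftrightarrow> G \<subseteq> sets borel \<and>
    (\<forall>F U. closed F \<longrightarrow> open U \<longrightarrow> F \<subseteq> U \<longrightarrow> (\<exists>A\<in>G. F \<subseteq> A \<and> A \<subseteq> U))"

lemma separatingD:
  assumes "separating G"
  shows "G \<subseteq> sets borel" "closed F \<Longrightarrow> open U \<Longrightarrow> F \<subseteq> U \<Longrightarrow> \<exists>A\<in>G. F \<subseteq> A \<and> A \<subseteq> U"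
  using assms unfolding separating_def by (rule conjunct1, simp)

lemma separating_nonempty: "separating G \<Longrightarrow> G \<noteq> {}"
  using separatingD(2)[of G "{}" "{}"] by auto

lemma countable_separating_exists:
  assumes comp: "compact (UNIV :: 'w::metric_space set)"
  obtains G :: "'w::metric_space set set" where "countable G" "separating G"
proof -
  obtain D :: "'w set" where D: "countable D" "\<And>x e. e > 0 \<Longrightarrow> \<exists>q\<in>D. dist q x < e"
    using countable_dense_exists[OF comp] by blast
  have "ball_alg D \<subseteq> sets borel" using ball_alg_borel by blast
  then have "separating (ball_alg D)"
    unfolding separating_def by (intro conjI allI impI ball_alg_between[OF comp D(2)])
  with countable_ball_alg[OF D(1)] show ?thesis by (rule that)
qed

section \<open>Total variation as a supremum over a countable family\<close>

lemma tv_ge: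
  assumes \<nu>: "bounded_signed \<nu>" and "A \<in> sets borel" "B \<in> sets borel"
  shows "\<bar>\<nu> (B \<inter> A)\<bar> + \<bar>\<nu> (B - A)\<bar> \<le> tv \<nu> B"
proof -
  interpret finite_measure "tv_measure \<nu>" by (rule finite_measure_tv_measure[OF \<nu>])
  have "measure (tv_measure \<nu>) ((B \<inter> A) \<union> (B - A)) =
      measure (tv_measure \<nu>) (B \<inter> A) + measure (tv_measure \<nu>) (B - A)"
    using assms by (intro finite_measure_Union) auto
  moreover have "(B \<inter> A) \<union> (B - A) = B" by blast
  ultimately have "tv \<nu> B = tv \<nu> (B \<inter> A) + tv \<nu> (B - A)"
    using assms by (simp add: measure_tv_measure)
  moreover have "\<bar>\<nu> (B \<inter> A)\<bar> \<le> tv \<nu> (B \<inter> A)" "\<bar>\<nu> (B - A)\<bar> \<le> tv \<nu> (B - A)"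
    using assms by (intro abs_le_tv; simp)+
  ultimately show ?thesis by linarith
qed

text \<open>
  Splitting \<open>B\<close> along a near optimal set for the positive part nearly attains the variation, and by
  regularity the splitting set may be taken from a fixed countable family.
\<close>

lemma tv_approx:
  fixes \<nu> :: "'w::metric_space set \<Rightarrow> real"
  assumes \<nu>: "bounded_signed \<nu>" and B: "B \<in> sets borel" and e: "e > 0"
    and sep: "separating G"
  shows "\<exists>A\<in>G. tv \<nu> B - e < \<bar>\<nu> (B \<inter> A)\<bar> + \<bar>\<nu> (B - A)\<bar>"
proof -
  note G = separatingD(2)[OF sep]
  note Gm = separatingD(1)[OF sep]
  obtain b where "charge (sets borel) \<nu> b" using \<nu> by (rule bounded_signed_charge)
  then interpret charge "sets borel" \<nu> b .
  interpret N: finite_measure "tv_measure \<nu>" by (rule finite_measure_tv_measure[OF \<nu>])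
  \<comment> \<open>Choosing \<open>P\<close> loses \<open>e / 4\<close>, and replacing
    \<open>P\<close> by \<open>B \<inter> A\<close> loses another \<open>e / 4\<close>. Both losses
    are doubled, because \<open>\<nu> (B \<inter> A) - \<nu> (B - A)\<close> equals
    \<open>2 * \<nu> (B \<inter> A) - \<nu> B\<close>.\<close>
  have "\<exists>P\<in>sets borel. P \<subseteq> B \<and> bv \<nu> B - e / 4 < \<nu> P"
  proof (rule ccontr)
    assume "\<not> ?thesis"
    then have "bv \<nu> B \<le> bv \<nu> B - e / 4"
      by (intro pv_least) (auto simp: not_less)
    then show False using e by simp
  qed
  then obtain P where P: "P \<in> sets borel" "P \<subseteq> B" "bv \<nu> B - e / 4 < \<nu> P" by blast
  have e4: "e / 4 > 0" using e by simp
  have "approximable (tv_measure \<nu>) P"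
    using P(1) by (intro borel_approximable N.finite_measure_axioms) simp_all
  from approximableD[OF this e4] obtain F U where
    FU: "closed F" "open U" "F \<subseteq> P" "P \<subseteq> U" "measure (tv_measure \<nu>) (U - F) < e / 4" by blast
  obtain A where A: "A \<in> G" "F \<subseteq> A" "A \<subseteq> U" using G[OF FU(1,2)] FU(3,4) by blast
  have m: "A \<in> sets borel" "U - F \<in> sets borel" using A(1) Gm FU by auto
  have "\<nu> P = \<nu> (P \<inter> A) + \<nu> (P - A)" by (rule Diff_Int[OF P(1) m(1)])
  moreover have "\<nu> (B \<inter> A) = \<nu> (B \<inter> A \<inter> P) + \<nu> (B \<inter> A - P)" using B m P by (intro Diff_Int) auto
  moreover have "B \<inter> A \<inter> P = P \<inter> A" using P(2) by blast
  moreover have "\<bar>\<nu> (P - A)\<bar> + \<bar>\<nu> (B \<inter> A - P)\<bar> \<le> measure (tv_measure \<nu>) (U - F)"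
  proof -
    have "\<bar>\<nu> (P - A)\<bar> + \<bar>\<nu> (B \<inter> A - P)\<bar> \<le> measure (tv_measure \<nu>) (P - A) + measure (tv_measure \<nu>) (B \<inter> A - P)"
      using B m P by (intro add_mono) (simp_all add: measure_tv_measure \<nu> abs_le_tv)
    also have "\<dots> = measure (tv_measure \<nu>) ((P - A) \<union> (B \<inter> A - P))"
      using B m P by (intro N.finite_measure_Union[symmetric]) auto
    also have "\<dots> \<le> measure (tv_measure \<nu>) (U - F)"
      using FU A m by (intro N.finite_measure_mono) auto
    finally show ?thesis .
  qed
  moreover have "\<nu> B = \<nu> (B \<inter> A) + \<nu> (B - A)" by (rule Diff_Int[OF B m(1)])
  moreover have "2 * bv \<nu> B = tv \<nu> B + \<nu> B" using bv_eq_tv(1)[OF \<nu> B] by simp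
  moreover have "\<nu> (B \<inter> A) - \<nu> (B - A) \<le> \<bar>\<nu> (B \<inter> A)\<bar> + \<bar>\<nu> (B - A)\<bar>" by arith
  moreover have "\<nu> (P - A) \<le> \<bar>\<nu> (P - A)\<bar>" "- \<nu> (B \<inter> A - P) \<le> \<bar>\<nu> (B \<inter> A - P)\<bar>"
    by (rule abs_ge_self abs_ge_minus_self)+
  ultimately have "tv \<nu> B - e < \<bar>\<nu> (B \<inter> A)\<bar> + \<bar>\<nu> (B - A)\<bar>"
    using FU(5) P(3) by (simp add: field_simps)
  then show ?thesis using A(1) by blast
qed

text \<open>With \<open>G\<close> countable and independent of \<nu>, this makes the variation of a
  family measurable and lets a single null set serve all the splittings.\<close>

lemma tv_eq_SUP:
  fixes \<nu> :: "'w::metric_space set \<Rightarrow> real"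
  assumes \<nu>: "bounded_signed \<nu>" and B: "B \<in> sets borel"
    and sep: "separating G"
  shows "bdd_above ((\<lambda>A. \<bar>\<nu> (B \<inter> A)\<bar> + \<bar>\<nu> (B - A)\<bar>) ` G)"
    "tv \<nu> B = (SUP A\<in>G. \<bar>\<nu> (B \<inter> A)\<bar> + \<bar>\<nu> (B - A)\<bar>)"
proof -
  note Gm = separatingD(1)[OF sep]
  have le: "\<bar>\<nu> (B \<inter> A)\<bar> + \<bar>\<nu> (B - A)\<bar> \<le> tv \<nu> B" if "A \<in> G" for A
    using that Gm by (intro tv_ge[OF \<nu> _ B]) blast
  show bdd: "bdd_above ((\<lambda>A. \<bar>\<nu> (B \<inter> A)\<bar> + \<bar>\<nu> (B - A)\<bar>) ` G)"
    by (rule bdd_aboveI2[of _ _ "tv \<nu> B"]) (rule le)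
  show "tv \<nu> B = (SUP A\<in>G. \<bar>\<nu> (B \<inter> A)\<bar> + \<bar>\<nu> (B - A)\<bar>)"
  proof (rule antisym)
    show "(SUP A\<in>G. \<bar>\<nu> (B \<inter> A)\<bar> + \<bar>\<nu> (B - A)\<bar>) \<le> tv \<nu> B"
    proof (rule cSUP_least)
      show "G \<noteq> {}" using sep by (rule separating_nonempty)
    qed (rule le)
    show "tv \<nu> B \<le> (SUP A\<in>G. \<bar>\<nu> (B \<inter> A)\<bar> + \<bar>\<nu> (B - A)\<bar>)"
    proof (rule field_le_epsilon)
      fix e :: real assume "e > 0"
      then obtain A where A: "A \<in> G" "tv \<nu> B - e < \<bar>\<nu> (B \<inter> A)\<bar> + \<bar>\<nu> (B - A)\<bar>"
        using tv_approx[OF \<nu> B _ sep] by blast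
      then show "tv \<nu> B \<le> (SUP A\<in>G. \<bar>\<nu> (B \<inter> A)\<bar> + \<bar>\<nu> (B - A)\<bar>) + e"
        using cSUP_upper[OF A(1) bdd] by linarith
    qed
  qed
qed


section \<open>Measurability of families of signed measures\<close>

text \<open>Induction over the construction of measurable functions. The kernel is controlled
  setwise and on \<open>space N\<close> only, which is what is known about Jordan parts of a
  family.\<close>

lemma nn_integral_kernel_measurable:
  fixes f :: "'w::topological_space \<Rightarrow> ennreal"
  assumes sets: "\<And>x. x \<in> space N \<Longrightarrow> sets (K x) = sets borel"
    and meas: "\<And>A. A \<in> sets borel \<Longrightarrow> (\<lambda>x. emeasure (K x) A) \<in> borel_measurable N"
    and f: "f \<in> borel_measurable borel"
  shows "(\<lambda>x. \<integral>\<^sup>+w. f w \<partial>K x) \<in> borel_measurable N"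
  using f
proof (induction rule: borel_measurable_induct)
  case (cong f g)
  then show ?case by simp
next
  case (set A)
  have "(\<lambda>x. \<integral>\<^sup>+w. indicator A w \<partial>K x) \<in> borel_measurable N \<longleftrightarrow> (\<lambda>x. emeasure (K x) A) \<in> borel_measurable N"
    using set sets by (intro measurable_cong) simp
  then show ?case using meas[OF set] by simp
next
  case (mult u c)
  have "(\<lambda>x. \<integral>\<^sup>+w. c * u w \<partial>K x) \<in> borel_measurable N \<longleftrightarrow> (\<lambda>x. c * (\<integral>\<^sup>+w. u w \<partial>K x)) \<in> borel_measurable N"
    using mult(2) sets by (intro measurable_cong nn_integral_cmult) (simp cong: measurable_cong_sets)
  then show ?case using mult by simp
next
  case (add u v)
  have "(\<lambda>x. \<integral>\<^sup>+w. v w + u w \<partial>K x) \<in> borel_measurable N \<longleftrightarrow>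
      (\<lambda>x. (\<integral>\<^sup>+w. v w \<partial>K x) + (\<integral>\<^sup>+w. u w \<partial>K x)) \<in> borel_measurable N"
    using add(1,3) sets by (intro measurable_cong nn_integral_add) (simp_all cong: measurable_cong_sets)
  then show ?case using add by simp
next
  case (seq U)
  have "(\<lambda>x. \<integral>\<^sup>+w. (SUP i. U i) w \<partial>K x) \<in> borel_measurable N \<longleftrightarrow>
      (\<lambda>x. SUP i. \<integral>\<^sup>+w. U i w \<partial>K x) \<in> borel_measurable N"
    unfolding SUP_apply
    using seq sets
    by (intro measurable_cong nn_integral_monotone_convergence_SUP) (simp_all cong: measurable_cong_sets)
  then show ?case using seq by simp
qed

lemma integral_kernel_measurable:
  fixes f :: "'w::topological_space \<Rightarrow> real"
  assumes sets: "\<And>x. x \<in> space N \<Longrightarrow> sets (K x) = sets borel"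
    and fin: "\<And>x. x \<in> space N \<Longrightarrow> finite_measure (K x)"
    and meas: "\<And>A. A \<in> sets borel \<Longrightarrow> (\<lambda>x. emeasure (K x) A) \<in> borel_measurable N"
    and f: "f \<in> borel_measurable borel" "\<And>w. \<bar>f w\<bar> \<le> c"
  shows "(\<lambda>x. LINT w|K x. f w) \<in> borel_measurable N"
proof -
  have int: "integrable (K x) f" if x: "x \<in> space N" for x
  proof -
    interpret finite_measure "K x" by (rule fin[OF x])
    show ?thesis
      using f sets[OF x] by (intro integrable_const_bound[of _ c]) (simp_all cong: measurable_cong_sets)
  qed
  have "(\<lambda>x. enn2real (\<integral>\<^sup>+w. ennreal (f w) \<partial>K x) - enn2real (\<integral>\<^sup>+w. ennreal (- f w) \<partial>K x)) \<in> borel_measurable N"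
    by (intro borel_measurable_diff borel_measurable_enn2real nn_integral_kernel_measurable sets meas
        measurable_compose[OF _ measurable_ennreal] borel_measurable_uminus f(1))
  moreover have "(\<lambda>x. LINT w|K x. f w) \<in> borel_measurable N \<longleftrightarrow>
      (\<lambda>x. enn2real (\<integral>\<^sup>+w. ennreal (f w) \<partial>K x) - enn2real (\<integral>\<^sup>+w. ennreal (- f w) \<partial>K x)) \<in> borel_measurable N"
    by (intro measurable_cong real_lebesgue_integral_def int)
  ultimately show ?thesis by simp
qed

section \<open>Weak-star measurability and setwise measurability of a family\<close>

context
  fixes \<omega> :: "'x \<Rightarrow> 'w::metric_space set \<Rightarrow> real" and N :: "'x measure"
  assumes comp: "compact (UNIV :: 'w set)"
    and \<omega>: "\<And>x. x \<in> space N \<Longrightarrow> bounded_signed (\<omega> x)"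
begin

lemma tv_measurable:
  assumes meas: "\<And>A. A \<in> sets borel \<Longrightarrow> (\<lambda>x. \<omega> x A) \<in> borel_measurable N"
    and B: "B \<in> sets borel"
  shows "(\<lambda>x. tv (\<omega> x) B) \<in> borel_measurable N"
proof -
  obtain G :: "'w set set" where G: "countable G" "separating G"
    using comp by (rule countable_separating_exists)
  note Gm = separatingD(1)[OF G(2)]
  note sup = tv_eq_SUP[OF \<omega> B G(2)]
  have "(\<lambda>x. SUP A\<in>G. \<bar>\<omega> x (B \<inter> A)\<bar> + \<bar>\<omega> x (B - A)\<bar>) \<in> borel_measurable N"
  proof (rule borel_measurable_cSUP)
    show "countable (G)" by (rule G(1))
    fix A assume "A \<in> G"
    then have "B \<inter> A \<in> sets borel" "B - A \<in> sets borel" using Gm B by auto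
    then show "(\<lambda>x. \<bar>\<omega> x (B \<inter> A)\<bar> + \<bar>\<omega> x (B - A)\<bar>) \<in> borel_measurable N"
      by (intro borel_measurable_add borel_measurable_abs meas)
  next
    fix x assume "x \<in> space N"
    then show "bdd_above ((\<lambda>A. \<bar>\<omega> x (B \<inter> A)\<bar> + \<bar>\<omega> x (B - A)\<bar>) ` G)" by (rule sup(1))
  qed
  moreover have "(\<lambda>x. tv (\<omega> x) B) \<in> borel_measurable N \<longleftrightarrow>
      (\<lambda>x. SUP A\<in>G. \<bar>\<omega> x (B \<inter> A)\<bar> + \<bar>\<omega> x (B - A)\<bar>) \<in> borel_measurable N"
    by (intro measurable_cong sup(2))
  ultimately show ?thesis by simp
qed

text \<open>The Jordan parts are \<open>(tv \<pm> \<nu>) / 2\<close>, so measurability of the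
  variation makes them measurable kernels. Compactness makes \<open>v\<close> bounded and hence
  integrable against them.\<close>

lemma pairing_measurable:
  assumes meas: "\<And>A. A \<in> sets borel \<Longrightarrow> (\<lambda>x. \<omega> x A) \<in> borel_measurable N"
    and v: "continuous_on UNIV v"
  shows "(\<lambda>x. pairing (\<omega> x) v) \<in> borel_measurable N"
proof -
  have "compact (range v)" by (rule compact_continuous_image[OF v comp])
  then obtain c where c: "\<And>w. \<bar>v w\<bar> \<le> c"
    using bounded_iff[of "range v"] compact_imp_bounded by (auto simp: real_norm_def)
  have vm: "v \<in> borel_measurable borel" by (rule borel_measurable_continuous_onI[OF v])
  have tvm: "(\<lambda>x. tv (\<omega> x) B) \<in> borel_measurable N" if "B \<in> sets borel" for B
    using meas that by (rule tv_measurable)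
  have int: "(\<lambda>x. LINT w|bv_measure (\<sigma> x). v w) \<in> borel_measurable N"
    if \<sigma>: "\<And>x. x \<in> space N \<Longrightarrow> bounded_signed (\<sigma> x)"
      and bv: "\<And>A. A \<in> sets borel \<Longrightarrow> (\<lambda>x. bv (\<sigma> x) A) \<in> borel_measurable N" for \<sigma>
  proof (rule integral_kernel_measurable[OF _ _ _ vm c])
    fix A :: "'w set" assume A: "A \<in> sets borel"
    have "(\<lambda>x. emeasure (bv_measure (\<sigma> x)) A) \<in> borel_measurable N \<longleftrightarrow>
        (\<lambda>x. ennreal (bv (\<sigma> x) A)) \<in> borel_measurable N"
      by (intro measurable_cong) (simp add: emeasure_bv_measure \<sigma> A)
    then show "(\<lambda>x. emeasure (bv_measure (\<sigma> x)) A) \<in> borel_measurable N"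
      using bv[OF A] by simp
  qed (simp_all add: finite_measure_bv_measure \<sigma>)
  have "(\<lambda>x. (tv (\<omega> x) A + \<omega> x A) / 2) \<in> borel_measurable N"
    "(\<lambda>x. (tv (\<omega> x) A - \<omega> x A) / 2) \<in> borel_measurable N" if A: "A \<in> sets borel" for A
    using tvm[OF A] meas[OF A] by simp_all
  moreover have "(\<lambda>x. bv (\<omega> x) A) \<in> borel_measurable N \<longleftrightarrow> (\<lambda>x. (tv (\<omega> x) A + \<omega> x A) / 2) \<in> borel_measurable N"
    "(\<lambda>x. bv (\<lambda>A. - \<omega> x A) A) \<in> borel_measurable N \<longleftrightarrow> (\<lambda>x. (tv (\<omega> x) A - \<omega> x A) / 2) \<in> borel_measurable N"
    if A: "A \<in> sets borel" for A
    by (rule measurable_cong, rule bv_eq_tv(1)[OF \<omega> A], assumption)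
      (rule measurable_cong, rule bv_eq_tv(2)[OF \<omega> A], assumption)
  ultimately have p: "(\<lambda>x. LINT w|bv_measure (\<omega> x). v w) \<in> borel_measurable N"
    and n: "(\<lambda>x. LINT w|bv_measure (\<lambda>A. - \<omega> x A). v w) \<in> borel_measurable N"
    by (simp_all add: int \<omega> bounded_signed_uminus)
  have "(\<lambda>x. pairing (\<omega> x) v) \<in> borel_measurable N \<longleftrightarrow>
      (\<lambda>x. (LINT w|bv_measure (\<omega> x). v w) - (LINT w|bv_measure (\<lambda>A. - \<omega> x A). v w)) \<in> borel_measurable N"
    by (intro measurable_cong) (simp add: pairing_def pos_part_eq \<omega>)
  then show ?thesis using borel_measurable_diff[OF p n] by simp
qed

text \<open>The indicator of an open set is the limit of continuous functions with values between 0
  and 1, so \<open>\<omega> x U\<close> is a limit of pairings by dominated convergence.\<close>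

lemma open_measurable:
  assumes pair: "\<And>v. continuous_on UNIV v \<Longrightarrow> (\<lambda>x. pairing (\<omega> x) v) \<in> borel_measurable N"
    and U: "open U"
  shows "(\<lambda>x. \<omega> x U) \<in> borel_measurable N"
proof -
  \<comment> \<open>The whole space is treated apart because the distance to its empty complement is
    0 by convention.\<close>
  define v where "v n w = (if U = UNIV then 1 else min 1 (real n * infdist w (- U)))" for n w
  have v: "continuous_on UNIV (v n)" for n
    unfolding v_def by (cases "U = UNIV") (simp_all, intro continuous_intros)
  have bound: "norm (v n w) \<le> 1" for n w
    unfolding v_def by (simp add: infdist_nonneg)
  have lim: "(\<lambda>n. v n w) \<longlonglongrightarrow> indicator U w" for w
  proof (cases "U = UNIV")
    case False
    have cl: "closed (- U)" "- U \<noteq> {}" using U False by auto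
    show ?thesis
    proof (cases "w \<in> U")
      case True
      then have "0 < infdist w (- U)"
        using in_closed_iff_infdist_zero[OF cl, of w] infdist_nonneg[of w "- U"] by auto
      then obtain m where m: "1 < real m * infdist w (- U)" using reals_Archimedean3 by blast
      have "v n w = 1" if "n \<ge> m" for n
      proof -
        have "real m * infdist w (- U) \<le> real n * infdist w (- U)"
          using that by (intro mult_right_mono infdist_nonneg) simp
        then show ?thesis using m False by (simp add: v_def)
      qed
      then have "\<forall>\<^sub>F n in sequentially. v n w = 1" unfolding eventually_sequentially by blast
      then show ?thesis using True by (simp add: tendsto_eventually)
    next
      case wU: False
      then have "infdist w (- U) = 0" using in_closed_iff_infdist_zero[OF cl, of w] by simp
      then have "v n w = 0" for n using False by (simp add: v_def)
      then show ?thesis using wU by simp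
    qed
  qed (simp add: v_def)
  have conv: "(\<lambda>n. LINT w|bv_measure \<nu>. v n w) \<longlonglongrightarrow> bv \<nu> U" if \<nu>: "bounded_signed \<nu>" for \<nu>
  proof -
    interpret finite_measure "bv_measure \<nu>" by (rule finite_measure_bv_measure[OF \<nu>])
    have "(\<lambda>n. LINT w|bv_measure \<nu>. v n w) \<longlonglongrightarrow> (LINT w|bv_measure \<nu>. indicator U w)"
    proof (rule integral_dominated_convergence[where w="\<lambda>_. 1"])
      show "v n \<in> borel_measurable (bv_measure \<nu>)" for n
        using borel_measurable_continuous_onI[OF v] by (simp cong: measurable_cong_sets)
      show "indicator U \<in> borel_measurable (bv_measure \<nu>)"
        using U by (intro borel_measurable_indicator) simp
    qed (simp_all add: lim bound[unfolded real_norm_def])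
    moreover have "(LINT w|bv_measure \<nu>. indicator U w) = bv \<nu> U"
      using U by (simp add: measure_bv_measure \<nu>)
    ultimately show ?thesis by simp
  qed
  show ?thesis
  proof (rule borel_measurable_LIMSEQ_real[OF _ pair[OF v]])
    fix x assume "x \<in> space N"
    note \<omega>x = \<omega>[OF this]
    have "(\<lambda>n. pairing (\<omega> x) (v n)) \<longlonglongrightarrow> bv (\<omega> x) U - bv (\<lambda>A. - \<omega> x A) U"
      unfolding pairing_def pos_part_eq[OF \<omega>x]
      by (intro tendsto_diff conv bounded_signed_uminus \<omega>x)
    moreover have "bv (\<omega> x) U - bv (\<lambda>A. - \<omega> x A) U = \<omega> x U"
      using U by (simp add: bv_eq_tv[OF \<omega>x] field_simps)
    ultimately show "(\<lambda>n. pairing (\<omega> x) (v n)) \<longlonglongrightarrow> \<omega> x U" by simp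
  qed
qed

text \<open>A Dynkin class argument starting from the open sets, which are stable under
  intersection. Complements are handled by subtraction from the value on \<open>UNIV\<close>, itself
  an open set.\<close>

lemma setwise_measurable:
  assumes pair: "\<And>v. continuous_on UNIV v \<Longrightarrow> (\<lambda>x. pairing (\<omega> x) v) \<in> borel_measurable N"
    and A: "A \<in> sets borel"
  shows "(\<lambda>x. \<omega> x A) \<in> borel_measurable N"
proof -
  have sig: "sigma_sets UNIV {S :: 'w set. open S} = sets borel" unfolding borel_def by simp
  have sm: "signed_measure (\<omega> x)" if "x \<in> space N" for x
    using \<omega>[OF that] by (simp add: bounded_signed_def)
  have "Int_stable {S :: 'w set. open S}" by (auto simp: Int_stable_def)
  moreover have "{S :: 'w set. open S} \<subseteq> Pow UNIV" by simp
  moreover have "A \<in> sigma_sets UNIV {S. open S}" using A sig by simp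
  ultimately show ?thesis
  proof (induction rule: sigma_sets_induct_disjoint)
    case (basic A)
    then have "open A" by simp
    with pair show ?case by (rule open_measurable)
  next
    case empty
    have "(\<lambda>x. \<omega> x {}) \<in> borel_measurable N \<longleftrightarrow> (\<lambda>x. 0 :: real) \<in> borel_measurable N"
      using sm by (intro measurable_cong) (simp add: signed_measure_def)
    then show ?case by simp
  next
    case (compl A)
    have A: "A \<in> sets borel" using compl(1) sig by simp
    have "\<omega> x (UNIV - A) = \<omega> x UNIV - \<omega> x A" if "x \<in> space N" for x
      using signed_measure_additive[OF sm[OF that], of A "UNIV - A"] A by simp
    then have "(\<lambda>x. \<omega> x (UNIV - A)) \<in> borel_measurable N \<longleftrightarrow>
        (\<lambda>x. \<omega> x UNIV - \<omega> x A) \<in> borel_measurable N"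
      by (intro measurable_cong)
    moreover have "(\<lambda>x. \<omega> x UNIV) \<in> borel_measurable N"
      using pair open_UNIV by (rule open_measurable)
    ultimately show ?case using borel_measurable_diff[OF _ compl(2)] by blast
  next
    case (union A)
    show ?case
    proof (rule borel_measurable_LIMSEQ_real)
      fix x assume "x \<in> space N"
      from sm[OF this] show "(\<lambda>n. \<Sum>i<n. \<omega> x (A i)) \<longlonglongrightarrow> \<omega> x (\<Union>i. A i)"
        using union(1,2) unfolding signed_measure_def sums_def sig by blast
    next
      show "(\<lambda>x. \<Sum>i<n. \<omega> x (A i)) \<in> borel_measurable N" for n
        using union(3) by (rule borel_measurable_sum)
    qed
  qed
qed

end

section \<open>From foliations to Radon measures\<close>

lemma tv_partition:
  assumes \<nu>: "bounded_signed \<nu>" and B: "borel_partition B A"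
  shows "summable (\<lambda>n. \<bar>\<nu> (B n)\<bar>)" "(\<Sum>n. \<bar>\<nu> (B n)\<bar>) \<le> tv \<nu> A"
proof -
  have "range B \<subseteq> sets borel" "(\<Union>n. B n) = A" using B by (simp_all add: borel_partition_def)
  then have A: "A \<in> sets borel" by (metis sets.countable_UN)
  have le: "(\<Sum>n. ennreal \<bar>\<nu> (B n)\<bar>) \<le> ennreal (tv \<nu> A)"
  proof -
    have "(\<Sum>n. ennreal \<bar>\<nu> (B n)\<bar>) \<le> variation \<nu> A"
      unfolding variation_def by (rule Sup_upper) (use B in \<open>intro CollectI exI[of _ B] conjI refl\<close>)
    then show ?thesis by (simp only: variation_tv[OF \<nu> A])
  qed
  show summ: "summable (\<lambda>n. \<bar>\<nu> (B n)\<bar>)"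
  proof (rule summable_suminf_not_top)
    show "(\<Sum>n. ennreal \<bar>\<nu> (B n)\<bar>) \<noteq> Orderings.top"
      using order_le_less_trans[OF le ennreal_less_top] by (rule less_imp_neq)
  qed simp
  show "(\<Sum>n. \<bar>\<nu> (B n)\<bar>) \<le> tv \<nu> A"
    using le unfolding suminf_ennreal2[OF abs_ge_zero summ] ennreal_le_iff[OF tv_nonneg[OF \<nu>]] .
qed

lemma tv_split:
  assumes "bounded_signed \<nu>" "A \<in> sets borel" "B \<in> sets borel" "A \<subseteq> B"
  shows "tv \<nu> B = tv \<nu> A + tv \<nu> (B - A)"
proof -
  interpret finite_measure "tv_measure \<nu>" by (rule finite_measure_tv_measure[OF assms(1)])
  show ?thesis using finite_measure_Diff[of B A] assms by (simp add: measure_tv_measure)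
qed

lemma L0_variation_family:
  "{L0_embed M s |s C. borel_partition C B \<and> L0_sums M (\<lambda>n. L0_abs M (\<mu> (C n))) s} \<subseteq> L0 M"
proof
  fix c assume "c \<in> {L0_embed M s |s C. borel_partition C B \<and> L0_sums M (\<lambda>n. L0_abs M (\<mu> (C n))) s}"
  then obtain s where "c = L0_embed M s" "s \<in> L0 M" by (auto simp: L0_sums_def)
  moreover from this(2) obtain f where "L0_fun M f" "s = ae_class M f" by (rule L0E)
  ultimately show "c \<in> L0 M" by (simp add: L0_embed_ae_class ae_class_in_L0 L0_fun_ereal)
qed

context prob_space
begin

context
  fixes \<mu> :: "'w::metric_space set \<Rightarrow> ('a \<Rightarrow> real) set" and \<omega> :: "'a \<Rightarrow> 'w set \<Rightarrow> real"
  assumes comp: "compact (UNIV :: 'w set)" and fol: "foliation M \<mu> \<omega>"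
begin

lemma foliation_signed: "x \<in> space M \<Longrightarrow> bounded_signed (\<omega> x)"
  using fol unfolding foliation_def radon_iff[OF comp] by blast

lemma foliation_fun: "A \<in> sets borel \<Longrightarrow> L0_fun M (\<lambda>x. \<omega> x A)"
  using fol unfolding foliation_def L0_fun_real_iff by blast

lemma foliation_eq: "A \<in> sets borel \<Longrightarrow> \<mu> A = ae_class M (\<lambda>x. \<omega> x A)"
  using fol unfolding foliation_def by blast

lemma foliation_tv: "A \<in> sets borel \<Longrightarrow> L0_fun M (\<lambda>x. tv (\<omega> x) A)"
  unfolding L0_fun_real_iff
  by (rule tv_measurable[OF comp]) (simp_all add: foliation_signed foliation_fun L0_fun_real_iff[symmetric])

lemma foliation_abs: "A \<in> sets borel \<Longrightarrow> L0_abs M (\<mu> A) = ae_class M (\<lambda>x. \<bar>\<omega> x A\<bar>)"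
  by (simp add: foliation_eq L0_abs_ae_class foliation_fun)

lemma foliation_partition_sums:
  assumes B: "borel_partition B A"
  shows "L0_fun M (\<lambda>x. \<Sum>n. \<bar>\<omega> x (B n)\<bar>)"
    "L0_sums M (\<lambda>n. L0_abs M (\<mu> (B n))) (ae_class M (\<lambda>x. \<Sum>n. \<bar>\<omega> x (B n)\<bar>))"
proof -
  have Bm: "B n \<in> sets borel" for n using B by (auto simp: borel_partition_def)
  have abs: "L0_fun M (\<lambda>x. \<bar>\<omega> x (B n)\<bar>)" for n by (intro L0_fun_abs foliation_fun Bm)
  show s: "L0_fun M (\<lambda>x. \<Sum>n. \<bar>\<omega> x (B n)\<bar>)"
    using abs unfolding L0_fun_real_iff by (rule borel_measurable_suminf)
  show "L0_sums M (\<lambda>n. L0_abs M (\<mu> (B n))) (ae_class M (\<lambda>x. \<Sum>n. \<bar>\<omega> x (B n)\<bar>))"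
    unfolding foliation_abs[OF Bm]
  proof (rule L0_sumsI[OF abs s], rule AE_I2)
    fix x assume "x \<in> space M"
    from tv_partition(1)[OF foliation_signed[OF this] B]
    show "(\<lambda>n. \<bar>\<omega> x (B n)\<bar>) sums (\<Sum>n. \<bar>\<omega> x (B n)\<bar>)" by (rule summable_sums)
  qed
qed

text \<open>Partition sums lie below the pointwise variation almost everywhere, one null set per
  partition. For minimality, an upper bound need only be tested on the partitions into
  \<open>B \<inter> A\<close> and \<open>B - A\<close> with \<open>A\<close> from a countable
  family, since these exhaust the variation at every point.\<close>

lemma L0_variation_foliation:
  assumes B: "B \<in> sets borel"
  shows "L0_variation M \<mu> B = ae_class M (\<lambda>x. ereal (tv (\<omega> x) B))"
  unfolding L0_variation_def
proof (rule L0bar_sup_eq, rule L0bar_supI)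
  let ?S = "{L0_embed M s |s C. borel_partition C B \<and> L0_sums M (\<lambda>n. L0_abs M (\<mu> (C n))) s}"
  show "L0_fun M (\<lambda>x. ereal (tv (\<omega> x) B))" by (intro L0_fun_ereal foliation_tv B)
  show "?S \<subseteq> L0 M" by (rule L0_variation_family)
  show "AE x in M. rep c x \<le> ereal (tv (\<omega> x) B)" if cS: "c \<in> ?S" for c
  proof -
    obtain s C where c: "c = L0_embed M s" and C: "borel_partition C B"
      and s: "L0_sums M (\<lambda>n. L0_abs M (\<mu> (C n))) s" using cS by blast
    have Cm: "C n \<in> sets borel" for n using C by (auto simp: borel_partition_def)
    have "s \<in> L0 M" using s by (simp add: L0_sums_def)
    then obtain g where g: "L0_fun M g" "s = ae_class M g" by (rule L0E)
    note fp = foliation_partition_sums[OF C]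
    have abs: "L0_fun M (\<lambda>x. \<bar>\<omega> x (C n)\<bar>)" for n by (intro L0_fun_abs foliation_fun Cm)
    \<comment> \<open>\<open>s\<close> is given merely as some limit in measure; uniqueness of such
      limits identifies it with the pointwise sum.\<close>
    have "AE x in M. g x = (\<Sum>n. \<bar>\<omega> x (C n)\<bar>)"
      by (rule L0_sums_AE_unique[OF abs g(1) fp(1)])
        (use s fp(2) in \<open>simp_all add: g(2) foliation_abs[OF Cm]\<close>)
    moreover have "AE x in M. rep c x = ereal (g x)"
      using rep_in(2)[OF L0_fun_ereal[OF g(1)]] by (simp add: c g(2) L0_embed_ae_class[OF g(1)])
    moreover have "AE x in M. (\<Sum>n. \<bar>\<omega> x (C n)\<bar>) \<le> tv (\<omega> x) B"
      by (rule AE_I2) (rule tv_partition(2)[OF foliation_signed C])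
    ultimately show ?thesis by eventually_elim simp
  qed
  fix g :: "'a \<Rightarrow> ereal" assume g: "\<And>c. c \<in> ?S \<Longrightarrow> AE x in M. rep c x \<le> g x"
  obtain G :: "'w set set" where G: "countable G" "separating G"
    using comp by (rule countable_separating_exists)
  note Gm = separatingD(1)[OF G(2)]
  have "AE x in M. ereal (\<bar>\<omega> x (B \<inter> A)\<bar> + \<bar>\<omega> x (B - A)\<bar>) \<le> g x" if AD: "A \<in> G" for A
  proof -
    have m: "B \<inter> A \<in> sets borel" "B - A \<in> sets borel" using AD Gm B by auto
    define C where "C = binaryset (B \<inter> A) (B - A)"
    have "borel_partition C ((B \<inter> A) \<union> (B - A))"
      unfolding C_def using m by (intro borel_partition_binaryset) auto
    moreover have "(B \<inter> A) \<union> (B - A) = B" by blast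
    ultimately have C: "borel_partition C B" by simp
    let ?f = "\<lambda>x. \<Sum>n. \<bar>\<omega> x (C n)\<bar>"
    note fp = foliation_partition_sums[OF C]
    have "L0_embed M (ae_class M ?f) \<in> ?S" using C fp(2) by blast
    then have "AE x in M. rep (L0_embed M (ae_class M ?f)) x \<le> g x" by (rule g)
    moreover have "AE x in M. rep (L0_embed M (ae_class M ?f)) x = ereal (?f x)"
      using rep_in(2)[OF L0_fun_ereal[OF fp(1)]] by (simp add: L0_embed_ae_class[OF fp(1)])
    moreover have "AE x in M. ?f x = \<bar>\<omega> x (B \<inter> A)\<bar> + \<bar>\<omega> x (B - A)\<bar>"
    proof (rule AE_I2)
      fix x assume "x \<in> space M"
      then have "\<omega> x {} = 0"
        using foliation_signed by (simp add: bounded_signed_def signed_measure_def)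
      then have "(\<lambda>n. \<bar>\<omega> x (C n)\<bar>) sums (\<bar>\<omega> x (B \<inter> A)\<bar> + \<bar>\<omega> x (B - A)\<bar>)"
        unfolding C_def by (intro binaryset_sums) simp
      then show "?f x = \<bar>\<omega> x (B \<inter> A)\<bar> + \<bar>\<omega> x (B - A)\<bar>" by (rule sums_unique[symmetric])
    qed
    ultimately show ?thesis by eventually_elim simp
  qed
  \<comment> \<open>Countability of \<open>G\<close> collects the exceptional sets into a single
    null set, after which the supremum can be taken at each point.\<close>
  then have "AE x in M. \<forall>A\<in>G. ereal (\<bar>\<omega> x (B \<inter> A)\<bar> + \<bar>\<omega> x (B - A)\<bar>) \<le> g x"
    using G(1) by (simp add: AE_ball_countable)
  then show "AE x in M. ereal (tv (\<omega> x) B) \<le> g x"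
    using AE_space
  proof eventually_elim
    case (elim x)
    note sup = tv_eq_SUP[OF foliation_signed[OF elim(2)] B G(2)]
    obtain A0 where ne: "A0 \<in> G" using separating_nonempty[OF G(2)] by blast
    show ?case
    proof (cases "g x")
      case (real r)
      have "tv (\<omega> x) B = (SUP A\<in>G. \<bar>\<omega> x (B \<inter> A)\<bar> + \<bar>\<omega> x (B - A)\<bar>)"
        by (rule sup(2))
      also have "\<dots> \<le> r"
        using ne elim(1) real by (intro cSUP_least) auto
      finally show ?thesis using real by simp
    next
      case MInf
      then show ?thesis using bspec[OF elim(1) ne] by simp
    qed simp
  qed
qed

text \<open>Sums of absolute values are bounded by the variation of the union, which is the order
  bound that summability demands.\<close>

lemma foliation_imp_L0_measure:
  assumes zero: "\<And>A. A \<notin> sets borel \<Longrightarrow> \<mu> A = \<zero>\<^bsub>L0_ring M\<^esub>"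
  shows "L0_measure M \<mu>"
  unfolding L0_measure_def
proof (intro conjI allI impI ballI)
  show "\<mu> A \<in> L0 M" if "A \<in> sets borel" for A
    by (simp add: foliation_eq foliation_fun that ae_class_in_L0)
  show "\<mu> A = \<zero>\<^bsub>L0_ring M\<^esub>" if "A \<notin> sets borel" for A using that by (rule zero)
  have sm: "signed_measure (\<omega> x)" if "x \<in> space M" for x
    using foliation_signed[OF that] by (simp add: bounded_signed_def)
  have "ae_class M (\<lambda>x. \<omega> x {}) = ae_class M (\<lambda>_. 0)"
    using sm by (intro ae_class_cong AE_I2) (simp add: signed_measure_def)
  then show "\<mu> {} = \<zero>\<^bsub>L0_ring M\<^esub>" by (simp add: foliation_eq L0_ring_simps)
next
  fix A :: "nat \<Rightarrow> 'w set" assume A: "range A \<subseteq> sets borel" "disjoint_family A"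
  have Am: "A n \<in> sets borel" "(\<Union>n. A n) \<in> sets borel" for n using A(1) by auto
  have part: "borel_partition A (\<Union>n. A n)" using A by (simp add: borel_partition_def)
  have abs: "L0_fun M (\<lambda>x. \<bar>\<omega> x (A n)\<bar>)" for n by (intro L0_fun_abs foliation_fun Am)
  show "L0_summable M (\<lambda>n. L0_abs M (\<mu> (A n)))"
    unfolding L0_summable_def
  proof (intro conjI allI)
    show "L0_abs M (\<mu> (A n)) \<in> L0_pos M" for n
      using abs Am by (simp add: foliation_abs L0_pos_iff)
    have "L0_le M (\<Oplus>\<^bsub>L0_ring M\<^esub>n\<in>{..<N}. L0_abs M (\<mu> (A n))) (ae_class M (\<lambda>x. tv (\<omega> x) (\<Union>n. A n)))" for N
    proof -
      have "AE x in M. (\<Sum>n<N. \<bar>\<omega> x (A n)\<bar>) \<le> tv (\<omega> x) (\<Union>n. A n)"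
      proof (rule AE_I2)
        fix x assume x: "x \<in> space M"
        note tvp = tv_partition[OF foliation_signed[OF x] part]
        have "(\<Sum>n<N. \<bar>\<omega> x (A n)\<bar>) \<le> (\<Sum>n. \<bar>\<omega> x (A n)\<bar>)"
          by (rule sum_le_suminf[OF tvp(1)]) simp_all
        then show "(\<Sum>n<N. \<bar>\<omega> x (A n)\<bar>) \<le> tv (\<omega> x) (\<Union>n. A n)" using tvp(2) by (rule order_trans)
      qed
      then show ?thesis
        by (simp add: foliation_abs Am L0_finsum_ae_class abs L0_le_ae_class L0_fun_sum foliation_tv)
    qed
    moreover have "ae_class M (\<lambda>x. tv (\<omega> x) (\<Union>n. A n)) \<in> L0 M"
      by (intro ae_class_in_L0 foliation_tv Am)
    ultimately show "\<exists>b\<in>L0 M. \<forall>N. L0_le M (\<Oplus>\<^bsub>L0_ring M\<^esub>n\<in>{..<N}. L0_abs M (\<mu> (A n))) b" by blast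
  qed
  have "(\<lambda>n. \<omega> x (A n)) sums \<omega> x (\<Union>n. A n)" if "x \<in> space M" for x
    using foliation_signed[OF that] A unfolding bounded_signed_def signed_measure_def by blast
  then have "AE x in M. (\<lambda>n. \<omega> x (A n)) sums \<omega> x (\<Union>n. A n)" by (rule AE_I2)
  then show "L0_sums M (\<lambda>n. \<mu> (A n)) (\<mu> (\<Union>n. A n))"
    unfolding foliation_eq[OF Am(1)] foliation_eq[OF Am(2)]
    by (rule L0_sumsI[OF foliation_fun[OF Am(1)] foliation_fun[OF Am(2)]])
qed

text \<open>Outer regularity is uniform in \<open>x\<close>: it is inherited from the averaged total variation measure.\<close>

lemma foliation_outer_approx:
  assumes B: "B \<in> sets borel"
  obtains U where "\<And>n::nat. open (U n)" "\<And>n. B \<subseteq> U n"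
    "AE x in M. \<forall>e>0. \<exists>n. tv (\<omega> x) (U n - B) < e"
proof -
  \<comment> \<open>The weight normalises the variation so that \<open>f A x \<le> 1\<close>. The
    averaged measure is therefore finite although the variation need not be integrable, and
    positivity of \<open>w\<close> allows undoing the weight at each point.\<close>
  define w where "w x = 1 / (1 + tv (\<omega> x) UNIV)" for x
  define f where "f A x = tv (\<omega> x) A * w x" for A x
  define \<eta> where "\<eta> = measure_of UNIV (sets borel) (\<lambda>A. \<integral>\<^sup>+x. ennreal (f A x) \<partial>completion M)"
  interpret completion: prob_space "completion M" by (rule prob_space_completion)
  interpret Bor: sigma_algebra UNIV "sets (borel :: 'w measure)"
    using sets.sigma_algebra_axioms[of "borel :: 'w measure"] by simp
  have w: "0 < w x" if "x \<in> space M" for x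
    using tv_nonneg[OF foliation_signed[OF that], of UNIV] by (simp add: w_def)
  have fm: "f A \<in> borel_measurable (completion M)" if "A \<in> sets borel" for A
  proof -
    have "(\<lambda>x. tv (\<omega> x) UNIV) \<in> borel_measurable (completion M)" "(\<lambda>x. tv (\<omega> x) A) \<in> borel_measurable (completion M)"
      using foliation_tv that by (simp_all add: L0_fun_real_iff[symmetric])
    then show ?thesis unfolding f_def[abs_def] w_def[abs_def]
      by (intro borel_measurable_times borel_measurable_divide borel_measurable_add borel_measurable_const)
  qed
  have f0: "0 \<le> f A x" if "x \<in> space M" for A x
    unfolding f_def using w[OF that] tv_nonneg[OF foliation_signed[OF that]] by simp
  have f1: "f A x \<le> 1" if "x \<in> space M" for A x
  proof -
    have "tv (\<omega> x) A \<le> 1 + tv (\<omega> x) UNIV"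
      using tv_mono[OF foliation_signed[OF that], of A UNIV] by simp
    then show ?thesis using tv_nonneg[OF foliation_signed[OF that], of UNIV]
      by (simp add: f_def w_def divide_le_eq)
  qed
  have fint: "integrable (completion M) (f A)" if "A \<in> sets borel" for A
    using f0 f1 by (intro completion.integrable_const_bound[where B=1] fm that AE_I2) simp
  have pos: "positive (sets borel) (\<lambda>A :: 'w set. \<integral>\<^sup>+x. ennreal (f A x) \<partial>completion M)"
  proof -
    have "tv (\<omega> x) {} = 0" if "x \<in> space M" for x
      using measure_tv_measure[OF foliation_signed[OF that], of "{}"] by simp
    then have "(\<integral>\<^sup>+x. ennreal (f {} x) \<partial>completion M) = (\<integral>\<^sup>+x. 0 \<partial>completion M)"
      by (intro nn_integral_cong) (simp add: f_def)
    then show ?thesis by (simp add: positive_def)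
  qed
  have ca: "countably_additive (sets borel) (\<lambda>A :: 'w set. \<integral>\<^sup>+x. ennreal (f A x) \<partial>completion M)"
  proof (rule countably_additiveI)
    fix C :: "nat \<Rightarrow> 'w set"
    assume C: "range C \<subseteq> sets borel" "disjoint_family C" "(\<Union>i. C i) \<in> sets borel"
    then have Cm: "C n \<in> sets borel" for n by blast
    have "(\<Sum>i. \<integral>\<^sup>+x. ennreal (f (C i) x) \<partial>completion M) = (\<integral>\<^sup>+x. (\<Sum>i. ennreal (f (C i) x)) \<partial>completion M)"
      by (rule nn_integral_suminf[symmetric]) (use fm[OF Cm] in \<open>measurable\<close>)
    also have "\<dots> = (\<integral>\<^sup>+x. ennreal (f (\<Union>i. C i) x) \<partial>completion M)"
    proof (rule nn_integral_cong)
      fix x assume "x \<in> space (completion M)"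
      then have x: "x \<in> space M" by simp
      note \<omega>x = foliation_signed[OF x]
      have f_em: "ennreal (f A x) = emeasure (tv_measure (\<omega> x)) A * ennreal (w x)" if "A \<in> sets borel" for A
        using w[OF x] tv_nonneg[OF \<omega>x] by (simp add: f_def emeasure_tv_measure[OF \<omega>x that] ennreal_mult)
      show "(\<Sum>i. ennreal (f (C i) x)) = ennreal (f (\<Union>i. C i) x)"
        unfolding f_em[OF Cm] f_em[OF C(3)] ennreal_suminf_multc
        using suminf_emeasure[of C "tv_measure (\<omega> x)"] C by simp
    qed
    finally show "(\<Sum>i. \<integral>\<^sup>+x. ennreal (f (C i) x) \<partial>completion M) = (\<integral>\<^sup>+x. ennreal (f (\<Union>i. C i) x) \<partial>completion M)" .
  qed
  have sets_\<eta>: "sets \<eta> = sets borel"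
    unfolding \<eta>_def using Bor.sigma_sets_eq by (simp add: sets_measure_of)
  have space_\<eta>: "space \<eta> = UNIV" unfolding \<eta>_def by (simp add: space_measure_of)
  have em: "emeasure \<eta> A = ennreal (LINT x|completion M. f A x)" if "A \<in> sets borel" for A
  proof -
    have "emeasure \<eta> A = (\<integral>\<^sup>+x. ennreal (f A x) \<partial>completion M)"
      unfolding \<eta>_def by (rule emeasure_measure_of_sigma[OF Bor.sigma_algebra_axioms pos ca that])
    also have "\<dots> = ennreal (LINT x|completion M. f A x)"
      using f0 by (intro nn_integral_eq_integral fint that AE_I2) simp
    finally show ?thesis .
  qed
  have fin: "finite_measure \<eta>"
    by (rule finite_measureI) (simp add: em space_\<eta>)
  have "approximable \<eta> B" by (rule borel_approximable[OF fin sets_\<eta> B])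
  then have "\<exists>F U. closed F \<and> open U \<and> F \<subseteq> B \<and> B \<subseteq> U \<and> measure \<eta> (U - F) < inverse (real (Suc n))" for n
    by (rule approximableD) simp
  then obtain F U where FU: "\<And>n. closed (F n)" "\<And>n. open (U n)" "\<And>n. F n \<subseteq> B" "\<And>n. B \<subseteq> U n"
    "\<And>n. measure \<eta> (U n - F n) < inverse (real (Suc n))" by metis
  have UB: "U n - B \<in> sets borel" "U n - F n \<in> sets borel" for n using FU B by auto
  \<comment> \<open>The truncation is inactive because \<open>f\<close> is at most 1, so this
    integral is the mass of \<open>U n - B\<close> under the averaged measure. In this form
    \<open>AE_ex_small\<close> applies.\<close>
  have "(LINT x|completion M. min \<bar>f (U n - B) x\<bar> 1) \<le> inverse (real (Suc n))" for n
  proof -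
    interpret \<eta>: finite_measure \<eta> by (rule fin)
    have "(LINT x|completion M. min \<bar>f (U n - B) x\<bar> 1) = (LINT x|completion M. f (U n - B) x)"
      using f0 f1 by (intro Bochner_Integration.integral_cong) (simp_all add: min_absorb1)
    also have "\<dots> = measure \<eta> (U n - B)"
    proof -
      have "0 \<le> (LINT x|completion M. f (U n - B) x)"
        using f0 by (intro integral_nonneg_AE AE_I2) simp
      then show ?thesis by (simp add: measure_def em UB)
    qed
    also have "\<dots> \<le> measure \<eta> (U n - F n)"
      using FU(3)[of n] UB sets_\<eta> by (intro \<eta>.finite_measure_mono) auto
    finally show ?thesis using FU(5)[of n] by linarith
  qed
  moreover have "0 \<le> (LINT x|completion M. min \<bar>f (U n - B) x\<bar> 1)" for n by simp
  ultimately have lim: "(\<lambda>n. LINT x|completion M. min \<bar>f (U n - B) x\<bar> 1) \<longlonglongrightarrow> 0"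
    by (intro tendsto_sandwich[OF _ _ tendsto_const LIMSEQ_inverse_real_of_nat] always_eventually allI)
  have "AE x in M. \<exists>n. \<bar>f (U n - B) x\<bar> < inverse (real (Suc k))" for k
    by (rule AE_ex_small[OF _ lim]) (simp_all add: L0_fun_real_iff fm UB)
  then have "AE x in M. \<forall>k. \<exists>n. \<bar>f (U n - B) x\<bar> < inverse (real (Suc k))"
    by (simp add: AE_all_countable)
  then have "AE x in M. \<forall>e>0. \<exists>n. tv (\<omega> x) (U n - B) < e"
    using AE_space
  proof eventually_elim
    case (elim x)
    show ?case
    proof (intro allI impI)
      fix e :: real assume "e > 0"
      then have "e * w x > 0" using w[OF elim(2)] by simp
      from reals_Archimedean[OF this] obtain k where k: "inverse (real (Suc k)) < e * w x" by blast
      obtain n where "\<bar>f (U n - B) x\<bar> < inverse (real (Suc k))" using elim(1) by blast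
      then have "tv (\<omega> x) (U n - B) * w x < e * w x" using k unfolding f_def by linarith
      then have "tv (\<omega> x) (U n - B) < e" using w[OF elim(2)] by simp
      then show "\<exists>n. tv (\<omega> x) (U n - B) < e" ..
    qed
  qed
  with FU(2,4) show ?thesis by (rule that)
qed

text \<open>In both conditions a sequence of sets chosen independently of \<open>x\<close> already
  attains the bound almost everywhere: closed sets increasing to \<open>U\<close> from inside, and
  the open sets of \<open>foliation_outer_approx\<close> from outside.\<close>

lemma foliation_imp_L0_radon:
  assumes zero: "\<And>A. A \<notin> sets borel \<Longrightarrow> \<mu> A = \<zero>\<^bsub>L0_ring M\<^esub>"
  shows "L0_radon M \<mu>"
  unfolding L0_radon_def
proof (intro conjI allI impI ballI)
  let ?V = "\<lambda>A. ae_class M (\<lambda>x. ereal (tv (\<omega> x) A))"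
  have V: "L0_fun M (\<lambda>x. ereal (tv (\<omega> x) A))" if "A \<in> sets borel" for A
    by (intro L0_fun_ereal foliation_tv that)
  have repV: "AE x in M. rep (?V A) x = ereal (tv (\<omega> x) A)" if "A \<in> sets borel" for A
    by (rule rep_in(2)[OF V[OF that]])
  have mono: "AE x in M. tv (\<omega> x) A \<le> tv (\<omega> x) B" if "A \<subseteq> B" for A B
    by (rule AE_I2) (rule tv_mono[OF foliation_signed that])
  show "L0_measure M \<mu>" using zero by (rule foliation_imp_L0_measure)
  show "L0_bounded_variation M \<mu>"
  proof -
    have "ae_class M (\<lambda>x. tv (\<omega> x) UNIV) \<in> L0_pos M"
      unfolding L0_pos_iff[OF foliation_tv[OF borel_open[OF open_UNIV]]]
      by (rule AE_I2, rule tv_nonneg, rule foliation_signed)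
    then show ?thesis
      unfolding L0_bounded_variation_def
      by (simp add: L0_variation_foliation L0_embed_ae_class[OF foliation_tv, symmetric])
  qed
  show "L0_variation M \<mu> U = \<Squnion>\<^bsub>L0bar M\<^esub> {L0_variation M \<mu> K |K. compact K \<and> K \<subseteq> U}" if U: "open U" for U
  proof -
    have Um: "U \<in> sets borel" using U by (rule borel_open)
    have Km: "K \<in> sets borel" if "compact K" for K :: "'w set"
      using that by (intro borel_closed compact_imp_closed)
    let ?S = "{L0_variation M \<mu> K |K. compact K \<and> K \<subseteq> U}"
    have S: "c \<in> ?S \<longleftrightarrow> (\<exists>K. compact K \<and> K \<subseteq> U \<and> c = ?V K)" for c
      using L0_variation_foliation[OF Km] by auto
    have "least (L0bar M) (?V U) (Upper (L0bar M) ?S)"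
    proof (rule L0bar_supI[OF V[OF Um]])
      show "?S \<subseteq> L0 M"
      proof
        fix c assume "c \<in> ?S"
        then obtain K where K: "compact K" "c = ?V K" unfolding S by blast
        show "c \<in> L0 M" unfolding K(2) by (intro ae_class_in_L0 V Km K(1))
      qed
      show "AE x in M. rep c x \<le> ereal (tv (\<omega> x) U)" if "c \<in> ?S" for c
      proof -
        from that obtain K where K: "compact K" "K \<subseteq> U" "c = ?V K" unfolding S by blast
        show ?thesis unfolding K(3) using repV[OF Km[OF K(1)]] mono[OF K(2)] by eventually_elim simp
      qed
      fix g :: "'a \<Rightarrow> ereal" assume g: "\<And>c. c \<in> ?S \<Longrightarrow> AE x in M. rep c x \<le> g x"
      \<comment> \<open>These sets exhaust \<open>U\<close> itself, so continuity from below applies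
        to every \<open>tv_measure (\<omega> x)\<close> at once.\<close>
      obtain F :: "nat \<Rightarrow> 'w set" where F: "\<And>n. closed (F n)" "incseq F" "(\<Union>n. F n) = U"
        using U by (rule open_eq_Union_closed) blast
      have Fc: "compact (F n)" for n using compact_Int_closed[OF comp F(1)] by simp
      have "AE x in M. ereal (tv (\<omega> x) (F n)) \<le> g x" for n
      proof -
        have "?V (F n) \<in> ?S" unfolding S using Fc F(3) by blast
        from g[OF this] repV[OF Km[OF Fc[of n]]] show ?thesis by eventually_elim simp
      qed
      then have "AE x in M. \<forall>n. ereal (tv (\<omega> x) (F n)) \<le> g x" by (simp add: AE_all_countable)
      then show "AE x in M. ereal (tv (\<omega> x) U) \<le> g x"
        using AE_space
      proof eventually_elim
        case (elim x)
        note \<omega>x = foliation_signed[OF elim(2)]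
        interpret finite_measure "tv_measure (\<omega> x)" by (rule finite_measure_tv_measure[OF \<omega>x])
        have "(\<lambda>n. measure (tv_measure (\<omega> x)) (F n)) \<longlonglongrightarrow> measure (tv_measure (\<omega> x)) (\<Union>n. F n)"
          using F(1) borel_closed by (intro finite_Lim_measure_incseq F(2)) auto
        then have "(\<lambda>n. ereal (tv (\<omega> x) (F n))) \<longlonglongrightarrow> ereal (tv (\<omega> x) U)"
          using F(1,3) Um by (simp add: measure_tv_measure[OF \<omega>x] borel_closed)
        then show ?case by (rule LIMSEQ_le_const2) (use elim(1) in blast)
      qed
    qed
    then show ?thesis by (simp add: L0_variation_foliation[OF Um] L0bar_sup_eq)
  qed
  show "L0_variation M \<mu> B = \<Sqinter>\<^bsub>L0bar M\<^esub> {L0_variation M \<mu> U |U. open U \<and> B \<subseteq> U}"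
    if B: "B \<in> sets borel" for B
  proof -
    let ?S = "{L0_variation M \<mu> U |U. open U \<and> B \<subseteq> U}"
    have S: "c \<in> ?S \<longleftrightarrow> (\<exists>U. open U \<and> B \<subseteq> U \<and> c = ?V U)" for c
      using L0_variation_foliation[OF borel_open] by auto
    have "greatest (L0bar M) (?V B) (Lower (L0bar M) ?S)"
    proof (rule L0bar_infI[OF V[OF B]])
      show "?S \<subseteq> L0 M"
      proof
        fix c assume "c \<in> ?S"
        then obtain U where U: "open U" "c = ?V U" unfolding S by blast
        show "c \<in> L0 M" unfolding U(2) by (intro ae_class_in_L0 V borel_open U(1))
      qed
      show "AE x in M. ereal (tv (\<omega> x) B) \<le> rep c x" if "c \<in> ?S" for c
      proof -
        from that obtain U where U: "open U" "B \<subseteq> U" "c = ?V U" unfolding S by blast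
        show ?thesis unfolding U(3) using repV[OF borel_open[OF U(1)]] mono[OF U(2)] by eventually_elim simp
      qed
      fix g :: "'a \<Rightarrow> ereal" assume g: "\<And>c. c \<in> ?S \<Longrightarrow> AE x in M. g x \<le> rep c x"
      obtain U where U: "\<And>n::nat. open (U n)" "\<And>n. B \<subseteq> U n"
        "AE x in M. \<forall>e>0. \<exists>n. tv (\<omega> x) (U n - B) < e"
        using B by (rule foliation_outer_approx) blast
      have "AE x in M. g x \<le> ereal (tv (\<omega> x) (U n))" for n
      proof -
        have "?V (U n) \<in> ?S" unfolding S using U(1,2) by blast
        from g[OF this] repV[OF borel_open[OF U(1)[of n]]] show ?thesis by eventually_elim simp
      qed
      then have "AE x in M. \<forall>n. g x \<le> ereal (tv (\<omega> x) (U n))" by (simp add: AE_all_countable)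
      then show "AE x in M. g x \<le> ereal (tv (\<omega> x) B)"
        using U(3) AE_space
      proof eventually_elim
        case (elim x)
        note \<omega>x = foliation_signed[OF elim(3)]
        show ?case
        proof (rule ereal_le_epsilon2)
          fix e :: real assume "0 < e"
          then obtain n where n: "tv (\<omega> x) (U n - B) < e" using elim(2) by blast
          have "tv (\<omega> x) (U n) = tv (\<omega> x) B + tv (\<omega> x) (U n - B)"
            using U(1,2) B by (intro tv_split[OF \<omega>x]) (simp_all add: borel_open)
          then have "ereal (tv (\<omega> x) (U n)) \<le> ereal (tv (\<omega> x) B) + ereal e" using n by simp
          then show "g x \<le> ereal (tv (\<omega> x) B) + ereal e"
            using elim(1) by (meson order_trans)
        qed
      qed
    qed
    then show ?thesis by (simp add: L0_variation_foliation[OF B] L0bar_inf_eq)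
  qed
qed

end

end

section \<open>Extension of charges from the algebra of balls\<close>

context charge
begin

lemma pv_subadd: "A \<in> \<A> \<Longrightarrow> B \<in> \<A> \<Longrightarrow> pv (A \<union> B) \<le> pv A + pv B"
  using pv_Un[of A "B - A"] Diff_in[of B A] pv_mono[of "B - A" B] by auto

lemma pv_UN_le:
  assumes "finite I" "\<And>i. i \<in> I \<Longrightarrow> A i \<in> \<A>"
  shows "(\<Union>i\<in>I. A i) \<in> \<A> \<and> pv (\<Union>i\<in>I. A i) \<le> (\<Sum>i\<in>I. pv (A i))"
  using assms
proof (induction I rule: finite_induct)
  case (insert i I)
  then have *: "A i \<in> \<A>" "(\<Union>i\<in>I. A i) \<in> \<A>" "pv (\<Union>i\<in>I. A i) \<le> (\<Sum>i\<in>I. pv (A i))" by auto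
  have "pv (A i \<union> (\<Union>i\<in>I. A i)) \<le> pv (A i) + (\<Sum>i\<in>I. pv (A i))"
    using pv_subadd[OF *(1,2)] *(3) by linarith
  then show ?case using insert.hyps Un_in[OF *(1,2)] by simp
qed (simp add: empty_in pv_empty)

end

text \<open>The last assumption is the only trace of countable additivity. The extra set
  \<open>B\<close> is there because \<open>pv_small\<close> needs smallness on parts of the shells,
  not just on the shells themselves.\<close>

locale ball_charge = charge "ball_alg D" \<nu> b
  for D :: "'w::metric_space set" and \<nu> b +
  assumes comp: "compact (UNIV :: 'w set)"
    and dense: "\<And>x e. e > 0 \<Longrightarrow> \<exists>q\<in>D. dist q x < e"
    and small: "\<And>q r B e. q \<in> D \<Longrightarrow> r \<in> \<rat> \<Longrightarrow> B \<in> ball_alg D \<Longrightarrow> e > 0 \<Longrightarrow>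
      \<exists>n. \<bar>\<nu> (B \<inter> (ball q r - ball q (r - inverse (real (Suc n)))))\<bar> < e"
begin

lemma negated_ball: "ball_charge D (\<lambda>A. - \<nu> A) b"
proof -
  interpret neg: charge "ball_alg D" "\<lambda>A. - \<nu> A" b by (rule negated)
  show ?thesis by unfold_locales (simp_all add: comp dense small del: of_nat_Suc)
qed

lemma ball_in: "q \<in> D \<Longrightarrow> r \<in> \<rat> \<Longrightarrow> ball q r \<in> ball_alg D"
  unfolding ball_alg_def by (rule gen_alg.base) blast

text \<open>The closure of a member of the algebra may leave the algebra, so the defect is measured
  with \<open>B\<close> and not with its closure.\<close>

definition inner_approximable :: "'w set \<Rightarrow> bool" where
  "inner_approximable A \<longleftrightarrow>
    (\<forall>e>0. \<exists>B\<in>ball_alg D. closure B \<subseteq> A \<and> pv (A - B) < e)"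

lemma inner_approximable_closed: "closed A \<Longrightarrow> A \<in> ball_alg D \<Longrightarrow> inner_approximable A"
  unfolding inner_approximable_def by (intro allI impI bexI[of _ A]) (simp_all add: pv_empty)

text \<open>Shrinking the radius slightly puts the closure inside the original ball, and the shell
  lost has small positive part by \<open>pv_small\<close>.\<close>

lemma inner_approximable_ball:
  assumes q: "q \<in> D" and r: "r \<in> \<rat>"
  shows "inner_approximable (ball q r)"
  unfolding inner_approximable_def
proof (intro allI impI)
  fix e :: real assume e: "e > 0"
  define s where "s n = r - inverse (real (Suc n))" for n
  have s: "s n \<in> \<rat>" "s n < r" for n unfolding s_def using r by simp_all
  have "\<exists>n. pv (ball q r - ball q (s n)) < e"
  proof (rule pv_small[OF _ _ _ e])
    show "ball q r - ball q (s n) \<in> ball_alg D" for n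
      by (intro Diff_in ball_in q r s)
    have "s 0 \<le> s n" for n unfolding s_def by (simp add: field_simps)
    then show "ball q r - ball q (s n) \<subseteq> ball q r - ball q (s 0)" for n
      by (intro Diff_mono subset_ball) simp_all
  next
    fix B \<delta> assume "B \<in> ball_alg D" "(0::real) < \<delta>"
    with q r show "\<exists>n. \<bar>\<nu> (B \<inter> (ball q r - ball q (s n)))\<bar> < \<delta>" unfolding s_def by (rule small)
  qed
  then obtain n where n: "pv (ball q r - ball q (s n)) < e" by blast
  have "closure (ball q (s n)) \<subseteq> cball q (s n)" by (rule closure_minimal) (simp_all add: ball_subset_cball)
  moreover have "cball q (s n) \<subseteq> ball q r" using s(2)[of n] by auto
  ultimately have "closure (ball q (s n)) \<subseteq> ball q r" by (rule order_trans)
  then show "\<exists>B\<in>ball_alg D. closure B \<subseteq> ball q r \<and> pv (ball q r - B) < e"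
    using n ball_in[OF q s(1)] by blast
qed

lemma inner_approximable_Un_Int:
  assumes A: "A \<in> ball_alg D" "A' \<in> ball_alg D" "inner_approximable A" "inner_approximable A'"
  shows "inner_approximable (A \<union> A') \<and> inner_approximable (A \<inter> A')"
  unfolding inner_approximable_def
proof (intro conjI allI impI)
  fix e :: real assume "e > 0"
  then have e2: "e / 2 > 0" by simp
  obtain B where B: "B \<in> ball_alg D" "closure B \<subseteq> A" "pv (A - B) < e / 2"
    using A(3) e2 unfolding inner_approximable_def by blast
  obtain B' where B': "B' \<in> ball_alg D" "closure B' \<subseteq> A'" "pv (A' - B') < e / 2"
    using A(4) e2 unfolding inner_approximable_def by blast
  have "pv ((A - B) \<union> (A' - B')) \<le> pv (A - B) + pv (A' - B')"
    by (intro pv_subadd Diff_in A B(1) B'(1))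
  then have lt: "pv ((A - B) \<union> (A' - B')) < e" using B(3) B'(3) by linarith
  show "\<exists>B\<in>ball_alg D. closure B \<subseteq> A \<union> A' \<and> pv (A \<union> A' - B) < e"
  proof (intro bexI conjI)
    show "B \<union> B' \<in> ball_alg D" by (rule Un_in[OF B(1) B'(1)])
    show "closure (B \<union> B') \<subseteq> A \<union> A'" using B(2) B'(2) by (auto simp: closure_Un)
    have "pv (A \<union> A' - (B \<union> B')) \<le> pv ((A - B) \<union> (A' - B'))" by (rule pv_mono) blast
    then show "pv (A \<union> A' - (B \<union> B')) < e" using lt by linarith
  qed
  show "\<exists>B\<in>ball_alg D. closure B \<subseteq> A \<inter> A' \<and> pv (A \<inter> A' - B) < e"
  proof (intro bexI conjI)
    show "B \<inter> B' \<in> ball_alg D" by (rule Int_in[OF B(1) B'(1)])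
    have "closure (B \<inter> B') \<subseteq> closure B \<inter> closure B'" by (simp add: closure_mono)
    then show "closure (B \<inter> B') \<subseteq> A \<inter> A'" using B(2) B'(2) by blast
    have "pv (A \<inter> A' - (B \<inter> B')) \<le> pv ((A - B) \<union> (A' - B'))" by (rule pv_mono) blast
    then show "pv (A \<inter> A' - (B \<inter> B')) < e" using lt by linarith
  qed
qed

lemma Compl_in: "A \<in> ball_alg D \<Longrightarrow> - A \<in> ball_alg D"
  unfolding ball_alg_def by (rule gen_alg.Compl)

text \<open>Inner approximation does not obviously pass to complements, so the induction carries
  \<open>A\<close> and \<open>- A\<close> together. Complements of balls are closed members of the
  algebra and approximate themselves; complements of unions are intersections.\<close>

lemma inner_approximable_ball_alg:
  assumes "A \<in> ball_alg D"
  shows "inner_approximable A"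
proof -
  have "A \<in> gen_alg {ball q r | q r. q \<in> D \<and> r \<in> \<rat>}" using assms by (simp add: ball_alg_def)
  then have "inner_approximable A \<and> inner_approximable (- A)"
  proof induction
    case (base A)
    then obtain q r where A: "A = ball q r" "q \<in> D" "r \<in> \<rat>" by blast
    have "closed (- A)" unfolding A(1) by (intro closed_Compl open_ball)
    then show ?case
      using inner_approximable_ball[OF A(2,3)] Compl_in[OF ball_in[OF A(2,3)]] A(1)
        inner_approximable_closed by blast
  next
    case empty
    have "- {} \<in> ball_alg D" by (rule Compl_in[OF empty_in])
    then show ?case
      using inner_approximable_closed[OF closed_empty empty_in] inner_approximable_closed[of "- {}"] by simp
  next
    case (Compl A)
    then show ?case by simp
  next
    case (Un A A')
    then have in_alg: "A \<in> ball_alg D" "A' \<in> ball_alg D" by (simp_all add: ball_alg_def)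
    show ?case
      using inner_approximable_Un_Int[OF in_alg] inner_approximable_Un_Int[OF Compl_in[OF in_alg(1)] Compl_in[OF in_alg(2)]]
        Un.IH by (simp add: Compl_Un)
  qed
  then show ?thesis ..
qed

text \<open>
  Inner approximation by closed sets makes the positive part continuous at the empty set on the
  algebra, by compactness, so that Caratheodory's theorem applies.
\<close>

lemma pv_tendsto_0:
  assumes A: "range A \<subseteq> ball_alg D" "decseq A" "(\<Inter>n. A n) = {}"
  shows "(\<lambda>n. pv (A n)) \<longlonglongrightarrow> 0"
proof (rule LIMSEQ_I)
  fix e :: real assume e: "0 < e"
  have An: "A n \<in> ball_alg D" for n using A(1) by blast
  \<comment> \<open>The tolerances add up to \<open>e / 2\<close>, so the total defect stays below
    \<open>e\<close>.\<close>
  have "\<exists>B\<in>ball_alg D. closure B \<subseteq> A n \<and> pv (A n - B) < e / 2 * (1/2) ^ Suc n" for n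
  proof -
    have "e / 2 * (1/2) ^ Suc n > 0" using e by simp
    then show ?thesis
      using inner_approximable_ball_alg[OF An[of n]] unfolding inner_approximable_def by blast
  qed
  then obtain B where B: "\<And>n. B n \<in> ball_alg D" "\<And>n. closure (B n) \<subseteq> A n"
    "\<And>n. pv (A n - B n) < e / 2 * (1/2) ^ Suc n" by metis
  have "(\<Inter>n. closure (B n)) \<subseteq> (\<Inter>n. A n)" by (rule INF_mono'[OF B(2)])
  \<comment> \<open>The closures lie in the sets \<open>A n\<close>, whose intersection is empty; by
    compactness finitely many of them already have empty intersection.\<close>
  then have "UNIV \<subseteq> (\<Union>n. - closure (B n))" unfolding A(3) Compl_INT[symmetric] by simp
  then obtain I where "I \<subseteq> UNIV" and I: "finite I" "UNIV \<subseteq> (\<Union>n\<in>I. - closure (B n))"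
    by (rule compactE_image[OF comp, of UNIV "\<lambda>n. - closure (B n)", rotated]) (simp_all add: open_Compl)
  have summ: "(\<lambda>n. e / 2 * (1/2) ^ Suc n) sums (e / 2)"
    using sums_mult[OF power_half_series, of "e/2"] by simp
  \<comment> \<open>Beyond all indices in \<open>I\<close>, a point of \<open>A m\<close> lies in
    every \<open>A n\<close> with \<open>n \<in> I\<close> and avoids the closure of some
    \<open>B n\<close>. Inserting 0 keeps the maximum meaningful when \<open>I\<close> is
    empty.\<close>
  have "norm (pv (A m) - 0) < e" if m: "m \<ge> Max (insert 0 I)" for m
  proof -
    have "A m \<subseteq> (\<Union>n\<in>I. A n - B n)"
    proof
      fix x assume x: "x \<in> A m"
      obtain n where n: "n \<in> I" "x \<notin> closure (B n)" using I(2) by blast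
      have "n \<le> m" using m n(1) I(1) by simp
      then have "x \<in> A n" using decseqD[OF A(2)] x by blast
      moreover have "x \<notin> B n" using n(2) closure_subset[of "B n"] by blast
      ultimately show "x \<in> (\<Union>n\<in>I. A n - B n)" using n(1) by blast
    qed
    then have "pv (A m) \<le> pv (\<Union>n\<in>I. A n - B n)" by (rule pv_mono)
    also have "\<dots> \<le> (\<Sum>n\<in>I. pv (A n - B n))"
      using pv_UN_le[OF I(1), of "\<lambda>n. A n - B n"] Diff_in[OF An B(1)] by blast
    also have "\<dots> \<le> (\<Sum>n\<in>I. e / 2 * (1/2) ^ Suc n)"
      by (intro sum_mono less_imp_le B(3))
    also have "\<dots> \<le> (\<Sum>n. e / 2 * (1/2) ^ Suc n)"
      using e by (intro sum_le_suminf sums_summable[OF summ] I(1)) simp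
    also have "\<dots> = e / 2" using summ by (rule sums_unique[symmetric])
    finally show ?thesis using e pv_nonneg[of "A m"] by simp
  qed
  then show "\<exists>no. \<forall>n\<ge>no. norm (pv (A n) - 0) < e" by blast
qed

lemma pv_extension:
  obtains N where "finite_measure N" "sets N = sets borel" "\<And>A. A \<in> ball_alg D \<Longrightarrow> measure N A = pv A"
proof -
  have ring: "ring_of_sets UNIV (ball_alg D)"
    unfolding ring_of_sets_iff using empty_in Un_in Diff_in by auto
  then interpret R: ring_of_sets UNIV "ball_alg D" .
  have sig: "sigma_sets UNIV (ball_alg D) = sets borel"
    using dense by (rule sigma_sets_ball_alg[OF comp])
  have "positive (ball_alg D) (\<lambda>A. ennreal (pv A))" by (simp add: positive_def pv_empty)
  moreover have "Measure_Space.additive (ball_alg D) (\<lambda>A. ennreal (pv A))"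
    unfolding Measure_Space.additive_def by (simp add: pv_Un pv_nonneg)
  moreover have "(\<lambda>i. ennreal (pv (A i))) \<longlonglongrightarrow> 0"
    if "range A \<subseteq> ball_alg D" "decseq A" "(\<Inter>i. A i) = {}" for A
    using tendsto_ennrealI[OF pv_tendsto_0[OF that]] by simp
  ultimately have "\<exists>\<mu>. (\<forall>s\<in>ball_alg D. \<mu> s = ennreal (pv s)) \<and> measure_space UNIV (sigma_sets UNIV (ball_alg D)) \<mu>"
    by (intro R.caratheodory_empty_continuous) auto
  then obtain \<mu> where \<mu>: "\<And>s. s \<in> ball_alg D \<Longrightarrow> \<mu> s = ennreal (pv s)" "measure_space UNIV (sets borel) \<mu>"
    unfolding sig by blast
  define N where "N = measure_of UNIV (sets borel) \<mu>"
  have sets_N: "sets N = sets borel" unfolding N_def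
    using sets.sigma_sets_eq[of borel] by (simp add: sets_measure_of)
  have space_N: "space N = UNIV" unfolding N_def by (simp add: space_measure_of)
  have em: "emeasure N A = \<mu> A" if "A \<in> sets borel" for A
    unfolding N_def using \<mu>(2) that unfolding measure_space_def by (intro emeasure_measure_of_sigma) auto
  \<comment> \<open>As the whole space belongs to the algebra, the extended measure has the finite
    total mass \<open>pv UNIV\<close>.\<close>
  have U: "UNIV \<in> ball_alg D" using Compl_in[OF empty_in] by simp
  show ?thesis
  proof (rule that[OF _ sets_N])
    show "finite_measure N"
      by (rule finite_measureI) (simp add: space_N em \<mu>(1)[OF U])
    show "measure N A = pv A" if "A \<in> ball_alg D" for A
      using \<mu>(1)[OF that] em[OF ball_alg_borel[OF that]] by (simp add: measure_def pv_nonneg)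
  qed
qed

text \<open>The smallness assumption involves absolute values, so the negated charge satisfies it
  too and both Jordan parts extend; on the algebra their difference is \<nu> by
  \<open>pv_uminus\<close>.\<close>

lemma extension: "\<exists>\<nu>'. bounded_signed \<nu>' \<and> (\<forall>A\<in>ball_alg D. \<nu>' A = \<nu> A)"
proof -
  interpret neg: ball_charge D "\<lambda>A. - \<nu> A" b by (rule negated_ball)
  obtain N where N: "finite_measure N" "sets N = sets borel" "\<And>A. A \<in> ball_alg D \<Longrightarrow> measure N A = pv A"
    by (rule pv_extension) blast
  obtain N' where N': "finite_measure N'" "sets N' = sets borel" "\<And>A. A \<in> ball_alg D \<Longrightarrow> measure N' A = neg.pv A"
    by (rule neg.pv_extension) blast
  have "bounded_signed (\<lambda>A. if A \<in> sets borel then measure N A - measure N' A else 0)"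
    by (rule bounded_signed_measure_diff[OF N(1) N'(1) N(2) N'(2)])
  moreover have "(if A \<in> sets borel then measure N A - measure N' A else 0) = \<nu> A" if "A \<in> ball_alg D" for A
    using ball_alg_borel[OF that] N(3)[OF that] N'(3)[OF that] pv_uminus[OF that] by simp
  ultimately show ?thesis by blast
qed

end

text \<open>The sets of agreement form a Dynkin class, and \<open>UNIV\<close> lies in the algebra.
  Off the Borel sets both functions vanish by convention, so the conclusion is equality of
  functions.\<close>

lemma bounded_signed_eqI:
  fixes D :: "'w::metric_space set"
  assumes comp: "compact (UNIV :: 'w set)" and D: "\<And>x e. e > 0 \<Longrightarrow> \<exists>q\<in>D. dist q x < e"
    and \<nu>: "signed_measure \<nu>" "signed_measure \<nu>'" and eq: "\<And>A. A \<in> ball_alg D \<Longrightarrow> \<nu> A = \<nu>' A"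
  shows "\<nu> = \<nu>'"
proof
  fix A :: "'w set"
  have sig: "sigma_sets UNIV (ball_alg D) = sets borel"
    using D by (rule sigma_sets_ball_alg[OF comp])
  have alg: "A \<inter> B \<in> ball_alg D" if "A \<in> ball_alg D" "B \<in> ball_alg D" for A B
  proof -
    have "A - (A - B) \<in> ball_alg D" using that unfolding ball_alg_def by (intro gen_alg_Diff)
    then show ?thesis by (simp add: Diff_Diff_Int)
  qed
  have U: "UNIV \<in> ball_alg D"
    unfolding ball_alg_def using gen_alg.Compl[OF gen_alg.empty] by simp
  show "\<nu> A = \<nu>' A"
  proof (cases "A \<in> sets borel")
    case True
    have "Int_stable (ball_alg D)" using alg by (auto simp: Int_stable_def)
    moreover have "ball_alg D \<subseteq> Pow UNIV" by simp
    moreover have "A \<in> sigma_sets UNIV (ball_alg D)" using True sig by simp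
    ultimately show ?thesis
    proof (induction rule: sigma_sets_induct_disjoint)
      case (basic A)
      then show ?case by (rule eq)
    next
      case empty
      show ?case using \<nu> by (simp add: signed_measure_def)
    next
      case (compl A)
      have A: "A \<in> sets borel" "UNIV - A \<in> sets borel" using compl(1) sig by auto
      have "\<nu> UNIV = \<nu> A + \<nu> (UNIV - A)" "\<nu>' UNIV = \<nu>' A + \<nu>' (UNIV - A)"
        using signed_measure_additive[OF \<nu>(1) A] signed_measure_additive[OF \<nu>(2) A] by simp_all
      then show ?case using eq[OF U] compl(2) by linarith
    next
      case (union A)
      have "(\<lambda>n. \<nu> (A n)) sums \<nu> (\<Union>n. A n)" "(\<lambda>n. \<nu>' (A n)) sums \<nu>' (\<Union>n. A n)"
        using \<nu> union(1,2) unfolding signed_measure_def sig by blast+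
      then show ?case using sums_unique2 unfolding union(3) by blast
    qed
  next
    case False
    then show ?thesis using \<nu> by (simp add: signed_measure_def)
  qed
qed

section \<open>Existence and uniqueness of foliations\<close>

context prob_space
begin

context
  fixes \<mu> :: "'w::metric_space set \<Rightarrow> ('a \<Rightarrow> real) set"
  assumes \<mu>: "L0_measure M \<mu>"
begin

definition rep_of :: "'w set \<Rightarrow> 'a \<Rightarrow> real" where
  "rep_of A = rep (\<mu> A)"

lemma rep_of:
  assumes "A \<in> sets borel"
  shows "rep_of A \<in> borel_measurable M" "L0_fun M (rep_of A)" "ae_class M (rep_of A) = \<mu> A"
proof -
  have "\<mu> A \<in> L0 M" using \<mu> assms by (simp add: L0_measure_def)
  then show "rep_of A \<in> borel_measurable M" "L0_fun M (rep_of A)" "ae_class M (rep_of A) = \<mu> A"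
    unfolding rep_of_def by (rule L0_rep)+
qed

lemma rep_of_sums:
  assumes A: "range A \<subseteq> sets borel" "disjoint_family A"
  shows "L0_sums M (\<lambda>n. ae_class M (rep_of (A n))) (ae_class M (rep_of (\<Union>n. A n)))"
proof -
  have "A n \<in> sets borel" "(\<Union>n. A n) \<in> sets borel" for n using A(1) by auto
  moreover have "L0_sums M (\<lambda>n. \<mu> (A n)) (\<mu> (\<Union>n. A n))"
    using \<mu> A unfolding L0_measure_def by blast
  ultimately show ?thesis by (simp add: rep_of)
qed

lemma rep_of_empty: "AE x in M. rep_of {} x = 0"
proof -
  have "ae_class M (rep_of {}) = ae_class M (\<lambda>_. 0)"
    using \<mu> rep_of(3)[of "{}"] by (simp add: L0_measure_def L0_ring_simps)
  then show ?thesis by (rule ae_class_eqD) (simp add: rep_of)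
qed

text \<open>Finite additivity is read off from the series with terms \<open>A\<close>,
  \<open>B\<close>, \<open>{}\<close>, \<open>{}\<close> and so on: it has two limits in measure,
  which must agree.\<close>

lemma rep_of_Un:
  assumes A: "A \<in> sets borel" and B: "B \<in> sets borel" and disj: "A \<inter> B = {}"
  shows "AE x in M. rep_of (A \<union> B) x = rep_of A x + rep_of B x"
proof -
  have part: "borel_partition (binaryset A B) (A \<union> B)" by (rule borel_partition_binaryset[OF assms])
  then have m: "binaryset A B n \<in> sets borel" for n by (auto simp: borel_partition_def)
  have s1: "L0_sums M (\<lambda>n. ae_class M (rep_of (binaryset A B n))) (ae_class M (rep_of (A \<union> B)))"
    using rep_of_sums[of "binaryset A B"] part by (simp add: borel_partition_def)
  have f: "L0_fun M (\<lambda>x. rep_of A x + rep_of B x)" by (intro L0_fun_add rep_of A B)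
  have "AE x in M. (\<lambda>n. rep_of (binaryset A B n) x) sums (rep_of A x + rep_of B x)"
    using rep_of_empty
  proof eventually_elim
    case (elim x)
    show ?case by (rule binaryset_sums[where f="\<lambda>A. rep_of A x"]) (rule elim)
  qed
  then have s2: "L0_sums M (\<lambda>n. ae_class M (rep_of (binaryset A B n))) (ae_class M (\<lambda>x. rep_of A x + rep_of B x))"
    by (rule L0_sumsI[OF rep_of(2)[OF m] f])
  show ?thesis
    by (rule L0_sums_AE_unique[OF rep_of(2)[OF m] _ f s1 s2]) (intro rep_of sets.Un A B)
qed

text \<open>For the series over the differences of consecutive sets, telescoping turns the error
  after \<open>N\<close> terms into \<open>- rep_of (C N) x\<close>, and \<open>AE_ex_small\<close>
  makes it small for some \<open>N\<close>.\<close>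

lemma rep_of_small:
  assumes C: "range C \<subseteq> sets borel" "decseq C" "(\<Inter>n. C n) = {}" and e: "e > 0"
  shows "AE x in M. \<exists>n. \<bar>rep_of (C n) x\<bar> < e"
proof -
  define E where "E n = C n - C (Suc n)" for n
  have Cm: "C n \<in> sets borel" for n using C(1) by blast
  then have Em: "E n \<in> sets borel" for n by (auto simp: E_def)
  have "disjoint_family E" "(\<Union>n. E n) = C 0"
    unfolding E_def[abs_def] by (rule decseq_differences[OF C(2,3)])+
  then have "L0_sums M (\<lambda>n. ae_class M (rep_of (E n))) (ae_class M (rep_of (C 0)))"
    using rep_of_sums[of E] Em by auto
  note lim = L0_sums_dist[OF this rep_of(2)[OF Em] rep_of(2)[OF Cm]]
  have "L0_fun M (\<lambda>x. (\<Sum>n<N. rep_of (E n) x) - rep_of (C 0) x)" for N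
    by (intro L0_fun_diff L0_fun_sum rep_of Em Cm)
  from AE_ex_small[OF this lim e]
  have "AE x in M. \<exists>N. \<bar>(\<Sum>n<N. rep_of (E n) x) - rep_of (C 0) x\<bar> < e" .
  moreover have "AE x in M. \<forall>n. rep_of (C n) x = rep_of (C (Suc n)) x + rep_of (E n) x"
    unfolding AE_all_countable
  proof
    fix n
    have "C (Suc n) \<union> E n = C n" using C(2) by (auto simp: E_def decseq_Suc_iff)
    moreover have "C (Suc n) \<inter> E n = {}" by (auto simp: E_def)
    ultimately show "AE x in M. rep_of (C n) x = rep_of (C (Suc n)) x + rep_of (E n) x"
      using rep_of_Un[OF Cm[of "Suc n"] Em[of n]] by simp
  qed
  ultimately show ?thesis
  proof eventually_elim
    case (elim x)
    have "(\<Sum>n<N. rep_of (E n) x) = rep_of (C 0) x - rep_of (C N) x" for N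
    proof (induction N)
      case (Suc N)
      then show ?case using spec[OF elim(2), of N] by simp
    qed simp
    then show ?case using elim(1) by simp
  qed
qed

text \<open>A single function dominates all the representatives: the total variation bounds in
  particular the sum over the partition into \<open>A\<close> and \<open>- A\<close>.\<close>

lemma rep_of_bounded:
  assumes "L0_bounded_variation M \<mu>"
  obtains b where "\<And>A. A \<in> sets borel \<Longrightarrow> AE x in M. \<bar>rep_of A x\<bar> \<le> b x"
proof -
  let ?S = "{L0_embed M s |s B. borel_partition B UNIV \<and> L0_sums M (\<lambda>n. L0_abs M (\<mu> (B n))) s}"
  have S: "?S \<subseteq> L0 M" by (rule L0_variation_family)
  obtain c where "c \<in> L0_pos M" and c: "L0_variation M \<mu> UNIV = L0_embed M c"
    using assms unfolding L0_bounded_variation_def by blast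
  then have "c \<in> L0 M" by (simp add: L0_pos_def)
  then obtain b where b: "L0_fun M b" "c = ae_class M b" by (rule L0E)
  have "AE x in M. \<bar>rep_of A x\<bar> \<le> b x" if A: "A \<in> sets borel" for A
  proof -
    have "borel_partition (binaryset A (- A)) (A \<union> - A)"
      using A by (intro borel_partition_binaryset) auto
    then have part: "borel_partition (binaryset A (- A)) UNIV" by simp
    then have m: "binaryset A (- A) n \<in> sets borel" for n by (auto simp: borel_partition_def)
    have Am: "- A \<in> sets borel" using A by auto
    have abs: "L0_fun M (\<lambda>x. \<bar>rep_of B x\<bar>)" if "B \<in> sets borel" for B
      by (intro L0_fun_abs rep_of that)
    have f: "L0_fun M (\<lambda>x. \<bar>rep_of A x\<bar> + \<bar>rep_of (- A) x\<bar>)" by (intro L0_fun_add abs A Am)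
    have "AE x in M. (\<lambda>n. \<bar>rep_of (binaryset A (- A) n) x\<bar>) sums (\<bar>rep_of A x\<bar> + \<bar>rep_of (- A) x\<bar>)"
      using rep_of_empty
    proof eventually_elim
      case (elim x)
      show ?case by (rule binaryset_sums[where f="\<lambda>A. \<bar>rep_of A x\<bar>"]) (simp add: elim)
    qed
    then have "L0_sums M (\<lambda>n. ae_class M (\<lambda>x. \<bar>rep_of (binaryset A (- A) n) x\<bar>))
        (ae_class M (\<lambda>x. \<bar>rep_of A x\<bar> + \<bar>rep_of (- A) x\<bar>))"
      by (rule L0_sumsI[OF abs[OF m] f])
    moreover have "L0_abs M (\<mu> B) = ae_class M (\<lambda>x. \<bar>rep_of B x\<bar>)" if "B \<in> sets borel" for B
      unfolding rep_of(3)[OF that, symmetric] by (rule L0_abs_ae_class[OF rep_of(2)[OF that]])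
    ultimately have "L0_sums M (\<lambda>n. L0_abs M (\<mu> (binaryset A (- A) n)))
        (ae_class M (\<lambda>x. \<bar>rep_of A x\<bar> + \<bar>rep_of (- A) x\<bar>))"
      using m by simp
    then have "L0_embed M (ae_class M (\<lambda>x. \<bar>rep_of A x\<bar> + \<bar>rep_of (- A) x\<bar>)) \<in> ?S"
      using part by blast
    from L0bar_le_sup[OF S this]
    have "L0_le M (ae_class M (\<lambda>x. ereal (\<bar>rep_of A x\<bar> + \<bar>rep_of (- A) x\<bar>))) (ae_class M (\<lambda>x. ereal (b x)))"
      using c unfolding L0_variation_def b(2) L0_embed_ae_class[OF f] L0_embed_ae_class[OF b(1)] by simp
    then have "AE x in M. ereal (\<bar>rep_of A x\<bar> + \<bar>rep_of (- A) x\<bar>) \<le> ereal (b x)"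
      unfolding L0_le_ae_class[OF L0_fun_ereal[OF f] L0_fun_ereal[OF b(1)]] .
    then show ?thesis by eventually_elim simp
  qed
  then show ?thesis by (rule that)
qed

lemma foliation_exists:
  assumes comp: "compact (UNIV :: 'w set)" and bv: "L0_bounded_variation M \<mu>"
  shows "\<exists>\<omega>. foliation M \<mu> \<omega>"
proof -
  obtain D :: "'w set" where D: "countable D" and dense: "\<And>x e. e > 0 \<Longrightarrow> \<exists>q\<in>D. dist q x < e"
    using countable_dense_exists[OF comp] by blast
  have alg: "countable (ball_alg D)" by (rule countable_ball_alg[OF D])
  have m: "A \<in> sets borel" if "A \<in> ball_alg D" for A using that by (rule ball_alg_borel)
  have sig: "sigma_sets UNIV (ball_alg D) = sets borel" using dense by (rule sigma_sets_ball_alg[OF comp])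
  obtain b where b: "\<And>A. A \<in> sets borel \<Longrightarrow> AE x in M. \<bar>rep_of A x\<bar> \<le> b x"
    by (rule rep_of_bounded[OF bv]) blast
  define ring where "ring q r n = ball q r - ball q (r - inverse (real (Suc n)))" for q :: 'w and r :: real and n :: nat
  have ring_small: "AE x in M. \<exists>n. \<bar>rep_of (B \<inter> ring q r n) x\<bar> < e"
    if B: "B \<in> sets borel" and e: "e > 0" for B q r e
  proof (rule rep_of_small[OF _ _ _ e])
    show "range (\<lambda>n. B \<inter> ring q r n) \<subseteq> sets borel" using B by (auto simp: ring_def)
    have "ring q r n \<subseteq> ring q r m" if "m \<le> n" for m n
    proof -
      have "inverse (real (Suc n)) \<le> inverse (real (Suc m))"
        using that by (intro le_imp_inverse_le) simp_all
      then have "ball q (r - inverse (real (Suc m))) \<subseteq> ball q (r - inverse (real (Suc n)))"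
        by (intro subset_ball) linarith
      then show ?thesis unfolding ring_def by blast
    qed
    then show "decseq (\<lambda>n. B \<inter> ring q r n)" unfolding decseq_def by blast
    show "(\<Inter>n. B \<inter> ring q r n) = {}"
    proof (rule equals0I)
      fix w assume w: "w \<in> (\<Inter>n. B \<inter> ring q r n)"
      then have "dist q w < r" by (auto simp: ring_def)
      then have "0 < r - dist q w" by simp
      from reals_Archimedean[OF this] obtain n where "inverse (real (Suc n)) < r - dist q w" by blast
      then have "w \<in> ball q (r - inverse (real (Suc n)))" by (simp add: mem_ball)
      moreover have "w \<in> ring q r n" using w by blast
      ultimately show False by (simp add: ring_def)
    qed
  qed
  \<comment> \<open>Balls, radii, algebra members and tolerances all range over countable sets, so
    almost every point satisfies everything at once. Tolerances \<open>1/(k+1)\<close> stand for all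
    positive ones.\<close>
  define good where "good x \<longleftrightarrow>
    (\<forall>A\<in>ball_alg D. \<forall>B\<in>ball_alg D. A \<inter> B = {} \<longrightarrow> rep_of (A \<union> B) x = rep_of A x + rep_of B x) \<and>
    (\<forall>A\<in>ball_alg D. \<bar>rep_of A x\<bar> \<le> b x) \<and>
    (\<forall>q\<in>D. \<forall>r\<in>\<rat>. \<forall>B\<in>ball_alg D. \<forall>k. \<exists>n. \<bar>rep_of (B \<inter> ring q r n) x\<bar> < inverse (real (Suc k)))" for x
  have good_AE: "AE x in M. good x"
  proof -
    have "AE x in M. \<forall>A\<in>ball_alg D. \<forall>B\<in>ball_alg D. A \<inter> B = {} \<longrightarrow> rep_of (A \<union> B) x = rep_of A x + rep_of B x"
    proof (intro AE_ball_countable[THEN iffD2, OF alg] ballI)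
      fix A B assume A: "A \<in> ball_alg D" and B: "B \<in> ball_alg D"
      show "AE x in M. A \<inter> B = {} \<longrightarrow> rep_of (A \<union> B) x = rep_of A x + rep_of B x"
        using rep_of_Un[OF m[OF A] m[OF B]] by (cases "A \<inter> B = {}") simp_all
    qed
    moreover have "AE x in M. \<forall>A\<in>ball_alg D. \<bar>rep_of A x\<bar> \<le> b x"
      by (intro AE_ball_countable[THEN iffD2, OF alg] ballI b m)
    moreover have "AE x in M. \<forall>q\<in>D. \<forall>r\<in>\<rat>. \<forall>B\<in>ball_alg D. \<forall>k. \<exists>n.
        \<bar>rep_of (B \<inter> ring q r n) x\<bar> < inverse (real (Suc k))"
      by (intro AE_ball_countable[THEN iffD2, OF D] AE_ball_countable[THEN iffD2, OF countable_rat]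
          AE_ball_countable[THEN iffD2, OF alg] ballI AE_all_countable[THEN iffD2] allI ring_small m) simp_all
    ultimately show ?thesis unfolding good_def by eventually_elim blast
  qed
  have ext: "\<exists>\<nu>. bounded_signed \<nu> \<and> (\<forall>A\<in>ball_alg D. \<nu> A = rep_of A x)" if x: "good x" for x
  proof -
    interpret ball_charge D "\<lambda>A. rep_of A x" "b x"
    proof
      show "{} \<in> ball_alg D" unfolding ball_alg_def by (rule gen_alg.empty)
      show "A \<union> B \<in> ball_alg D" if "A \<in> ball_alg D" "B \<in> ball_alg D" for A B
        using that unfolding ball_alg_def by (rule gen_alg.Un)
      show "A - B \<in> ball_alg D" if "A \<in> ball_alg D" "B \<in> ball_alg D" for A B
        using that unfolding ball_alg_def by (rule gen_alg_Diff)
      show "rep_of (A \<union> B) x = rep_of A x + rep_of B x"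
        if "A \<in> ball_alg D" "B \<in> ball_alg D" "A \<inter> B = {}" for A B
        using x that unfolding good_def by blast
      show "\<bar>rep_of A x\<bar> \<le> b x" if "A \<in> ball_alg D" for A
        using x that unfolding good_def by blast
      show "\<exists>n. \<bar>rep_of (B \<inter> (ball q r - ball q (r - inverse (real (Suc n))))) x\<bar> < e"
        if qrB: "q \<in> D" "r \<in> \<rat>" "B \<in> ball_alg D" and e: "0 < e" for q r B e
      proof -
        from reals_Archimedean[OF e] obtain k where k: "inverse (real (Suc k)) < e" by blast
        obtain n where "\<bar>rep_of (B \<inter> ring q r n) x\<bar> < inverse (real (Suc k))"
          using x qrB unfolding good_def by blast
        then have "\<bar>rep_of (B \<inter> ring q r n) x\<bar> < e" using k by linarith
        then show ?thesis unfolding ring_def by blast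
      qed
    qed (rule comp, rule dense)
    show ?thesis by (rule extension)
  qed
  \<comment> \<open>No measurable selection is involved: measurability in \<open>x\<close> is
    derived afterwards from agreement with \<open>rep_of\<close>. The zero measure is a default on
    the exceptional null set.\<close>
  define \<omega> where "\<omega> x = (if good x then SOME \<nu>. bounded_signed \<nu> \<and> (\<forall>A\<in>ball_alg D. \<nu> A = rep_of A x) else (\<lambda>_. 0))" for x
  have \<omega>: "bounded_signed (\<omega> x)" "good x \<Longrightarrow> A \<in> ball_alg D \<Longrightarrow> \<omega> x A = rep_of A x" for x A
    using someI_ex[OF ext[of x]] bounded_signed_zero by (auto simp: \<omega>_def)
  have sm: "signed_measure (\<omega> x)" for x using \<omega>(1) by (simp add: bounded_signed_def)
  have alg_Int: "Int_stable (ball_alg D)"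
  proof (rule Int_stableI)
    fix A B assume "A \<in> ball_alg D" "B \<in> ball_alg D"
    then have "A - (A - B) \<in> ball_alg D" unfolding ball_alg_def by (intro gen_alg_Diff)
    then show "A \<inter> B \<in> ball_alg D" by (simp add: Diff_Diff_Int)
  qed
  \<comment> \<open>The null set may now depend on \<open>A\<close>, so agreement propagates from
    the algebra to all Borel sets by a Dynkin class argument.\<close>
  have key: "AE x in M. rep_of A x = \<omega> x A" if A: "A \<in> sets borel" for A
  proof -
    have gen: "AE x in M. rep_of A x = \<omega> x A" if "A \<in> ball_alg D" for A
      using good_AE by eventually_elim (simp add: \<omega>(2) that)
    note alg_Int
    moreover have "ball_alg D \<subseteq> Pow UNIV" by simp
    moreover have "A \<in> sigma_sets UNIV (ball_alg D)" using A sig by simp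
    ultimately show ?thesis
    proof (induction rule: sigma_sets_induct_disjoint)
      case (basic A)
      then show ?case by (rule gen)
    next
      case empty
      show ?case
        using rep_of_empty by eventually_elim (use sm in \<open>simp add: signed_measure_def\<close>)
    next
      case (compl A)
      have A: "A \<in> sets borel" "UNIV - A \<in> sets borel" using compl(1) sig by auto
      have "UNIV \<in> ball_alg D"
        unfolding ball_alg_def using gen_alg.Compl[OF gen_alg.empty] by simp
      have disj: "A \<inter> (UNIV - A) = {}" and un: "A \<union> (UNIV - A) = UNIV" by blast+
      have add: "\<omega> x UNIV = \<omega> x A + \<omega> x (UNIV - A)" for x
        using signed_measure_additive[OF sm A disj] unfolding un .
      from gen[OF \<open>UNIV \<in> ball_alg D\<close>] rep_of_Un[OF A disj, unfolded un] compl(2) show ?case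
      proof eventually_elim
        case (elim x)
        then show ?case using add[of x] by linarith
      qed
    next
      case (union A)
      have A: "range A \<subseteq> sets borel" using union(2) sig by simp
      have Am: "A n \<in> sets borel" "(\<Union>n. A n) \<in> sets borel" for n using A by auto
      have f: "L0_fun M (\<lambda>x. \<omega> x (A n))" for n
        by (rule L0_fun_AE[OF rep_of(1)[OF Am(1)] union(3)])
      have sums: "(\<lambda>n. \<omega> x (A n)) sums \<omega> x (\<Union>n. A n)" for x
        using sm A union(1) unfolding signed_measure_def by blast
      have g: "L0_fun M (\<lambda>x. \<omega> x (\<Union>n. A n))"
        unfolding L0_fun_real_iff
      proof (rule borel_measurable_LIMSEQ_real)
        show "(\<lambda>n. \<Sum>i<n. \<omega> x (A i)) \<longlonglongrightarrow> \<omega> x (\<Union>n. A n)" for x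
          using sums unfolding sums_def .
        show "(\<lambda>x. \<Sum>i<n. \<omega> x (A i)) \<in> borel_measurable (completion M)" for n
          using f unfolding L0_fun_real_iff by (rule borel_measurable_sum)
      qed
      \<comment> \<open>For \<omega> the series converges at every point, for \<open>rep_of\<close>
        in measure; the terms have the same classes by induction, hence so do the limits.\<close>
      have "L0_sums M (\<lambda>n. ae_class M (\<lambda>x. \<omega> x (A n))) (ae_class M (\<lambda>x. \<omega> x (\<Union>n. A n)))"
        using sums by (intro L0_sumsI f g AE_I2)
      moreover have "ae_class M (\<lambda>x. \<omega> x (A n)) = ae_class M (rep_of (A n))" for n
        by (rule ae_class_cong[OF union(3), symmetric])
      ultimately have "L0_sums M (\<lambda>n. ae_class M (rep_of (A n))) (ae_class M (\<lambda>x. \<omega> x (\<Union>n. A n)))"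
        by simp
      from L0_sums_AE_unique[OF rep_of(2)[OF Am(1)] rep_of(2)[OF Am(2)] g rep_of_sums[OF A union(1)] this]
      show ?case .
    qed
  qed
  have "foliation M \<mu> \<omega>"
    unfolding foliation_def
  proof (intro conjI ballI)
    show "radon (\<omega> x)" for x using \<omega>(1) by (simp add: radon_iff[OF comp])
    fix A :: "'w set" assume A: "A \<in> sets borel"
    show "(\<lambda>x. \<omega> x A) \<in> borel_measurable (completion M)"
      using L0_fun_AE[OF rep_of(1)[OF A] key[OF A]] by (simp add: L0_fun_real_iff)
    show "\<mu> A = ae_class M (\<lambda>x. \<omega> x A)"
      using ae_class_cong[OF key[OF A]] rep_of(3)[OF A] by simp
  qed
  then show ?thesis by (rule exI[of _ \<omega>])
qed

end

lemma foliation_unique: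
  fixes \<mu> :: "'w::metric_space set \<Rightarrow> ('a \<Rightarrow> real) set"
  assumes comp: "compact (UNIV :: 'w set)"
    and \<omega>: "foliation M \<mu> \<omega>" and \<omega>': "foliation M \<mu> \<omega>'"
  shows "AE x in M. \<omega> x = \<omega>' x"
proof -
  obtain D :: "'w set" where D: "countable D" and dense: "\<And>x e. e > 0 \<Longrightarrow> \<exists>q\<in>D. dist q x < e"
    using countable_dense_exists[OF comp] by blast
  have "AE x in M. \<omega> x A = \<omega>' x A" if "A \<in> ball_alg D" for A
  proof (rule ae_class_eqD)
    note m = ball_alg_borel[OF that]
    show "ae_class M (\<lambda>x. \<omega> x A) = ae_class M (\<lambda>x. \<omega>' x A)"
      using foliation_eq[OF comp \<omega> m] foliation_eq[OF comp \<omega>' m] by simp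
    show "L0_fun M (\<lambda>x. \<omega> x A)" by (rule foliation_fun[OF comp \<omega> m])
  qed
  \<comment> \<open>Equality setwise almost everywhere becomes equality of measures almost
    everywhere only because countably many sets are enough to determine a measure.\<close>
  then have "AE x in M. \<forall>A\<in>ball_alg D. \<omega> x A = \<omega>' x A"
    by (simp add: AE_ball_countable countable_ball_alg[OF D])
  then show ?thesis
    using AE_space
  proof eventually_elim
    case (elim x)
    have "signed_measure (\<omega> x)" "signed_measure (\<omega>' x)"
      using foliation_signed[OF comp \<omega> elim(2)] foliation_signed[OF comp \<omega>' elim(2)]
      by (simp_all add: bounded_signed_def)
    then show ?case using elim(1) by (intro bounded_signed_eqI[OF comp dense]) simp_all
  qed
qed

end

section \<open>The isomorphism\<close>

lemma bv_add_le:
  assumes "bounded_signed \<nu>" "bounded_signed \<nu>'"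
  shows "bv (\<lambda>A. \<nu> A + \<nu>' A) A \<le> bv \<nu> A + bv \<nu>' A"
proof -
  obtain b b' c where "charge (sets borel) \<nu> b" "charge (sets borel) \<nu>' b'"
    "charge (sets borel) (\<lambda>A. \<nu> A + \<nu>' A) c"
    using assms bounded_signed_add[OF assms] by (meson bounded_signed_charge)
  then interpret c1: charge "sets borel" \<nu> b + c2: charge "sets borel" \<nu>' b'
    + c3: charge "sets borel" "\<lambda>A. \<nu> A + \<nu>' A" c .
  show ?thesis by (rule c3.pv_least) (intro add_mono c1.pv_upper c2.pv_upper)
qed

lemma tv_add_le:
  assumes "bounded_signed \<nu>" "bounded_signed \<nu>'"
  shows "tv (\<lambda>A. \<nu> A + \<nu>' A) A \<le> tv \<nu> A + tv \<nu>' A"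
  using bv_add_le[OF assms, of A] bv_add_le[OF assms[THEN bounded_signed_uminus], of A]
  unfolding tv_def by simp

lemma bv_scale_le:
  assumes "bounded_signed \<nu>" "0 \<le> c"
  shows "bv (\<lambda>A. c * \<nu> A) A \<le> c * bv \<nu> A"
proof -
  obtain b d where "charge (sets borel) \<nu> b" "charge (sets borel) (\<lambda>A. c * \<nu> A) d"
    using assms(1) bounded_signed_scale[OF assms(1)] by (meson bounded_signed_charge)
  then interpret c1: charge "sets borel" \<nu> b + c2: charge "sets borel" "\<lambda>A. c * \<nu> A" d .
  show ?thesis by (rule c2.pv_least) (intro mult_left_mono c1.pv_upper assms(2))
qed

text \<open>A negative factor exchanges the two Jordan parts, so the nonnegative case is applied to
  \<open>- c\<close>.\<close>

lemma tv_scale_le: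
  assumes \<nu>: "bounded_signed \<nu>"
  shows "tv (\<lambda>A. c * \<nu> A) A \<le> \<bar>c\<bar> * tv \<nu> A"
proof (cases "0 \<le> c")
  case True
  then show ?thesis
    using bv_scale_le[OF \<nu> True, of A] bv_scale_le[OF bounded_signed_uminus[OF \<nu>] True, of A]
    unfolding tv_def by (simp add: distrib_left)
next
  case False
  then have c: "0 \<le> - c" by simp
  show ?thesis
    using bv_scale_le[OF \<nu> c, of A] bv_scale_le[OF bounded_signed_uminus[OF \<nu>] c, of A] False
    unfolding tv_def by (simp add: distrib_left)
qed

text \<open>The reverse inequality is \<open>tv_scale_le\<close> for the inverse factor applied to
  the scaled measure.\<close>

lemma tv_scale:
  assumes \<nu>: "bounded_signed \<nu>"
  shows "tv (\<lambda>A. c * \<nu> A) A = \<bar>c\<bar> * tv \<nu> A"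
proof (rule antisym[OF tv_scale_le[OF \<nu>]])
  show "\<bar>c\<bar> * tv \<nu> A \<le> tv (\<lambda>A. c * \<nu> A) A"
  proof (cases "c = 0")
    case True
    then show ?thesis using tv_nonneg[OF bounded_signed_scale[OF \<nu>, of c], of A] by simp
  next
    case False
    have "tv (\<lambda>A. inverse c * (c * \<nu> A)) A \<le> \<bar>inverse c\<bar> * tv (\<lambda>A. c * \<nu> A) A"
      by (rule tv_scale_le[OF bounded_signed_scale[OF \<nu>]])
    moreover have "inverse c * (c * y) = y" for y
      using False by (simp add: mult.assoc[symmetric])
    ultimately have "\<bar>c\<bar> * tv \<nu> A \<le> \<bar>c\<bar> * (\<bar>inverse c\<bar> * tv (\<lambda>A. c * \<nu> A) A)"
      by (intro mult_left_mono) simp_all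
    also have "\<dots> = tv (\<lambda>A. c * \<nu> A) A"
      using False by (simp add: mult.assoc[symmetric] abs_mult[symmetric])
    finally show ?thesis .
  qed
qed

lemma variation_norm_eq: "bounded_signed \<nu> \<Longrightarrow> variation_norm \<nu> = tv \<nu> UNIV"
  by (simp add: variation_norm_def variation_tv tv_nonneg)

lemma bounded_signed_tv_eq_0_iff:
  assumes \<nu>: "bounded_signed \<nu>"
  shows "tv \<nu> UNIV = 0 \<longleftrightarrow> \<nu> = (\<lambda>A. 0)"
proof
  assume 0: "tv \<nu> UNIV = 0"
  show "\<nu> = (\<lambda>A. 0)"
  proof
    fix A show "\<nu> A = 0"
    proof (cases "A \<in> sets borel")
      case True
      then show ?thesis using abs_le_tv[OF \<nu> True] tv_mono[OF \<nu>, of A UNIV] 0 by simp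
    next
      case False
      then show ?thesis using \<nu> by (simp add: bounded_signed_def signed_measure_def)
    qed
  qed
next
  assume "\<nu> = (\<lambda>A. 0)"
  then show "tv \<nu> UNIV = 0" using tv_scale[OF \<nu>, of 0 UNIV] by simp
qed

section \<open>Weak-star measurable families and the two modules\<close>

context prob_space
begin

context
  assumes comp: "compact (UNIV :: 'w::metric_space set)"
begin

text \<open>In this form membership is exactly what a foliation requires of its family, and closure
  under the pointwise operations is immediate.\<close>

lemma wstar_measurable_iff:
  fixes \<omega> :: "'a \<Rightarrow> 'w set \<Rightarrow> real"
  shows "\<omega> \<in> wstar_measurable M \<longleftrightarrow>
    (\<forall>x\<in>space M. bounded_signed (\<omega> x)) \<and> (\<forall>A\<in>sets borel. L0_fun M (\<lambda>x. \<omega> x A))"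
proof -
  have "(\<forall>v. continuous_on UNIV v \<longrightarrow> (\<lambda>x. pairing (\<omega> x) v) \<in> borel_measurable (completion M)) \<longleftrightarrow>
      (\<forall>A\<in>sets borel. L0_fun M (\<lambda>x. \<omega> x A))" if \<omega>: "\<forall>x\<in>space M. bounded_signed (\<omega> x)"
  proof -
    have \<omega>': "bounded_signed (\<omega> x)" if "x \<in> space (completion M)" for x using \<omega> that by simp
    show ?thesis
      unfolding L0_fun_real_iff
      using pairing_measurable[where N="completion M" and \<omega>=\<omega>, OF comp \<omega>']
        setwise_measurable[where N="completion M" and \<omega>=\<omega>, OF comp \<omega>'] by blast
  qed
  then show ?thesis unfolding wstar_measurable_def radon_iff[OF comp] by blast
qed

lemma wstar_signed: "\<omega> \<in> wstar_measurable M \<Longrightarrow> x \<in> space M \<Longrightarrow> bounded_signed (\<omega> x)"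
  for \<omega> :: "'a \<Rightarrow> 'w set \<Rightarrow> real"
  by (simp add: wstar_measurable_iff)

lemma wstar_fun: "\<omega> \<in> wstar_measurable M \<Longrightarrow> A \<in> sets borel \<Longrightarrow> L0_fun M (\<lambda>x. \<omega> x A)"
  for \<omega> :: "'a \<Rightarrow> 'w set \<Rightarrow> real"
  by (simp add: wstar_measurable_iff)

lemma wstar_zero: "(\<lambda>x A. 0) \<in> (wstar_measurable M :: ('a \<Rightarrow> 'w set \<Rightarrow> real) set)"
  by (simp add: wstar_measurable_iff bounded_signed_zero)

lemma wstar_add:
  fixes \<omega> \<omega>' :: "'a \<Rightarrow> 'w set \<Rightarrow> real"
  shows "\<omega> \<in> wstar_measurable M \<Longrightarrow> \<omega>' \<in> wstar_measurable M \<Longrightarrow> (\<lambda>x A. \<omega> x A + \<omega>' x A) \<in> wstar_measurable M"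
  by (simp add: wstar_measurable_iff bounded_signed_add L0_fun_add)

lemma wstar_smult:
  fixes \<omega> :: "'a \<Rightarrow> 'w set \<Rightarrow> real"
  shows "L0_fun M f \<Longrightarrow> \<omega> \<in> wstar_measurable M \<Longrightarrow> (\<lambda>x A. f x * \<omega> x A) \<in> wstar_measurable M"
  by (simp add: wstar_measurable_iff bounded_signed_scale L0_fun_mult)

lemma wstar_class_cong:
  "AE x in M. \<omega> x = \<omega>' x \<Longrightarrow> wstar_class M \<omega> = wstar_class M \<omega>'"
  unfolding wstar_class_def by (auto elim: eventually_elim2)

lemma rep_wstar_class:
  assumes "\<omega> \<in> wstar_measurable M"
  shows "rep (wstar_class M \<omega>) \<in> wstar_measurable M" "AE x in M. rep (wstar_class M \<omega>) x = \<omega> x"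
proof -
  have "\<omega> \<in> wstar_class M \<omega>" using assms by (simp add: wstar_class_def)
  then have "rep (wstar_class M \<omega>) \<in> wstar_class M \<omega>"
    unfolding rep_def by (rule someI[where P="\<lambda>g. g \<in> wstar_class M \<omega>"])
  then show "rep (wstar_class M \<omega>) \<in> wstar_measurable M" "AE x in M. rep (wstar_class M \<omega>) x = \<omega> x"
    by (simp_all add: wstar_class_def)
qed

lemma wstar_class_eq_iff:
  assumes "\<omega> \<in> wstar_measurable M" "\<omega>' \<in> wstar_measurable M"
  shows "wstar_class M \<omega> = wstar_class M \<omega>' \<longleftrightarrow> (AE x in M. \<omega> x = \<omega>' x)"
proof
  assume eq: "wstar_class M \<omega> = wstar_class M \<omega>'"
  show "AE x in M. \<omega> x = \<omega>' x"
    using rep_wstar_class(2)[OF assms(1)] rep_wstar_class(2)[OF assms(2)]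
    unfolding eq by eventually_elim simp
qed (rule wstar_class_cong)

abbreviation W :: "(('a \<Rightarrow> real) set, ('a \<Rightarrow> 'w set \<Rightarrow> real) set) normed_module" where
  "W \<equiv> L0_wstar_module M"

abbreviation V :: "(('a \<Rightarrow> real) set, 'w set \<Rightarrow> ('a \<Rightarrow> real) set) normed_module" where
  "V \<equiv> L0_radon_module M"

lemma W_simps: "carrier W = wstar_class M ` wstar_measurable M" "\<zero>\<^bsub>W\<^esub> = wstar_class M (\<lambda>x A. 0)"
  by (simp_all add: L0_wstar_module_def)

lemma W_add:
  fixes \<omega> \<omega>' :: "'a \<Rightarrow> 'w set \<Rightarrow> real"
  assumes "\<omega> \<in> wstar_measurable M" "\<omega>' \<in> wstar_measurable M"
  shows "wstar_class M \<omega> \<oplus>\<^bsub>W\<^esub> wstar_class M \<omega>' = wstar_class M (\<lambda>x A. \<omega> x A + \<omega>' x A)"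
proof -
  have "AE x in M. (\<lambda>A. rep (wstar_class M \<omega>) x A + rep (wstar_class M \<omega>') x A) = (\<lambda>A. \<omega> x A + \<omega>' x A)"
    using rep_wstar_class(2)[OF assms(1)] rep_wstar_class(2)[OF assms(2)] by eventually_elim simp
  from wstar_class_cong[OF this] show ?thesis by (simp add: L0_wstar_module_def)
qed

lemma W_smult:
  fixes \<omega> :: "'a \<Rightarrow> 'w set \<Rightarrow> real"
  assumes "L0_fun M f" "\<omega> \<in> wstar_measurable M"
  shows "ae_class M f \<odot>\<^bsub>W\<^esub> wstar_class M \<omega> = wstar_class M (\<lambda>x A. f x * \<omega> x A)"
proof -
  have "AE x in M. (\<lambda>A. rep (ae_class M f) x * rep (wstar_class M \<omega>) x A) = (\<lambda>A. f x * \<omega> x A)"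
    using rep_in(2)[OF assms(1)] rep_wstar_class(2)[OF assms(2)] by eventually_elim simp
  from wstar_class_cong[OF this] show ?thesis by (simp add: L0_wstar_module_def)
qed

lemma W_norm:
  fixes \<omega> :: "'a \<Rightarrow> 'w set \<Rightarrow> real"
  assumes "\<omega> \<in> wstar_measurable M"
  shows "L0_norm W (wstar_class M \<omega>) = ae_class M (\<lambda>x. tv (\<omega> x) UNIV)"
proof -
  have "AE x in M. variation_norm (rep (wstar_class M \<omega>) x) = tv (\<omega> x) UNIV"
    using rep_wstar_class(2)[OF assms] AE_space
    by eventually_elim (simp add: variation_norm_eq wstar_signed[OF assms])
  from ae_class_cong[OF this] show ?thesis by (simp add: L0_wstar_module_def)
qed

lemma wstar_tv_fun:
  fixes \<omega> :: "'a \<Rightarrow> 'w set \<Rightarrow> real"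
  assumes "\<omega> \<in> wstar_measurable M"
  shows "L0_fun M (\<lambda>x. tv (\<omega> x) UNIV)"
  unfolding L0_fun_real_iff
  by (rule tv_measurable[OF comp])
    (simp_all add: wstar_signed[OF assms] wstar_fun[OF assms] L0_fun_real_iff[symmetric])

text \<open>Both modules are images of the same families, with pointwise operations and with a.e.
  equality as the kernel. The axioms are therefore checked once, and then used for
  \<open>wstar_class\<close> and for \<open>integrate\<close>.\<close>

lemma random_normed_module_wstar_image:
  fixes U :: "(('a \<Rightarrow> real) set, 'v) normed_module" and \<pi> :: "('a \<Rightarrow> 'w set \<Rightarrow> real) \<Rightarrow> 'v"
  assumes carrier: "carrier U = \<pi> ` wstar_measurable M" and zero: "\<zero>\<^bsub>U\<^esub> = \<pi> (\<lambda>x A. 0)"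
    and add: "\<And>f g. f \<in> wstar_measurable M \<Longrightarrow> g \<in> wstar_measurable M \<Longrightarrow>
      \<pi> f \<oplus>\<^bsub>U\<^esub> \<pi> g = \<pi> (\<lambda>x A. f x A + g x A)"
    and smult: "\<And>p f. L0_fun M p \<Longrightarrow> f \<in> wstar_measurable M \<Longrightarrow>
      ae_class M p \<odot>\<^bsub>U\<^esub> \<pi> f = \<pi> (\<lambda>x A. p x * f x A)"
    and norm: "\<And>f. f \<in> wstar_measurable M \<Longrightarrow> L0_norm U (\<pi> f) = ae_class M (\<lambda>x. tv (f x) UNIV)"
    and eq: "\<And>f g. f \<in> wstar_measurable M \<Longrightarrow> g \<in> wstar_measurable M \<Longrightarrow>
      \<pi> f = \<pi> g \<longleftrightarrow> (AE x in M. f x = g x)"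
  shows "random_normed_module M U"
proof -
  have I: "\<pi> f \<in> carrier U" if "f \<in> wstar_measurable M" for f using that by (simp add: carrier)
  have E: "\<exists>f. f \<in> wstar_measurable M \<and> c = \<pi> f" if "c \<in> carrier U" for c
    using that by (auto simp: carrier)
  have R: "\<exists>p. L0_fun M p \<and> a = ae_class M p" if "a \<in> carrier (L0_ring M)" for a
    using that by (auto simp: L0_ring_simps elim: L0E)
  have module: "Module.module (L0_ring M) U"
  proof (rule moduleI[OF cring_L0_ring abelian_groupI])
    fix c d e assume "c \<in> carrier U" "d \<in> carrier U" "e \<in> carrier U"
    from this[THEN E] obtain f g h where f: "f \<in> wstar_measurable M" "c = \<pi> f"
      and g: "g \<in> wstar_measurable M" "d = \<pi> g" and h: "h \<in> wstar_measurable M" "e = \<pi> h" by blast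
    show "c \<oplus>\<^bsub>U\<^esub> d \<in> carrier U" using f g by (simp add: add I wstar_add)
    show "c \<oplus>\<^bsub>U\<^esub> d \<oplus>\<^bsub>U\<^esub> e = c \<oplus>\<^bsub>U\<^esub> (d \<oplus>\<^bsub>U\<^esub> e)" using f g h by (simp add: add wstar_add add.assoc)
    show "c \<oplus>\<^bsub>U\<^esub> d = d \<oplus>\<^bsub>U\<^esub> c" using f g by (simp add: add add.commute)
  next
    fix c assume "c \<in> carrier U"
    from E[OF this] obtain f where f: "f \<in> wstar_measurable M" "c = \<pi> f" by blast
    show "\<zero>\<^bsub>U\<^esub> \<oplus>\<^bsub>U\<^esub> c = c" using f by (simp add: zero add wstar_zero)
    \<comment> \<open>Writing the additive inverse as a multiple lets \<open>wstar_smult\<close>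
      supply its membership.\<close>
    have m: "(\<lambda>x A. - 1 * f x A) \<in> wstar_measurable M" by (rule wstar_smult[OF L0_fun_const f(1)])
    have "\<pi> (\<lambda>x A. - 1 * f x A) \<oplus>\<^bsub>U\<^esub> c = \<zero>\<^bsub>U\<^esub>"
      unfolding f(2) add[OF m f(1)] by (simp add: zero)
    then show "\<exists>d\<in>carrier U. d \<oplus>\<^bsub>U\<^esub> c = \<zero>\<^bsub>U\<^esub>" using I[OF m] by (rule bexI)
    show "\<one>\<^bsub>L0_ring M\<^esub> \<odot>\<^bsub>U\<^esub> c = c" using f by (simp add: L0_ring_simps smult)
  next
    show "\<zero>\<^bsub>U\<^esub> \<in> carrier U" unfolding zero by (rule I[OF wstar_zero])
  next
    fix a b c d assume *: "a \<in> carrier (L0_ring M)" "b \<in> carrier (L0_ring M)" "c \<in> carrier U" "d \<in> carrier U"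
    from *(1,2)[THEN R] obtain p q where p: "L0_fun M p" "a = ae_class M p"
      and q: "L0_fun M q" "b = ae_class M q" by blast
    from *(3,4)[THEN E] obtain f g where f: "f \<in> wstar_measurable M" "c = \<pi> f"
      and g: "g \<in> wstar_measurable M" "d = \<pi> g" by blast
    show "(a \<oplus>\<^bsub>L0_ring M\<^esub> b) \<odot>\<^bsub>U\<^esub> c = a \<odot>\<^bsub>U\<^esub> c \<oplus>\<^bsub>U\<^esub> b \<odot>\<^bsub>U\<^esub> c"
      using p q f by (simp add: L0_add_ae_class L0_fun_add smult add wstar_smult distrib_right)
    show "a \<odot>\<^bsub>U\<^esub> (c \<oplus>\<^bsub>U\<^esub> d) = a \<odot>\<^bsub>U\<^esub> c \<oplus>\<^bsub>U\<^esub> a \<odot>\<^bsub>U\<^esub> d"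
      using p f g by (simp add: smult add wstar_smult wstar_add distrib_left)
    show "(a \<otimes>\<^bsub>L0_ring M\<^esub> b) \<odot>\<^bsub>U\<^esub> c = a \<odot>\<^bsub>U\<^esub> (b \<odot>\<^bsub>U\<^esub> c)"
      using p q f by (simp add: L0_mult_ae_class L0_fun_mult smult wstar_smult mult.assoc)
  next
    fix a c assume "a \<in> carrier (L0_ring M)" "c \<in> carrier U"
    from R[OF this(1)] E[OF this(2)] obtain p f where "L0_fun M p" "a = ae_class M p"
      "f \<in> wstar_measurable M" "c = \<pi> f" by blast
    then show "a \<odot>\<^bsub>U\<^esub> c \<in> carrier U" by (simp add: smult I wstar_smult)
  qed
  show ?thesis
    unfolding random_normed_module_def
  proof (intro conjI ballI module)
    fix c assume "c \<in> carrier U"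
    from E[OF this] obtain f where f: "f \<in> wstar_measurable M" "c = \<pi> f" by blast
    note tvf = wstar_tv_fun[OF f(1)]
    have "AE x in M. 0 \<le> tv (f x) UNIV"
      by (rule AE_I2, rule tv_nonneg, rule wstar_signed[OF f(1)])
    then show "L0_norm U c \<in> L0_pos M" unfolding f(2) norm[OF f(1)] L0_pos_iff[OF tvf] .
    have "L0_norm U c = \<zero>\<^bsub>L0_ring M\<^esub> \<longleftrightarrow> (AE x in M. tv (f x) UNIV = 0)"
      unfolding f(2) norm[OF f(1)] L0_ring_simps
      using ae_class_cong[of "\<lambda>x. tv (f x) UNIV" "\<lambda>_. 0" M] ae_class_eqD[OF _ tvf, of "\<lambda>_. 0"] by blast
    also have "\<dots> \<longleftrightarrow> (AE x in M. f x = (\<lambda>A. 0))"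
      by (rule AE_cong) (rule bounded_signed_tv_eq_0_iff[OF wstar_signed[OF f(1)]])
    also have "\<dots> \<longleftrightarrow> c = \<zero>\<^bsub>U\<^esub>"
      unfolding f(2) zero eq[OF f(1) wstar_zero] ..
    finally show "L0_norm U c = \<zero>\<^bsub>L0_ring M\<^esub> \<longleftrightarrow> c = \<zero>\<^bsub>U\<^esub>" .
  next
    fix c d assume "c \<in> carrier U" "d \<in> carrier U"
    from this[THEN E] obtain f g where f: "f \<in> wstar_measurable M" "c = \<pi> f"
      and g: "g \<in> wstar_measurable M" "d = \<pi> g" by blast
    have "AE x in M. tv (\<lambda>A. f x A + g x A) UNIV \<le> tv (f x) UNIV + tv (g x) UNIV"
      by (rule AE_I2) (rule tv_add_le[OF wstar_signed[OF f(1)] wstar_signed[OF g(1)]])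
    then show "L0_le M (L0_norm U (c \<oplus>\<^bsub>U\<^esub> d)) (L0_norm U c \<oplus>\<^bsub>L0_ring M\<^esub> L0_norm U d)"
      unfolding f(2) g(2)
      by (simp add: add f(1) g(1) norm wstar_add L0_add_ae_class wstar_tv_fun L0_le_ae_class L0_fun_add)
  next
    fix a :: "('a \<Rightarrow> real) set" and c assume *: "a \<in> L0 M" "c \<in> carrier U"
    obtain p where p: "L0_fun M p" "a = ae_class M p" using *(1) by (rule L0E)
    from E[OF *(2)] obtain f where f: "f \<in> wstar_measurable M" "c = \<pi> f" by blast
    have "AE x in M. tv (\<lambda>A. p x * f x A) UNIV = \<bar>p x\<bar> * tv (f x) UNIV"
      by (rule AE_I2) (rule tv_scale[OF wstar_signed[OF f(1)]])
    from ae_class_cong[OF this]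
    show "L0_norm U (a \<odot>\<^bsub>U\<^esub> c) = L0_abs M a \<otimes>\<^bsub>L0_ring M\<^esub> L0_norm U c"
      unfolding f(2) p(2)
      by (simp add: smult f(1) p(1) norm wstar_smult L0_abs_ae_class L0_mult_ae_class wstar_tv_fun L0_fun_abs)
  qed
qed

lemma random_normed_module_W: "random_normed_module M W"
  by (rule random_normed_module_wstar_image[OF W_simps W_add W_smult W_norm wstar_class_eq_iff])

section \<open>Radon measures described by their foliations\<close>

lemma foliation_wstar: "foliation M \<mu> \<omega> \<Longrightarrow> \<omega> \<in> wstar_measurable M"
  for \<mu> :: "'w set \<Rightarrow> ('a \<Rightarrow> real) set"
  unfolding wstar_measurable_iff
  using foliation_signed[OF comp] foliation_fun[OF comp] by blast

lemma foliation_iff: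
  fixes \<omega> :: "'a \<Rightarrow> 'w set \<Rightarrow> real"
  shows "foliation M \<mu> \<omega> \<longleftrightarrow> \<omega> \<in> wstar_measurable M \<and> (\<forall>A\<in>sets borel. \<mu> A = ae_class M (\<lambda>x. \<omega> x A))"
  unfolding foliation_def wstar_measurable_iff L0_fun_real_iff radon_iff[OF comp] by blast

lemma L0_radon_iff:
  fixes \<mu> :: "'w set \<Rightarrow> ('a \<Rightarrow> real) set"
  shows "L0_radon M \<mu> \<longleftrightarrow>
    (\<forall>A. A \<notin> sets borel \<longrightarrow> \<mu> A = ae_class M (\<lambda>_. 0)) \<and> (\<exists>\<omega>. foliation M \<mu> \<omega>)"
proof
  assume "L0_radon M \<mu>"
  then have "L0_measure M \<mu>" "L0_bounded_variation M \<mu>" by (simp_all add: L0_radon_def)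
  from foliation_exists[OF this(1) comp this(2)] this(1)
  show "(\<forall>A. A \<notin> sets borel \<longrightarrow> \<mu> A = ae_class M (\<lambda>_. 0)) \<and> (\<exists>\<omega>. foliation M \<mu> \<omega>)"
    by (simp add: L0_measure_def L0_ring_simps)
next
  assume *: "(\<forall>A. A \<notin> sets borel \<longrightarrow> \<mu> A = ae_class M (\<lambda>_. 0)) \<and> (\<exists>\<omega>. foliation M \<mu> \<omega>)"
  then obtain \<omega> where "foliation M \<mu> \<omega>" by blast
  from foliation_imp_L0_radon[OF comp this] * show "L0_radon M \<mu>" by (simp add: L0_ring_simps)
qed

text \<open>The way back from a family to a set function, which inverts the foliation map on
  classes. Through it the structure of \<open>V\<close> is expressed by pointwise operations on
  families.\<close>

definition integrate :: "('a \<Rightarrow> 'w set \<Rightarrow> real) \<Rightarrow> 'w set \<Rightarrow> ('a \<Rightarrow> real) set" where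
  "integrate \<omega> A = ae_class M (\<lambda>x. \<omega> x A)"

lemma integrate_nonborel:
  assumes \<omega>: "\<omega> \<in> wstar_measurable M" and A: "A \<notin> sets borel"
  shows "integrate \<omega> A = ae_class M (\<lambda>_. 0)" "AE x in M. \<omega> x A = 0"
proof -
  show "AE x in M. \<omega> x A = 0"
    using wstar_signed[OF \<omega>] A by (intro AE_I2) (simp add: bounded_signed_def signed_measure_def)
  then show "integrate \<omega> A = ae_class M (\<lambda>_. 0)" unfolding integrate_def by (rule ae_class_cong)
qed

text \<open>All sets \<open>A\<close> have to be covered, Borel or not, because the operations of
  \<open>V\<close> act on functions defined on all sets.\<close>

lemma integrate_fun:
  fixes \<omega> :: "'a \<Rightarrow> 'w set \<Rightarrow> real"
  assumes \<omega>: "\<omega> \<in> wstar_measurable M"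
  shows "L0_fun M (\<lambda>x. \<omega> x A)"
proof (cases "A \<in> sets borel")
  case True
  then show ?thesis by (rule wstar_fun[OF \<omega>])
next
  case False
  have "AE x in M. 0 = \<omega> x A" using integrate_nonborel(2)[OF \<omega> False] by eventually_elim simp
  then show ?thesis by (rule L0_fun_AE[OF borel_measurable_const])
qed

lemma foliation_integrate: "\<omega> \<in> wstar_measurable M \<Longrightarrow> foliation M (integrate \<omega>) \<omega>"
  by (simp add: foliation_iff integrate_def)

lemma V_I: "\<omega> \<in> wstar_measurable M \<Longrightarrow> integrate \<omega> \<in> carrier V"
  using foliation_integrate integrate_nonborel(1) by (auto simp: L0_radon_module_def L0_radon_iff)

lemma V_E:
  assumes "\<mu> \<in> carrier V"
  obtains \<omega> where "\<omega> \<in> wstar_measurable M" "\<mu> = integrate \<omega>"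
proof -
  have \<mu>: "L0_radon M \<mu>" using assms by (simp add: L0_radon_module_def)
  then obtain \<omega> where \<omega>: "foliation M \<mu> \<omega>" by (auto simp: L0_radon_iff)
  have w: "\<omega> \<in> wstar_measurable M" by (rule foliation_wstar[OF \<omega>])
  have "\<mu> A = integrate \<omega> A" for A
  proof (cases "A \<in> sets borel")
    case True
    then show ?thesis using \<omega> by (simp add: foliation_iff integrate_def)
  next
    case False
    then show ?thesis using \<mu> integrate_nonborel(1)[OF w] by (simp add: L0_radon_iff)
  qed
  then show ?thesis using w by (intro that) auto
qed

lemma V_zero: "\<zero>\<^bsub>V\<^esub> = integrate (\<lambda>x A. 0)"
  by (simp add: L0_radon_module_def integrate_def[abs_def] L0_ring_simps)

lemma V_add:
  assumes "\<omega> \<in> wstar_measurable M" "\<omega>' \<in> wstar_measurable M"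
  shows "integrate \<omega> \<oplus>\<^bsub>V\<^esub> integrate \<omega>' = integrate (\<lambda>x A. \<omega> x A + \<omega>' x A)"
  by (simp add: L0_radon_module_def integrate_def[abs_def] L0_add_ae_class integrate_fun assms)

lemma V_smult:
  assumes "L0_fun M f" "\<omega> \<in> wstar_measurable M"
  shows "ae_class M f \<odot>\<^bsub>V\<^esub> integrate \<omega> = integrate (\<lambda>x A. f x * \<omega> x A)"
  by (simp add: L0_radon_module_def integrate_def[abs_def] L0_mult_ae_class integrate_fun assms)

lemma V_norm:
  assumes \<omega>: "\<omega> \<in> wstar_measurable M"
  shows "L0_norm V (integrate \<omega>) = ae_class M (\<lambda>x. tv (\<omega> x) UNIV)"
proof -
  have "L0_variation M (integrate \<omega>) UNIV = ae_class M (\<lambda>x. ereal (tv (\<omega> x) UNIV))"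
    by (rule L0_variation_foliation[OF comp foliation_integrate[OF \<omega>]]) simp
  then show ?thesis
    by (simp add: L0_radon_module_def L0_map_ae_class L0_fun_ereal wstar_tv_fun[OF \<omega>])
qed

text \<open>Uniqueness of foliations makes the definite description in \<open>foliation_map\<close>
  denote.\<close>

lemma foliation_map_integrate:
  assumes \<omega>: "\<omega> \<in> wstar_measurable M"
  shows "foliation_map M (integrate \<omega>) = wstar_class M \<omega>"
  unfolding foliation_map_def
proof (rule the_equality)
  show "\<exists>\<omega>'. foliation M (integrate \<omega>) \<omega>' \<and> wstar_class M \<omega> = wstar_class M \<omega>'"
    using foliation_integrate[OF \<omega>] by blast
  fix c assume "\<exists>\<omega>'. foliation M (integrate \<omega>) \<omega>' \<and> c = wstar_class M \<omega>'"
  then obtain \<omega>' where "foliation M (integrate \<omega>) \<omega>'" "c = wstar_class M \<omega>'" by blast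
  then show "c = wstar_class M \<omega>"
    using wstar_class_cong[OF foliation_unique[OF comp _ foliation_integrate[OF \<omega>]]] by simp
qed

lemma integrate_eq_iff:
  assumes f: "f \<in> wstar_measurable M" and g: "g \<in> wstar_measurable M"
  shows "integrate f = integrate g \<longleftrightarrow> (AE x in M. f x = g x)"
proof
  assume "integrate f = integrate g"
  then show "AE x in M. f x = g x"
    using foliation_unique[OF comp foliation_integrate[OF f]] foliation_integrate[OF g] by simp
next
  assume "AE x in M. f x = g x"
  then have "AE x in M. f x A = g x A" for A by eventually_elim simp
  from ae_class_cong[OF this] show "integrate f = integrate g" unfolding integrate_def[abs_def] by simp
qed

lemma carrier_V: "carrier V = integrate ` wstar_measurable M"
  using V_I by (auto elim: V_E)

lemma random_normed_module_V: "random_normed_module M V"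
  by (rule random_normed_module_wstar_image[OF carrier_V V_zero V_add V_smult V_norm integrate_eq_iff])

text \<open>\<open>integrate\<close> and \<open>wstar_class\<close> identify the same families, so
  passing from one image to the other is well defined and bijective; the operations and the norm
  have the same formulas on both sides.\<close>

lemma foliation_map_isomorphism: "isometric_isomorphism M V W (foliation_map M)"
proof -
  let ?\<phi> = "foliation_map M :: ('w set \<Rightarrow> ('a \<Rightarrow> real) set) \<Rightarrow> _"
  have "inj_on ?\<phi> (carrier V)"
    unfolding carrier_V
    by (rule inj_onI) (auto simp: foliation_map_integrate wstar_class_eq_iff integrate_eq_iff)
  moreover have "?\<phi> ` carrier V = carrier W"
    unfolding carrier_V W_simps image_image
    by (rule image_cong) (simp_all add: foliation_map_integrate)
  ultimately have bij: "bij_betw ?\<phi> (carrier V) (carrier W)" by (simp add: bij_betw_def)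
  have add: "?\<phi> (v \<oplus>\<^bsub>V\<^esub> w) = ?\<phi> v \<oplus>\<^bsub>W\<^esub> ?\<phi> w" if v: "v \<in> carrier V" and w: "w \<in> carrier V" for v w
  proof -
    obtain f where "f \<in> wstar_measurable M" "v = integrate f" using v by (rule V_E)
    moreover obtain g where "g \<in> wstar_measurable M" "w = integrate g" using w by (rule V_E)
    ultimately show ?thesis by (simp add: foliation_map_integrate V_add W_add wstar_add)
  qed
  have smult: "?\<phi> (a \<odot>\<^bsub>V\<^esub> v) = a \<odot>\<^bsub>W\<^esub> ?\<phi> v" if a: "a \<in> L0 M" and v: "v \<in> carrier V" for a v
  proof -
    obtain p where "L0_fun M p" "a = ae_class M p" using a by (rule L0E)
    moreover obtain f where "f \<in> wstar_measurable M" "v = integrate f" using v by (rule V_E)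
    ultimately show ?thesis by (simp add: foliation_map_integrate V_smult W_smult wstar_smult)
  qed
  have norm: "L0_norm W (?\<phi> v) = L0_norm V v" if v: "v \<in> carrier V" for v
  proof -
    obtain f where "f \<in> wstar_measurable M" "v = integrate f" using v by (rule V_E)
    then show ?thesis by (simp add: foliation_map_integrate V_norm W_norm)
  qed
  show ?thesis
    unfolding isometric_isomorphism_def
    by (intro conjI ballI random_normed_module_V random_normed_module_W bij add smult norm)
qed

end

end

theorem theorem5p23:
  fixes M :: "'x measure"
  assumes "prob_space M"
    and "compact (UNIV :: 'w::metric_space set)"
  shows "(\<forall>\<mu> :: 'w set \<Rightarrow> ('x \<Rightarrow> real) set. L0_radon M \<mu> \<longrightarrow>
            (\<exists>\<omega>. foliation M \<mu> \<omega>) \<and>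
            (\<forall>\<omega> \<omega>'. foliation M \<mu> \<omega> \<longrightarrow> foliation M \<mu> \<omega>' \<longrightarrow> (AE x in M. \<omega> x = \<omega>' x))) \<and>
         isometric_isomorphism M
           (L0_radon_module M :: (('x \<Rightarrow> real) set, 'w set \<Rightarrow> ('x \<Rightarrow> real) set) normed_module)
           (L0_wstar_module M)
           (foliation_map M)"
proof -
  interpret prob_space M by fact
  show ?thesis
  proof (intro conjI allI impI)
    fix \<mu> :: "'w set \<Rightarrow> ('x \<Rightarrow> real) set" assume "L0_radon M \<mu>"
    then show "\<exists>\<omega>. foliation M \<mu> \<omega>" by (simp add: L0_radon_iff[OF assms(2)])
  next
    fix \<mu> :: "'w set \<Rightarrow> ('x \<Rightarrow> real) set" and \<omega> \<omega>'
    assume "foliation M \<mu> \<omega>" "foliation M \<mu> \<omega>'"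
    then show "AE x in M. \<omega> x = \<omega>' x" by (rule foliation_unique[OF assms(2)])
  next
    show "isometric_isomorphism M
        (L0_radon_module M :: (('x \<Rightarrow> real) set, 'w set \<Rightarrow> ('x \<Rightarrow> real) set) normed_module)
        (L0_wstar_module M) (foliation_map M)"
      by (rule foliation_map_isomorphism[OF assms(2)])
  qed
qed

end
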